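(* Suppose $\Delta\vdash P$ and $\Delta\vdash Q$ in AW$\pi$. If $[\![P]\!]\approx_{\pi}[\![Q]\!]$, where $[\![\cdot]\!]$ is the translation into the asynchronous $\pi$-calculus and $\approx_\pi$ is weak bisimilarity there, then $P\cong_\Delta Q$.
   Context: The calculus AW$\pi$. Names form a countably infinite set. Besides a distinguished set of success names, every name is either an I-name (only input subject) or an O-name (only output subject). Values $v ::= a \mid \star$. Processes: $P ::= 0 \mid P \mid Q \mid a(x).P \mid \overline{b}\langle v\rangle \mid (\nu\, a \leftrightarrow b : T)P \mid\ !a(x).P$; input and restriction are binders; in $(\nu\, a\leftrightarrow b)P$, $a$ is an I-name and $b$ an O-name. Success names are O-names carrying only $\star$, never restricted; a closed process has only success names free. Types $T ::= o\,T \mid i\,T \mid \mathsf{unit}$ (dual of $o\,T$ is $i\,T$ and vice versa). $I(\Gamma)$ is the set of names with input type in environment $\Gamma$; $\Gamma_1,\Gamma_2$ is defined only if they agree on shared names. Typing rules: $\Gamma\vdash 0$; if $\Gamma_1\vdash P_1$, $\Gamma_2\vdash P_2$, $I(\Gamma_1)\cap I(\Gamma_2)=\emptyset$ then $\Gamma_1,\Gamma_2\vdash P_1\mid P_2$; if $\Gamma,a:i\,T,b:o\,T\vdash P$ then $\Gamma\vdash(\nu\,a\leftrightarrow b:i\,T)P$; $\Gamma,a:o\,T,b:T\vdash \overline{a}\langle b\rangle$; if $\Gamma,a:i\,T,b:T\vdash P$ then $\Gamma,a:i\,T\vdash a(b).P$; if $\Gamma_o,b:T\vdash P$ with $\Gamma_o$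 assigning only output types, then $\Gamma_o,a:i\,T,\Gamma'\vdash\ !a(b).P$. Reduction: structural congruence $\equiv$: $|$ associative, commutative with unit $0$, $P\mid(\nu\,a\leftrightarrow b)Q\equiv(\nu\,a\leftrightarrow b)(P\mid Q)$ if $a,b\notin\mathrm{fn}(P)$, restrictions commute, $(\nu\,a\leftrightarrow b)0\equiv0$. Reduction $\to$ closed under $|$, restriction, $\equiv$, with $(\nu\,a\leftrightarrow b)(a(x).P\mid\overline{b}\langle v\rangle\mid Q)\to(\nu\,a\leftrightarrow b)(P\{v/x\}\mid Q)$ and the analogous rule for $!a(x).P$ (which persists). $\Rightarrow$ is the reflexive-transitive closure. $P\downarrow_\omega$ if $P\equiv\overline{\omega}\langle\star\rangle\mid P'$ ($\omega$ success name), $P\Downarrow_\omega$ if $P\Rightarrow\downarrow_\omega$. Barbed bisimilarity $\approx$: largest symmetric relation on closed processes with $P\downarrow_\omega\Rightarrow Q\Downarrow_\omega$ and $P\to P'\Rightarrow \exists Q\Rightarrow Q', P'\approx Q'$. An extension of $\Delta$ adds only O-names; a context $C$ is closing for $\Delta$ if it is typable under an environment with only success names, the hole being typable under an extension of $\Delta$. For $\Delta\vdash P,Q$: $P\cong_\Delta Q$ iff $C[P]\approx C[Q]$ for all contexts $C$ closing for $\Delta$. Asynchronous $\pi$-calculus: processes $P ::= 0 \mid P\mid Q \mid a(x).P \mid \overline{b}\langle v\rangle \mid (\nu a)P \mid\ !a(x).P$ with the standard (ground) labelled transition system; $\approx_\pi$ denotes ordinary (synchronous) weak bisimilarity on it.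 The translation $[\![\cdot]\!]$ from AW$\pi$ is homomorphic on all constructs except restriction: $[\![(\nu\,a\leftrightarrow b)P]\!]=(\nu b)\big([\![P]\!]\{b/a\}\big)$, i.e. each connected pair is identified with its O-name. *)

theory Defs
  imports Main
begin

section \<open>Names, values, substitutions\<close>

text \<open>
  Processes are taken up to alpha-conversion, via de Bruijn indices: under a binder for
  \<open>k\<close> names, the indices \<open>0, \<dots>, k - 1\<close> stand for the bound names and \<open>Var (n + k)\<close> is the
  name that is called \<open>Var n\<close> outside.  At top level \<open>Var 0, Var 1, \<dots>\<close> are simply the ordinary
  free names.  Success names have a constructor of their own, hence no binder can bind them.

  Whether an ordinary name is an I-name or an O-name is read off its type (input or output type)
  in the typing environment; typable processes use names of input type only as input subjects and
  names of output type only as output subjects.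
\<close>

datatype name = Var nat | Success nat

datatype val = Nm name | Star

fun vsub :: "(nat \<Rightarrow> val) \<Rightarrow> val \<Rightarrow> val" where
  "vsub \<sigma> (Nm (Var n)) = \<sigma> n"
| "vsub \<sigma> (Nm (Success w)) = Nm (Success w)"
| "vsub \<sigma> Star = Star"

definition renaming :: "(nat \<Rightarrow> nat) \<Rightarrow> nat \<Rightarrow> val" where
  "renaming f = (\<lambda>n. Nm (Var (f n)))"

definition lift :: "(nat \<Rightarrow> val) \<Rightarrow> nat \<Rightarrow> val" where
  "lift \<sigma> = (\<lambda>n. case n of 0 \<Rightarrow> Nm (Var 0) | Suc m \<Rightarrow> vsub (renaming Suc) (\<sigma> m))"

text \<open>\<open>inst v\<close> is the substitution \<open>{v/x}\<close> on the body of an input prefix, which is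
  thereby moved out of the scope of the binder \<open>x\<close>.\<close>

definition inst :: "val \<Rightarrow> nat \<Rightarrow> val" where
  "inst v = (\<lambda>n. case n of 0 \<Rightarrow> v | Suc m \<Rightarrow> Nm (Var m))"

fun val_names :: "val \<Rightarrow> name set" where
  "val_names (Nm a) = {a}"
| "val_names Star = {}"

definition unbind :: "name set \<Rightarrow> name set" where
  "unbind A = {Var n |n. Var (Suc n) \<in> A} \<union> {Success w |w. Success w \<in> A}"

section \<open>The calculus AW\<open>\<pi>\<close>\<close>

datatype ty = OT ty | IT ty | UnitT

text \<open>
  \<open>Res T P\<close> is \<open>(\<nu> a \<leftrightarrow> b : T) P\<close>; in \<open>P\<close> the O-name \<open>b\<close> has index \<open>0\<close> and the I-name
  \<open>a\<close> has index \<open>1\<close>.  In \<open>In a P\<close> and \<open>Rep a P\<close> the received name has index \<open>0\<close> in \<open>P\<close>.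

  Subjects range over values rather than names only in order that substitution be total:
  a process with \<open>Star\<close> in subject position is inert and not typable.
\<close>

datatype proc =
    Inert
  | Par proc proc
  | In val proc
  | Out val val
  | Res ty proc
  | Rep val proc

primrec sub :: "(nat \<Rightarrow> val) \<Rightarrow> proc \<Rightarrow> proc" where
  "sub \<sigma> Inert = Inert"
| "sub \<sigma> (Par P Q) = Par (sub \<sigma> P) (sub \<sigma> Q)"
| "sub \<sigma> (In a P) = In (vsub \<sigma> a) (sub (lift \<sigma>) P)"
| "sub \<sigma> (Out a v) = Out (vsub \<sigma> a) (vsub \<sigma> v)"
| "sub \<sigma> (Res T P) = Res T (sub (lift (lift \<sigma>)) P)"
| "sub \<sigma> (Rep a P) = Rep (vsub \<sigma> a) (sub (lift \<sigma>) P)"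

abbreviation ren :: "(nat \<Rightarrow> nat) \<Rightarrow> proc \<Rightarrow> proc" where
  "ren f P \<equiv> sub (renaming f) P"

primrec fn :: "proc \<Rightarrow> name set" where
  "fn Inert = {}"
| "fn (Par P Q) = fn P \<union> fn Q"
| "fn (In a P) = val_names a \<union> unbind (fn P)"
| "fn (Out a v) = val_names a \<union> val_names v"
| "fn (Res T P) = unbind (unbind (fn P))"
| "fn (Rep a P) = val_names a \<union> unbind (fn P)"

definition closed_proc :: "proc \<Rightarrow> bool" where
  "closed_proc P \<longleftrightarrow> fn P \<subseteq> range Success"

subsection \<open>Typing\<close>

type_synonym env = "name \<rightharpoonup> ty"

definition wf_env :: "env \<Rightarrow> bool" where
  "wf_env \<Gamma> \<longleftrightarrow> finite (dom \<Gamma>) \<and> (\<forall>w. Success w \<in> dom \<Gamma> \<longrightarrow> \<Gamma> (Success w) = Some (OT UnitT))"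

definition inames :: "env \<Rightarrow> name set" where
  "inames \<Gamma> = {a. \<exists>T. \<Gamma> a = Some (IT T)}"

definition only_outputs :: "env \<Rightarrow> bool" where
  "only_outputs \<Gamma> \<longleftrightarrow> (\<forall>a\<in>dom \<Gamma>. \<exists>T. \<Gamma> a = Some (OT T))"

definition agree :: "env \<Rightarrow> env \<Rightarrow> bool" where
  "agree \<Gamma>\<^sub>1 \<Gamma>\<^sub>2 \<longleftrightarrow> (\<forall>a\<in>dom \<Gamma>\<^sub>1 \<inter> dom \<Gamma>\<^sub>2. \<Gamma>\<^sub>1 a = \<Gamma>\<^sub>2 a)"

fun val_ty :: "env \<Rightarrow> val \<Rightarrow> ty option" where
  "val_ty \<Gamma> (Nm a) = \<Gamma> a"
| "val_ty \<Gamma> Star = Some UnitT"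

text \<open>\<open>bind T \<Gamma>\<close> is \<open>\<Gamma>, x : T\<close> for a newly bound \<open>x\<close>, which receives index \<open>0\<close>.\<close>

definition bind :: "ty \<Rightarrow> env \<Rightarrow> env" where
  "bind T \<Gamma> = (\<lambda>a. case a of
      Var n \<Rightarrow> (case n of 0 \<Rightarrow> Some T | Suc m \<Rightarrow> \<Gamma> (Var m))
    | Success w \<Rightarrow> \<Gamma> (Success w))"

inductive typed :: "env \<Rightarrow> proc \<Rightarrow> bool" (infix "\<turnstile>" 50) where
  typed_Inert: "wf_env \<Gamma> \<Longrightarrow> \<Gamma> \<turnstile> Inert"
| typed_Par:
    "\<lbrakk>\<Gamma>\<^sub>1 \<turnstile> P\<^sub>1; \<Gamma>\<^sub>2 \<turnstile> P\<^sub>2; agree \<Gamma>\<^sub>1 \<Gamma>\<^sub>2; inames \<Gamma>\<^sub>1 \<inter> inames \<Gamma>\<^sub>2 = {}\<rbrakk>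
     \<Longrightarrow> \<Gamma>\<^sub>1 ++ \<Gamma>\<^sub>2 \<turnstile> Par P\<^sub>1 P\<^sub>2"
| typed_Res: "bind (OT T) (bind (IT T) \<Gamma>) \<turnstile> P \<Longrightarrow> \<Gamma> \<turnstile> Res (IT T) P"
| typed_Out:
    "\<lbrakk>wf_env \<Gamma>; \<Gamma> a = Some (OT T); val_ty \<Gamma> v = Some T\<rbrakk> \<Longrightarrow> \<Gamma> \<turnstile> Out (Nm a) v"
| typed_In: "\<lbrakk>\<Gamma> a = Some (IT T); bind T \<Gamma> \<turnstile> P\<rbrakk> \<Longrightarrow> \<Gamma> \<turnstile> In (Nm a) P"
| typed_Rep:
    "\<lbrakk>bind T \<Gamma>\<^sub>o \<turnstile> P; only_outputs \<Gamma>\<^sub>o; wf_env \<Gamma>; \<Gamma>\<^sub>o \<subseteq>\<^sub>m \<Gamma>; \<Gamma> a = Some (IT T)\<rbrakk>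
     \<Longrightarrow> \<Gamma> \<turnstile> Rep (Nm a) P"

subsection \<open>Reduction and barbed bisimilarity\<close>

definition swap_pairs :: "nat \<Rightarrow> nat" where
  "swap_pairs n = (if n < 2 then n + 2 else if n < 4 then n - 2 else n)"

inductive scong :: "proc \<Rightarrow> proc \<Rightarrow> bool" (infix "\<simeq>" 50) where
  sc_refl: "P \<simeq> P"
| sc_sym: "P \<simeq> Q \<Longrightarrow> Q \<simeq> P"
| sc_trans: "P \<simeq> Q \<Longrightarrow> Q \<simeq> R \<Longrightarrow> P \<simeq> R"
| sc_Par: "P \<simeq> P' \<Longrightarrow> Q \<simeq> Q' \<Longrightarrow> Par P Q \<simeq> Par P' Q'"
| sc_In: "P \<simeq> P' \<Longrightarrow> In a P \<simeq> In a P'"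
| sc_Res: "P \<simeq> P' \<Longrightarrow> Res T P \<simeq> Res T P'"
| sc_Rep: "P \<simeq> P' \<Longrightarrow> Rep a P \<simeq> Rep a P'"
| sc_assoc: "Par (Par P Q) R \<simeq> Par P (Par Q R)"
| sc_comm: "Par P Q \<simeq> Par Q P"
| sc_unit: "Par P Inert \<simeq> P"
| sc_extrude: "Par P (Res T Q) \<simeq> Res T (Par (ren (\<lambda>n. n + 2) P) Q)"
| sc_swap: "Res S (Res T P) \<simeq> Res T (Res S (ren swap_pairs P))"
| sc_gc: "Res T Inert \<simeq> Inert"

inductive red :: "proc \<Rightarrow> proc \<Rightarrow> bool" (infix "\<longmapsto>" 50) where
  red_In:
    "Res T (Par (In (Nm (Var 1)) P) (Par (Out (Nm (Var 0)) v) Q))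
     \<longmapsto> Res T (Par (sub (inst v) P) Q)"
| red_Rep:
    "Res T (Par (Rep (Nm (Var 1)) P) (Par (Out (Nm (Var 0)) v) Q))
     \<longmapsto> Res T (Par (Rep (Nm (Var 1)) P) (Par (sub (inst v) P) Q))"
| red_Par: "P \<longmapsto> P' \<Longrightarrow> Par P Q \<longmapsto> Par P' Q"
| red_Res: "P \<longmapsto> P' \<Longrightarrow> Res T P \<longmapsto> Res T P'"
| red_scong: "\<lbrakk>P \<simeq> Q; Q \<longmapsto> Q'; Q' \<simeq> P'\<rbrakk> \<Longrightarrow> P \<longmapsto> P'"

abbreviation reds :: "proc \<Rightarrow> proc \<Rightarrow> bool" (infix "\<longmapsto>*" 50) where
  "P \<longmapsto>* Q \<equiv> red\<^sup>*\<^sup>* P Q"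

definition barb :: "proc \<Rightarrow> nat \<Rightarrow> bool" where
  "barb P w \<longleftrightarrow> (\<exists>P'. P \<simeq> Par (Out (Nm (Success w)) Star) P')"

definition weak_barb :: "proc \<Rightarrow> nat \<Rightarrow> bool" where
  "weak_barb P w \<longleftrightarrow> (\<exists>P'. P \<longmapsto>* P' \<and> barb P' w)"

definition barbed_bisimulation :: "(proc \<Rightarrow> proc \<Rightarrow> bool) \<Rightarrow> bool" where
  "barbed_bisimulation R \<longleftrightarrow> symp R \<and>
     (\<forall>P Q. R P Q \<longrightarrow>
        closed_proc P \<and> closed_proc Q \<and>
        (\<forall>w. barb P w \<longrightarrow> weak_barb Q w) \<and>
        (\<forall>P'. P \<longmapsto> P' \<longrightarrow> (\<exists>Q'. Q \<longmapsto>* Q' \<and> R P' Q')))"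

definition barbed_bisimilar :: "proc \<Rightarrow> proc \<Rightarrow> bool" (infix "\<approx>" 50) where
  "P \<approx> Q \<longleftrightarrow> (\<exists>R. barbed_bisimulation R \<and> R P Q)"

subsection \<open>Contexts and barbed congruence\<close>

text \<open>
  The binders of a context must capture names of the process put in the hole, so contexts are
  not taken up to alpha-conversion: \<open>CIn v x C\<close>, \<open>CRep v x C\<close> and \<open>CRes a b T C\<close> bind the
  names \<open>Var x\<close>, resp. \<open>Var a\<close> and \<open>Var b\<close>.  Filling the hole uses the named binding operations
  \<open>abs1 x P\<close> and \<open>abs2 a b P\<close>, which turn these names into the indices of the bound names.
\<close>

datatype ctx =
    Hole
  | CParL ctx proc
  | CParR proc ctx
  | CIn val nat ctx
  | CRes nat nat ty ctx
  | CRep val nat ctx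

definition abs1 :: "nat \<Rightarrow> proc \<Rightarrow> proc" where
  "abs1 x P = ren (\<lambda>n. if n = x then 0 else n + 1) P"

definition abs2 :: "nat \<Rightarrow> nat \<Rightarrow> proc \<Rightarrow> proc" where
  "abs2 a b P = ren (\<lambda>n. if n = b then 0 else if n = a then 1 else n + 2) P"

primrec fill :: "ctx \<Rightarrow> proc \<Rightarrow> proc" where
  "fill Hole P = P"
| "fill (CParL C Q) P = Par (fill C P) Q"
| "fill (CParR Q C) P = Par Q (fill C P)"
| "fill (CIn v x C) P = In v (abs1 x (fill C P))"
| "fill (CRes a b T C) P = Res T (abs2 a b (fill C P))"
| "fill (CRep v x C) P = Rep v (abs1 x (fill C P))"

text \<open>An extension of \<open>\<Delta>\<close> adds only names that are not of input type.  Names of type \<open>UnitT\<close>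
  are never subjects, so they may be taken as O-names and may be added too.\<close>

definition extends :: "env \<Rightarrow> env \<Rightarrow> bool" where
  "extends \<Gamma> \<Delta> \<longleftrightarrow> \<Delta> \<subseteq>\<^sub>m \<Gamma> \<and> inames \<Gamma> = inames \<Delta>"

text \<open>\<open>ctx_typed \<Delta> \<Gamma> C\<close>: the context \<open>C\<close> is typable under \<open>\<Gamma>\<close> when the hole is typable under
  an extension of \<open>\<Delta>\<close>.\<close>

inductive ctx_typed :: "env \<Rightarrow> env \<Rightarrow> ctx \<Rightarrow> bool" for \<Delta> where
  ctx_Hole: "\<lbrakk>wf_env \<Gamma>; extends \<Gamma> \<Delta>\<rbrakk> \<Longrightarrow> ctx_typed \<Delta> \<Gamma> Hole"
| ctx_ParL:
    "\<lbrakk>ctx_typed \<Delta> \<Gamma>\<^sub>1 C; \<Gamma>\<^sub>2 \<turnstile> Q; agree \<Gamma>\<^sub>1 \<Gamma>\<^sub>2; inames \<Gamma>\<^sub>1 \<inter> inames \<Gamma>\<^sub>2 = {}\<rbrakk>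
     \<Longrightarrow> ctx_typed \<Delta> (\<Gamma>\<^sub>1 ++ \<Gamma>\<^sub>2) (CParL C Q)"
| ctx_ParR:
    "\<lbrakk>\<Gamma>\<^sub>1 \<turnstile> Q; ctx_typed \<Delta> \<Gamma>\<^sub>2 C; agree \<Gamma>\<^sub>1 \<Gamma>\<^sub>2; inames \<Gamma>\<^sub>1 \<inter> inames \<Gamma>\<^sub>2 = {}\<rbrakk>
     \<Longrightarrow> ctx_typed \<Delta> (\<Gamma>\<^sub>1 ++ \<Gamma>\<^sub>2) (CParR Q C)"
| ctx_Res:
    "\<lbrakk>ctx_typed \<Delta> (\<Gamma>(Var a \<mapsto> IT T, Var b \<mapsto> OT T)) C;
      a \<noteq> b; Var a \<notin> dom \<Gamma>; Var b \<notin> dom \<Gamma>\<rbrakk>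
     \<Longrightarrow> ctx_typed \<Delta> \<Gamma> (CRes a b (IT T) C)"
| ctx_In:
    "\<lbrakk>\<Gamma> a = Some (IT T); ctx_typed \<Delta> (\<Gamma>(Var x \<mapsto> T)) C; Var x \<notin> dom \<Gamma>\<rbrakk>
     \<Longrightarrow> ctx_typed \<Delta> \<Gamma> (CIn (Nm a) x C)"
| ctx_Rep:
    "\<lbrakk>ctx_typed \<Delta> (\<Gamma>\<^sub>o(Var x \<mapsto> T)) C; Var x \<notin> dom \<Gamma>\<^sub>o; only_outputs \<Gamma>\<^sub>o;
      wf_env \<Gamma>; \<Gamma>\<^sub>o \<subseteq>\<^sub>m \<Gamma>; \<Gamma> a = Some (IT T)\<rbrakk>
     \<Longrightarrow> ctx_typed \<Delta> \<Gamma> (CRep (Nm a) x C)"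

definition closing :: "env \<Rightarrow> ctx \<Rightarrow> bool" where
  "closing \<Delta> C \<longleftrightarrow> (\<exists>\<Gamma>. wf_env \<Gamma> \<and> dom \<Gamma> \<subseteq> range Success \<and> ctx_typed \<Delta> \<Gamma> C)"

definition barbed_congruent :: "env \<Rightarrow> proc \<Rightarrow> proc \<Rightarrow> bool" where
  "barbed_congruent \<Delta> P Q \<longleftrightarrow>
     \<Delta> \<turnstile> P \<and> \<Delta> \<turnstile> Q \<and> (\<forall>C. closing \<Delta> C \<longrightarrow> fill C P \<approx> fill C Q)"

section \<open>The asynchronous \<open>\<pi>\<close>-calculus\<close>

text \<open>In \<open>PIn a P\<close>, \<open>PRep a P\<close> and \<open>PNu P\<close> the bound name has index \<open>0\<close> in \<open>P\<close>.\<close>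

datatype pi =
    PInert
  | PPar pi pi
  | PIn val pi
  | POut val val
  | PNu pi
  | PRep val pi

primrec psub :: "(nat \<Rightarrow> val) \<Rightarrow> pi \<Rightarrow> pi" where
  "psub \<sigma> PInert = PInert"
| "psub \<sigma> (PPar P Q) = PPar (psub \<sigma> P) (psub \<sigma> Q)"
| "psub \<sigma> (PIn a P) = PIn (vsub \<sigma> a) (psub (lift \<sigma>) P)"
| "psub \<sigma> (POut a v) = POut (vsub \<sigma> a) (vsub \<sigma> v)"
| "psub \<sigma> (PNu P) = PNu (psub (lift \<sigma>) P)"
| "psub \<sigma> (PRep a P) = PRep (vsub \<sigma> a) (psub (lift \<sigma>) P)"

abbreviation pren :: "(nat \<Rightarrow> nat) \<Rightarrow> pi \<Rightarrow> pi" where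
  "pren f P \<equiv> psub (renaming f) P"

text \<open>
  The ground transition system.  \<open>LIn a\<close> is the input \<open>a(x)\<close> of a fresh name \<open>x\<close> and \<open>LBOut a\<close>
  the bound output \<open>(\<nu> x) a\<langle>x\<rangle>\<close> (with \<open>a\<close> as output subject); the derivative of such a
  transition is in the scope of \<open>x\<close>, which has index \<open>0\<close>.  Hence the usual freshness conditions
  on \<open>x\<close> turn into shifts.
\<close>

datatype label = LTau | LIn name | LOut name val | LBOut name

fun shift_name :: "name \<Rightarrow> name" where
  "shift_name (Var n) = Var (Suc n)"
| "shift_name (Success w) = Success w"

fun shift_label :: "label \<Rightarrow> label" where
  "shift_label LTau = LTau"
| "shift_label (LIn a) = LIn (shift_name a)"
| "shift_label (LOut a v) = LOut (shift_name a) (vsub (renaming Suc) v)"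
| "shift_label (LBOut a) = LBOut (shift_name a)"

fun binds :: "label \<Rightarrow> bool" where
  "binds LTau = False"
| "binds (LIn a) = True"
| "binds (LOut a v) = False"
| "binds (LBOut a) = True"

definition under :: "label \<Rightarrow> pi \<Rightarrow> pi" where
  "under l P = (if binds l then pren Suc P else P)"

definition swap01 :: "nat \<Rightarrow> nat" where
  "swap01 n = (if n = 0 then 1 else if n = 1 then 0 else n)"

inductive trans_pi :: "pi \<Rightarrow> label \<Rightarrow> pi \<Rightarrow> bool" where
  tr_In: "trans_pi (PIn (Nm a) P) (LIn a) P"
| tr_Rep: "trans_pi (PRep (Nm a) P) (LIn a) (PPar P (pren Suc (PRep (Nm a) P)))"
| tr_Out: "trans_pi (POut (Nm a) v) (LOut a v) PInert"
| tr_ParL: "trans_pi P l P' \<Longrightarrow> trans_pi (PPar P Q) l (PPar P' (under l Q))"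
| tr_ParR: "trans_pi Q l Q' \<Longrightarrow> trans_pi (PPar P Q) l (PPar (under l P) Q')"
| tr_ComL:
    "\<lbrakk>trans_pi P (LIn a) P'; trans_pi Q (LOut a v) Q'\<rbrakk>
     \<Longrightarrow> trans_pi (PPar P Q) LTau (PPar (psub (inst v) P') Q')"
| tr_ComR:
    "\<lbrakk>trans_pi P (LOut a v) P'; trans_pi Q (LIn a) Q'\<rbrakk>
     \<Longrightarrow> trans_pi (PPar P Q) LTau (PPar P' (psub (inst v) Q'))"
| tr_CloseL:
    "\<lbrakk>trans_pi P (LIn a) P'; trans_pi Q (LBOut a) Q'\<rbrakk>
     \<Longrightarrow> trans_pi (PPar P Q) LTau (PNu (PPar P' Q'))"
| tr_CloseR:
    "\<lbrakk>trans_pi P (LBOut a) P'; trans_pi Q (LIn a) Q'\<rbrakk>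
     \<Longrightarrow> trans_pi (PPar P Q) LTau (PNu (PPar P' Q'))"
| tr_Res:
    "trans_pi P (shift_label l) P'
     \<Longrightarrow> trans_pi (PNu P) l (PNu (if binds l then pren swap01 P' else P'))"
| tr_Open:
    "trans_pi P (LOut (shift_name a) (Nm (Var 0))) P' \<Longrightarrow> trans_pi (PNu P) (LBOut a) P'"

definition taus :: "pi \<Rightarrow> pi \<Rightarrow> bool" where
  "taus = (\<lambda>P Q. trans_pi P LTau Q)\<^sup>*\<^sup>*"

definition weak_trans :: "pi \<Rightarrow> label \<Rightarrow> pi \<Rightarrow> bool" where
  "weak_trans P l Q \<longleftrightarrow>
     (if l = LTau then taus P Q
      else \<exists>P' Q'. taus P P' \<and> trans_pi P' l Q' \<and> taus Q' Q)"

definition weak_bisimulation :: "(pi \<Rightarrow> pi \<Rightarrow> bool) \<Rightarrow> bool" where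
  "weak_bisimulation R \<longleftrightarrow> symp R \<and>
     (\<forall>P Q l P'. R P Q \<longrightarrow> trans_pi P l P' \<longrightarrow> (\<exists>Q'. weak_trans Q l Q' \<and> R P' Q'))"

definition weak_bisimilar :: "pi \<Rightarrow> pi \<Rightarrow> bool" (infix "\<approx>\<^sub>\<pi>" 50) where
  "P \<approx>\<^sub>\<pi> Q \<longleftrightarrow> (\<exists>R. weak_bisimulation R \<and> R P Q)"

section \<open>The translation\<close>

text \<open>\<open>identify\<close> is the substitution \<open>{b/a}\<close> for the pair bound by a restriction
  (\<open>b\<close> has index \<open>0\<close>, \<open>a\<close> has index \<open>1\<close>); its result is in the scope of \<open>b\<close> alone.\<close>

definition identify :: "nat \<Rightarrow> nat" where
  "identify n = n - 1"

primrec translate :: "proc \<Rightarrow> pi" where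
  "translate Inert = PInert"
| "translate (Par P Q) = PPar (translate P) (translate Q)"
| "translate (In a P) = PIn a (translate P)"
| "translate (Out a v) = POut a v"
| "translate (Res T P) = PNu (pren identify (translate P))"
| "translate (Rep a P) = PRep a (translate P)"

end

theory Submission
  imports Defs
begin

text \<open>
  The translation turns reductions into internal steps and, on typed processes, reflects them, since
  a name is an input subject or an output subject according to its type.  So it suffices that
  \<open>\<approx>\<^sub>\<pi>\<close> is preserved by the translated contexts.  The hard part is closure under substitutions, which
  the identification of the two names of a restriction and the received values call for: a
  substitution may identify the subject of an output with that of an input.  In the asynchronous
  calculus this is harmless: an output has no continuation and floats at top level, so the new
  communication is simulated by the output followed by the input, both of which are visible before
  the substitution and hence matched by bisimilarity.

  Closure fails when \<open>Star\<close> is substituted for a channel: this disables communications on it.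
  Therefore the congruence argument takes place under a simple type discipline (without the linearity
  of input names), which ensures that \<open>Star\<close> replaces only names that are never subjects.
\<close>

section \<open>Substitutions and structural congruence of the \<open>\<pi>\<close>-calculus\<close>

text \<open>The candidate bisimulation must be closed at once under substitution, parallel
  composition and restriction, because these produce each other: a value received from the
  environment is a further substitution, and the communication of a private name puts a restriction
  around both partners. Input and replication can be treated afterwards, when closure under
  substitution is available for the copies that a replication spawns.

  The analysis \<open>trans_psub_inv\<close> of the transitions of a substituted process serves
  twice. For a typed \<open>\<sigma>\<close> it carries the congruence argument. For the renaming
  \<open>identify\<close> it carries the reflection of internal steps: in a polarised process every
  communication is created by merging the two ends of a pair.

  An output can be replayed after internal steps only up to structural congruence, which is
  therefore shown to be a strong bisimulation beforehand. There are two type systems: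
  \<open>ok\<close> keeps the polarity of names and serves the reflection, whereas
  \<open>pok\<close> on translations forgets it, as both ends of a pair become one channel.\<close>

lemma vsub_vsub: "vsub \<sigma> (vsub \<tau> v) = vsub (\<lambda>n. vsub \<sigma> (\<tau> n)) v"
  by (cases "(\<tau>, v)" rule: vsub.cases) auto

lemma vsub_id [simp]: "vsub (\<lambda>n. Nm (Var n)) v = v"
  by (cases "(\<lambda>n. Nm (Var n), v)" rule: vsub.cases) auto

lemma lift_0 [simp]: "lift \<sigma> 0 = Nm (Var 0)"
  by (simp add: lift_def)

lemma lift_Suc [simp]: "lift \<sigma> (Suc n) = vsub (renaming Suc) (\<sigma> n)"
  by (simp add: lift_def)

lemma inst_0 [simp]: "inst v 0 = v"
  by (simp add: inst_def)

lemma inst_Suc [simp]: "inst v (Suc n) = Nm (Var n)"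
  by (simp add: inst_def)

lemma renaming_app [simp]: "renaming f n = Nm (Var (f n))"
  by (simp add: renaming_def)

lemma vsub_lift_shift: "vsub (lift \<sigma>) (vsub (renaming Suc) v) = vsub (renaming Suc) (vsub \<sigma> v)"
  by (simp add: vsub_vsub)

lemma lift_comp: "lift (\<lambda>n. vsub \<sigma> (\<tau> n)) = (\<lambda>n. vsub (lift \<sigma>) (lift \<tau> n))"
  by (rule ext) (auto simp: lift_def[of "\<lambda>n. vsub \<sigma> (\<tau> n)"] vsub_lift_shift split: nat.splits)

text \<open>As a simp rule it fuses nested substitutions, so that an equation between renamed
  processes becomes a pointwise check of indices. Proofs that must keep the nested shape, to match a
  transition or a rule of \<open>peq\<close>, switch it off.\<close>

lemma psub_psub [simp]: "psub \<sigma> (psub \<tau> P) = psub (\<lambda>n. vsub \<sigma> (\<tau> n)) P"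
  by (induction P arbitrary: \<sigma> \<tau>) (simp_all add: vsub_vsub lift_comp)

lemma sub_sub [simp]: "sub \<sigma> (sub \<tau> P) = sub (\<lambda>n. vsub \<sigma> (\<tau> n)) P"
  by (induction P arbitrary: \<sigma> \<tau>) (simp_all add: vsub_vsub lift_comp)

lemma lift_id: "lift (\<lambda>n. Nm (Var n)) = (\<lambda>n. Nm (Var n))"
  by (rule ext) (auto simp: lift_def renaming_def split: nat.splits)

lemma psub_id [simp]: "psub (\<lambda>n. Nm (Var n)) P = P"
  by (induction P) (simp_all add: lift_id)

lemma sub_id [simp]: "sub (\<lambda>n. Nm (Var n)) P = P"
  by (induction P) (simp_all add: lift_id)

lemma psub_cong: "(\<And>n. \<sigma> n = \<tau> n) \<Longrightarrow> psub \<sigma> P = psub \<tau> P"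
  by (metis ext)

lemma psub_eq_id: "(\<And>n. \<sigma> n = Nm (Var n)) \<Longrightarrow> psub \<sigma> P = P"
  by (metis psub_id psub_cong)

lemma swap01_simps [simp]: "swap01 0 = Suc 0" "swap01 (Suc 0) = 0" "swap01 (Suc (Suc n)) = Suc (Suc n)"
  by (simp_all add: swap01_def)

lemma swap_pairs_simps [simp]:
  "swap_pairs 0 = 2" "swap_pairs (Suc 0) = 3" "swap_pairs (Suc (Suc 0)) = 0"
  "swap_pairs (Suc (Suc (Suc 0))) = 1" "swap_pairs (Suc (Suc (Suc (Suc n)))) = Suc (Suc (Suc (Suc n)))"
  by (simp_all add: swap_pairs_def)

lemma nat_cases_2:
  obtains "n = 0" | "n = Suc 0" | m where "n = Suc (Suc m)"
  by (metis not0_implies_Suc)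

lemma lift_lift_swap: "lift (lift \<sigma>) (swap01 n) = vsub (renaming swap01) (lift (lift \<sigma>) n)"
  by (cases n rule: nat_cases_2) (auto simp: vsub_vsub)

text \<open>It absorbs what transitions leave behind: inert residues of outputs, rebracketing and
  displaced restrictions. With indices, the exchange of two adjacent binders shows up as
  \<open>swap01\<close>.\<close>

inductive peq :: "pi \<Rightarrow> pi \<Rightarrow> bool" (infix "\<equiv>\<^sub>\<pi>" 50) where
  peq_refl [simp]: "P \<equiv>\<^sub>\<pi> P"
| peq_sym: "P \<equiv>\<^sub>\<pi> Q \<Longrightarrow> Q \<equiv>\<^sub>\<pi> P"
| peq_trans [trans]: "P \<equiv>\<^sub>\<pi> Q \<Longrightarrow> Q \<equiv>\<^sub>\<pi> R \<Longrightarrow> P \<equiv>\<^sub>\<pi> R"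
| peq_Par: "P \<equiv>\<^sub>\<pi> P' \<Longrightarrow> Q \<equiv>\<^sub>\<pi> Q' \<Longrightarrow> PPar P Q \<equiv>\<^sub>\<pi> PPar P' Q'"
| peq_In: "P \<equiv>\<^sub>\<pi> P' \<Longrightarrow> PIn a P \<equiv>\<^sub>\<pi> PIn a P'"
| peq_Nu: "P \<equiv>\<^sub>\<pi> P' \<Longrightarrow> PNu P \<equiv>\<^sub>\<pi> PNu P'"
| peq_Rep: "P \<equiv>\<^sub>\<pi> P' \<Longrightarrow> PRep a P \<equiv>\<^sub>\<pi> PRep a P'"
| peq_assoc: "PPar (PPar P Q) R \<equiv>\<^sub>\<pi> PPar P (PPar Q R)"
| peq_comm: "PPar P Q \<equiv>\<^sub>\<pi> PPar Q P"
| peq_unit: "PPar P PInert \<equiv>\<^sub>\<pi> P"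
| peq_extrude: "PPar P (PNu Q) \<equiv>\<^sub>\<pi> PNu (PPar (pren Suc P) Q)"
| peq_swap: "PNu (PNu P) \<equiv>\<^sub>\<pi> PNu (PNu (pren swap01 P))"
| peq_gc: "PNu PInert \<equiv>\<^sub>\<pi> PInert"

lemma peq_psub: "P \<equiv>\<^sub>\<pi> Q \<Longrightarrow> psub \<sigma> P \<equiv>\<^sub>\<pi> psub \<sigma> Q"
proof (induction arbitrary: \<sigma> rule: peq.induct)
  case (peq_extrude P Q)
  have *: "psub \<sigma> (PNu (PPar (pren Suc P) Q)) = PNu (PPar (pren Suc (psub \<sigma> P)) (psub (lift \<sigma>) Q))"
    by (simp add: vsub_vsub)
  show ?case by (subst *) (simp only: psub.simps peq.peq_extrude)
next
  case (peq_swap P)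
  have *: "psub \<sigma> (PNu (PNu (pren swap01 P))) = PNu (PNu (pren swap01 (psub (lift (lift \<sigma>)) P)))"
    by (simp add: lift_lift_swap)
  show ?case by (subst *) (simp only: psub.simps peq.peq_swap)
qed (auto intro: peq.intros)

lemma peq_extrude_left: "PPar (PNu P) Q \<equiv>\<^sub>\<pi> PNu (PPar P (pren Suc Q))"
  by (meson peq.intros)

lemma peq_left_commute: "PPar P (PPar Q R) \<equiv>\<^sub>\<pi> PPar Q (PPar P R)"
  by (meson peq.intros)

lemma peq_unit_left: "PPar PInert P \<equiv>\<^sub>\<pi> P"
  by (meson peq.intros)

section \<open>Transitions and substitutions\<close>

text \<open>The value \<open>Success 0\<close> is junk, for a subject that is replaced by \<open>Star\<close>.\<close>

fun nsub :: "(nat \<Rightarrow> val) \<Rightarrow> name \<Rightarrow> name" where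
  "nsub \<sigma> (Var n) = (case \<sigma> n of Nm a \<Rightarrow> a | Star \<Rightarrow> Success 0)"
| "nsub \<sigma> (Success w) = Success w"

fun lsub :: "(nat \<Rightarrow> val) \<Rightarrow> label \<Rightarrow> label" where
  "lsub \<sigma> LTau = LTau"
| "lsub \<sigma> (LIn a) = LIn (nsub \<sigma> a)"
| "lsub \<sigma> (LOut a v) = LOut (nsub \<sigma> a) (vsub \<sigma> v)"
| "lsub \<sigma> (LBOut a) = LBOut (nsub \<sigma> a)"

abbreviation lifts :: "label \<Rightarrow> (nat \<Rightarrow> val) \<Rightarrow> nat \<Rightarrow> val" where
  "lifts l \<sigma> \<equiv> if binds l then lift \<sigma> else \<sigma>"

lemma nsub_shift [simp]: "nsub (renaming Suc) a = shift_name a"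
  by (cases a) auto

lemma shift_label_lsub: "shift_label l = lsub (renaming Suc) l"
  by (cases l) auto

lemma vsub_Nm: "vsub \<sigma> (Nm a) \<noteq> Star \<Longrightarrow> vsub \<sigma> (Nm a) = Nm (nsub \<sigma> a)"
  by (cases a) (auto split: val.splits)

lemma vsub_shift [simp]: "vsub (renaming Suc) (Nm a) = Nm (shift_name a)"
  by (cases a) auto

lemma vsub_lift_shift_name [simp]:
  "vsub (lift \<sigma>) (Nm (shift_name a)) = vsub (renaming Suc) (vsub \<sigma> (Nm a))"
  by (metis vsub_shift vsub_lift_shift)

lemma nsub_lift_shift [simp]: "nsub (lift \<sigma>) (shift_name a) = shift_name (nsub \<sigma> a)"
  by (cases a) (auto split: val.splits)

lemma lsub_lift_shift [simp]: "lsub (lift \<sigma>) (shift_label l) = shift_label (lsub \<sigma> l)"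
  by (cases l) (auto simp: vsub_lift_shift)

lemma binds_lsub [simp]: "binds (lsub \<sigma> l) = binds l" "binds (shift_label l) = binds l"
  by (cases l; simp)+

lemma shift_name_inj [simp]: "shift_name a = shift_name b \<longleftrightarrow> a = b"
  by (cases a; cases b) auto

lemma shift_val_inj [simp]: "vsub (renaming Suc) v = vsub (renaming Suc) w \<longleftrightarrow> v = w"
  by (cases v; cases w) (auto simp: vsub_shift simp del: vsub.simps(1,2))

lemma shift_name_neq [simp]: "shift_name a \<noteq> Var 0" "Var 0 \<noteq> shift_name a"
  by (cases a; simp)+

lemma shift_val_neq [simp]: "vsub (renaming Suc) v \<noteq> Nm (Var 0)" "Nm (Var 0) \<noteq> vsub (renaming Suc) v"
  by (cases v; simp del: vsub.simps(1,2))+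

lemma name_shift_cases: obtains "a = Var 0" | b where "a = shift_name b"
  by (cases a rule: shift_name.cases)
    (metis not0_implies_Suc shift_name.simps(1), metis shift_name.simps(2))

lemma val_shift_cases: obtains "v = Nm (Var 0)" | w where "v = vsub (renaming Suc) w"
  by (cases v) (metis name_shift_cases vsub_shift, metis vsub.simps(3))

text \<open>\<open>lift \<sigma>\<close> fixes index 0 and sends shifted names to shifted names, so
  a subject that is visible outside the binder comes from such a subject. This lets labels be pulled
  out of a restriction.\<close>

lemma nsub_lift_eq_shift:
  assumes "nsub (lift \<sigma>) a = shift_name b"
  obtains a' where "a = shift_name a'" "nsub \<sigma> a' = b"
  using assms by (cases a rule: name_shift_cases) auto

lemma vsub_lift_eq_shift:
  assumes "vsub (lift \<sigma>) v = vsub (renaming Suc) w"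
  obtains v' where "v = vsub (renaming Suc) v'" "vsub \<sigma> v' = w"
  using assms by (cases v rule: val_shift_cases) (auto simp: vsub_lift_shift)

lemma vsub_lift_eq_0: "vsub (lift \<sigma>) v = Nm (Var 0) \<longleftrightarrow> v = Nm (Var 0)"
  by (cases v rule: val_shift_cases) (auto simp: vsub_lift_shift)

lemma lsub_lift_eq_shift:
  assumes "lsub (lift \<sigma>) l = shift_label k"
  obtains l' where "l = shift_label l'" "lsub \<sigma> l' = k"
proof (cases l)
  case LTau
  then show ?thesis using assms that[of LTau] by (cases k) auto
next
  case (LIn a)
  with assms obtain b where "k = LIn b" "nsub (lift \<sigma>) a = shift_name b" by (cases k) auto
  then show ?thesis using LIn that by (metis nsub_lift_eq_shift lsub.simps(2) shift_label.simps(2))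
next
  case (LOut a v)
  with assms obtain b w where "k = LOut b w" "nsub (lift \<sigma>) a = shift_name b"
    "vsub (lift \<sigma>) v = vsub (renaming Suc) w" by (cases k) auto
  then show ?thesis using LOut that
    by (metis nsub_lift_eq_shift vsub_lift_eq_shift lsub.simps(3) shift_label.simps(3))
next
  case (LBOut a)
  with assms obtain b where "k = LBOut b" "nsub (lift \<sigma>) a = shift_name b" by (cases k) auto
  then show ?thesis using LBOut that by (metis nsub_lift_eq_shift lsub.simps(4) shift_label.simps(4))
qed

section \<open>Substitutions preserve transitions\<close>

lemma lift_inst: "psub (inst (vsub \<sigma> v)) (psub (lift \<sigma>) P) = psub \<sigma> (psub (inst v) P)"
  unfolding psub_psub
proof (rule psub_cong)
  show "vsub (inst (vsub \<sigma> v)) (lift \<sigma> n) = vsub \<sigma> (inst v n)" for n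
    by (cases n) (simp_all add: vsub_vsub)
qed

lemma lift_swap: "psub (lift (lift \<sigma>)) (pren swap01 P) = pren swap01 (psub (lift (lift \<sigma>)) P)"
  by (simp add: lift_lift_swap)

lemma under_lsub: "under (lsub \<sigma> l) = under l"
  by (simp add: under_def fun_eq_iff)

lemma lift_under: "psub (lifts l \<sigma>) (under l P) = under l (psub \<sigma> P)"
  by (auto simp: under_def)

text \<open>A subject turned into \<open>Star\<close> would silence its prefix. Only prefixes that
  can fire at once are inspected, since a single transition does not involve the subjects inside
  their bodies.\<close>

primrec sok :: "(nat \<Rightarrow> val) \<Rightarrow> pi \<Rightarrow> bool" where
  "sok \<sigma> PInert = True"
| "sok \<sigma> (PPar P Q) = (sok \<sigma> P \<and> sok \<sigma> Q)"
| "sok \<sigma> (PIn a P) = (a \<noteq> Star \<longrightarrow> vsub \<sigma> a \<noteq> Star)"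
| "sok \<sigma> (POut a v) = (a \<noteq> Star \<longrightarrow> vsub \<sigma> a \<noteq> Star)"
| "sok \<sigma> (PNu P) = sok (lift \<sigma>) P"
| "sok \<sigma> (PRep a P) = (a \<noteq> Star \<longrightarrow> vsub \<sigma> a \<noteq> Star)"

lemma sok_names:
  assumes "\<And>n. \<sigma> n \<noteq> Star"
  shows "sok \<sigma> P"
proof -
  have lift: "lift \<tau> n \<noteq> Star" if "\<And>n. \<tau> n \<noteq> Star" for \<tau> n
    using that[of "n - 1"] by (cases n; cases "\<tau> (n - 1)") (auto simp del: vsub.simps simp: vsub_shift)
  have v: "vsub \<tau> v \<noteq> Star" if "\<And>n. \<tau> n \<noteq> Star" "v \<noteq> Star" for \<tau> v
    using that by (cases "(\<tau>, v)" rule: vsub.cases) auto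
  show ?thesis using assms
    by (induction P arbitrary: \<sigma>) (simp_all add: lift v)
qed

text \<open>The calculus has no test for inequality of names, so merging names disables nothing. A
  \<open>Star\<close> in subject position could, and \<open>sok\<close> rules it out.\<close>

lemma trans_psub:
  assumes "trans_pi P l P'" "sok \<sigma> P"
  shows "trans_pi (psub \<sigma> P) (lsub \<sigma> l) (psub (lifts l \<sigma>) P')"
  using assms
proof (induction arbitrary: \<sigma> rule: trans_pi.induct)
  case (tr_In a P)
  then show ?case by (simp add: trans_pi.tr_In vsub_Nm)
next
  case (tr_Rep a P)
  then show ?case using trans_pi.tr_Rep[of "nsub \<sigma> a" "psub (lift \<sigma>) P"]
    by (simp add: vsub_Nm flip: lift_comp)
next
  case (tr_Out a v)
  then show ?case by (simp add: trans_pi.tr_Out vsub_Nm)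
next
  case (tr_ParL P l P' Q)
  then have "trans_pi (psub \<sigma> P) (lsub \<sigma> l) (psub (lifts l \<sigma>) P')"
    by (simp del: if_split)
  from trans_pi.tr_ParL[OF this, of "psub \<sigma> Q"] show ?case
    by (simp only: psub.simps lift_under under_lsub)
next
  case (tr_ParR Q l Q' P)
  then have "trans_pi (psub \<sigma> Q) (lsub \<sigma> l) (psub (lifts l \<sigma>) Q')"
    by (simp del: if_split)
  from trans_pi.tr_ParR[OF this, of "psub \<sigma> P"] show ?case
    by (simp only: psub.simps lift_under under_lsub)
next
  case (tr_ComL P a P' Q v Q')
  then show ?case by (simp flip: lift_inst del: psub_psub) (blast intro: trans_pi.tr_ComL)
next
  case (tr_ComR P a v P' Q Q')
  then show ?case by (simp flip: lift_inst del: psub_psub) (blast intro: trans_pi.tr_ComR)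
next
  case (tr_Res P l P')
  then have "trans_pi (psub (lift \<sigma>) P) (shift_label (lsub \<sigma> l)) (psub (lifts l (lift \<sigma>)) P')"
    by (simp flip: lsub_lift_shift del: if_split)
  from trans_pi.tr_Res[OF this] show ?case
    by (cases "binds l") (simp_all add: lift_swap del: psub_psub)
next
  case (tr_Open P a P')
  then have "trans_pi (psub (lift \<sigma>) P) (LOut (shift_name (nsub \<sigma> a)) (Nm (Var 0))) (psub (lift \<sigma>) P')"
    using tr_Open.IH[of "lift \<sigma>"] by simp
  from trans_pi.tr_Open[OF this] show ?case by simp
next
  case (tr_CloseL P a P' Q Q')
  then show ?case by simp (blast intro: trans_pi.tr_CloseL)
next
  case (tr_CloseR P a P' Q Q')
  then show ?case by simp (blast intro: trans_pi.tr_CloseR)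
qed

lemmas trans_pren = trans_psub[OF _ sok_names, of _ _ _ "renaming f" for f, simplified]

section \<open>Substitutions reflect transitions, up to the communications they create\<close>

inductive_cases PInert_trans [elim!]: "trans_pi PInert l P'"
inductive_cases PPar_trans [consumes 1]: "trans_pi (PPar P Q) l P'"
inductive_cases PIn_trans [elim!]: "trans_pi (PIn a P) l P'"
inductive_cases POut_trans [elim!]: "trans_pi (POut a v) l P'"
inductive_cases PNu_trans [consumes 1]: "trans_pi (PNu P) l P'"
inductive_cases PRep_trans [elim!]: "trans_pi (PRep a P) l P'"

lemma lsub_eq_simps [simp]:
  "lsub \<sigma> l = LTau \<longleftrightarrow> l = LTau"
  "lsub \<sigma> l = LIn a \<longleftrightarrow> (\<exists>b. l = LIn b \<and> nsub \<sigma> b = a)"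
  "lsub \<sigma> l = LOut a v \<longleftrightarrow> (\<exists>b w. l = LOut b w \<and> nsub \<sigma> b = a \<and> vsub \<sigma> w = v)"
  "lsub \<sigma> l = LBOut a \<longleftrightarrow> (\<exists>b. l = LBOut b \<and> nsub \<sigma> b = a)"
  "LTau = lsub \<sigma> l \<longleftrightarrow> l = LTau"
  "LIn a = lsub \<sigma> l \<longleftrightarrow> (\<exists>b. l = LIn b \<and> nsub \<sigma> b = a)"
  "LOut a v = lsub \<sigma> l \<longleftrightarrow> (\<exists>b w. l = LOut b w \<and> nsub \<sigma> b = a \<and> vsub \<sigma> w = v)"
  "LBOut a = lsub \<sigma> l \<longleftrightarrow> (\<exists>b. l = LBOut b \<and> nsub \<sigma> b = a)"
  by (cases l; auto)+

lemma under_simps [simp]: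
  "under LTau P = P" "under (LOut a v) P = P"
  "under (LIn a) P = pren Suc P" "under (LBOut a) P = pren Suc P"
  "under l (PPar P Q) = PPar (under l P) (under l Q)"
  by (simp_all add: under_def)

text \<open>Gives the normal form of a substitution followed by the reception of a value; it is this
  form that \<open>sub_typed_cons\<close> types.\<close>

lemma inst_lift: "(\<lambda>n. vsub (inst v) (lift \<sigma> n)) = case_nat v \<sigma>"
proof
  show "vsub (inst v) (lift \<sigma> n) = case_nat v \<sigma> n" for n
    by (cases n) (simp_all add: vsub_vsub)
qed

text \<open>The communications that \<open>\<sigma>\<close> creates by identifying two distinct names \<open>a\<close> and \<open>c\<close>.\<close>

definition reacts :: "(nat \<Rightarrow> val) \<Rightarrow> pi \<Rightarrow> pi \<Rightarrow> bool" where
  "reacts \<sigma> P X \<longleftrightarrow>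
    (\<exists>a c v P\<^sub>1 P\<^sub>2. trans_pi P (LOut a v) P\<^sub>1 \<and> trans_pi P\<^sub>1 (LIn c) P\<^sub>2 \<and>
      a \<noteq> c \<and> nsub \<sigma> a = nsub \<sigma> c \<and> X \<equiv>\<^sub>\<pi> psub (case_nat (vsub \<sigma> v) \<sigma>) P\<^sub>2) \<or>
    (\<exists>a c P\<^sub>1 P\<^sub>2. trans_pi P (LBOut a) P\<^sub>1 \<and> trans_pi P\<^sub>1 (LIn (shift_name c)) P\<^sub>2 \<and>
      a \<noteq> c \<and> nsub \<sigma> a = nsub \<sigma> c \<and> X \<equiv>\<^sub>\<pi> PNu (psub (case_nat (Nm (Var 0)) (lift \<sigma>)) P\<^sub>2))"

lemma reacts_out:
  assumes "trans_pi P (LOut a v) P\<^sub>1" "trans_pi P\<^sub>1 (LIn c) P\<^sub>2" "a \<noteq> c" "nsub \<sigma> a = nsub \<sigma> c"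
    "X \<equiv>\<^sub>\<pi> psub (case_nat (vsub \<sigma> v) \<sigma>) P\<^sub>2"
  shows "reacts \<sigma> P X"
  using assms unfolding reacts_def by blast

lemma reacts_bout:
  assumes "trans_pi P (LBOut a) P\<^sub>1" "trans_pi P\<^sub>1 (LIn (shift_name c)) P\<^sub>2" "a \<noteq> c"
    "nsub \<sigma> a = nsub \<sigma> c" "X \<equiv>\<^sub>\<pi> PNu (psub (case_nat (Nm (Var 0)) (lift \<sigma>)) P\<^sub>2)"
  shows "reacts \<sigma> P X"
  using assms unfolding reacts_def by blast

lemma reacts_ParL:
  assumes "reacts \<sigma> P X" shows "reacts \<sigma> (PPar P Q) (PPar X (psub \<sigma> Q))"
  using assms unfolding reacts_def[of \<sigma> P]
proof (elim disjE exE conjE)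
  fix a c v P\<^sub>1 P\<^sub>2
  assume *: "trans_pi P (LOut a v) P\<^sub>1" "trans_pi P\<^sub>1 (LIn c) P\<^sub>2" "a \<noteq> c" "nsub \<sigma> a = nsub \<sigma> c"
    "X \<equiv>\<^sub>\<pi> psub (case_nat (vsub \<sigma> v) \<sigma>) P\<^sub>2"
  show ?thesis
    by (rule reacts_out[OF tr_ParL[OF *(1)] tr_ParL[OF *(2)] *(3,4)]) (simp add: *(5) peq_Par)
next
  fix a c P\<^sub>1 P\<^sub>2
  assume *: "trans_pi P (LBOut a) P\<^sub>1" "trans_pi P\<^sub>1 (LIn (shift_name c)) P\<^sub>2" "a \<noteq> c"
    "nsub \<sigma> a = nsub \<sigma> c" "X \<equiv>\<^sub>\<pi> PNu (psub (case_nat (Nm (Var 0)) (lift \<sigma>)) P\<^sub>2)"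
  have "PPar X (psub \<sigma> Q) \<equiv>\<^sub>\<pi> PPar (PNu (psub (case_nat (Nm (Var 0)) (lift \<sigma>)) P\<^sub>2)) (psub \<sigma> Q)"
    by (simp add: *(5) peq_Par)
  also note peq_extrude_left
  finally show ?thesis
    by (intro reacts_bout[OF tr_ParL[OF *(1)] tr_ParL[OF *(2)] *(3,4)]) simp
qed

lemma reacts_ParR:
  assumes "reacts \<sigma> P X" shows "reacts \<sigma> (PPar Q P) (PPar (psub \<sigma> Q) X)"
  using assms unfolding reacts_def[of \<sigma> P]
proof (elim disjE exE conjE)
  fix a c v P\<^sub>1 P\<^sub>2
  assume *: "trans_pi P (LOut a v) P\<^sub>1" "trans_pi P\<^sub>1 (LIn c) P\<^sub>2" "a \<noteq> c" "nsub \<sigma> a = nsub \<sigma> c"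
    "X \<equiv>\<^sub>\<pi> psub (case_nat (vsub \<sigma> v) \<sigma>) P\<^sub>2"
  show ?thesis
    by (rule reacts_out[OF tr_ParR[OF *(1)] tr_ParR[OF *(2)] *(3,4)]) (simp add: *(5) peq_Par)
next
  fix a c P\<^sub>1 P\<^sub>2
  assume *: "trans_pi P (LBOut a) P\<^sub>1" "trans_pi P\<^sub>1 (LIn (shift_name c)) P\<^sub>2" "a \<noteq> c"
    "nsub \<sigma> a = nsub \<sigma> c" "X \<equiv>\<^sub>\<pi> PNu (psub (case_nat (Nm (Var 0)) (lift \<sigma>)) P\<^sub>2)"
  have "PPar (psub \<sigma> Q) X \<equiv>\<^sub>\<pi> PPar (psub \<sigma> Q) (PNu (psub (case_nat (Nm (Var 0)) (lift \<sigma>)) P\<^sub>2))"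
    by (simp add: *(5) peq_Par)
  also note peq_extrude
  finally show ?thesis
    by (intro reacts_bout[OF tr_ParR[OF *(1)] tr_ParR[OF *(2)] *(3,4)]) simp
qed

text \<open>The restricted name is never merged with another one by \<open>lift \<sigma>\<close>, so
  both subjects are visible outside and remain distinct there. If the object sent is the restricted
  name itself, the free output becomes a bound one and the first form of reaction turns into the
  second; otherwise the form is kept.\<close>

lemma reacts_Nu:
  assumes "reacts (lift \<sigma>) P X" shows "reacts \<sigma> (PNu P) (PNu X)"
proof -
  have names: "\<exists>a' c'. a = shift_name a' \<and> c = shift_name c' \<and> a' \<noteq> c' \<and> nsub \<sigma> a' = nsub \<sigma> c'"
    if "a \<noteq> c" "nsub (lift \<sigma>) a = nsub (lift \<sigma>) c" for a c
    using that by (cases a rule: name_shift_cases; cases c rule: name_shift_cases) auto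
  show ?thesis using assms unfolding reacts_def[of "lift \<sigma>" P]
  proof (elim disjE exE conjE)
    fix a c v P\<^sub>1 P\<^sub>2
    assume *: "trans_pi P (LOut a v) P\<^sub>1" "trans_pi P\<^sub>1 (LIn c) P\<^sub>2" "a \<noteq> c"
      "nsub (lift \<sigma>) a = nsub (lift \<sigma>) c" "X \<equiv>\<^sub>\<pi> psub (case_nat (vsub (lift \<sigma>) v) (lift \<sigma>)) P\<^sub>2"
    obtain a' c' where a: "a = shift_name a'" "c = shift_name c'" and
      ac: "a' \<noteq> c'" "nsub \<sigma> a' = nsub \<sigma> c'" using names[OF *(3,4)] by blast
    show ?thesis
    proof (cases v rule: val_shift_cases)
      case 1
      then have "trans_pi (PNu P) (LBOut a') P\<^sub>1" using * a tr_Open by simp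
      moreover have "trans_pi P\<^sub>1 (LIn (shift_name c')) P\<^sub>2" using * a by simp
      ultimately show ?thesis by (rule reacts_bout[OF _ _ ac]) (use * 1 peq_Nu in simp)
    next
      case (2 w)
      have "trans_pi (PNu P) (LOut a' w) (PNu P\<^sub>1)" using tr_Res[of P "LOut a' w"] * a 2 by simp
      moreover have "trans_pi (PNu P\<^sub>1) (LIn c') (PNu (pren swap01 P\<^sub>2))"
        using tr_Res[of P\<^sub>1 "LIn c'"] * a by simp
      moreover have "PNu X \<equiv>\<^sub>\<pi> psub (case_nat (vsub \<sigma> w) \<sigma>) (PNu (pren swap01 P\<^sub>2))"
        (is "_ \<equiv>\<^sub>\<pi> ?Y")
      proof -
        have "?Y = PNu (psub (case_nat (vsub (lift \<sigma>) v) (lift \<sigma>)) P\<^sub>2)"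
        unfolding psub.simps psub_psub
      proof (intro arg_cong[where f = PNu] psub_cong)
        show "vsub (lift (case_nat (vsub \<sigma> w) \<sigma>)) (renaming swap01 n)
            = case_nat (vsub (lift \<sigma>) v) (lift \<sigma>) n" for n
          by (cases n rule: nat_cases_2) (simp_all add: 2 vsub_lift_shift)
      qed
        then show ?thesis using *(5) peq_Nu by metis
      qed
      ultimately show ?thesis by (rule reacts_out[OF _ _ ac])
    qed
  next
    fix a c P\<^sub>1 P\<^sub>2
    assume *: "trans_pi P (LBOut a) P\<^sub>1" "trans_pi P\<^sub>1 (LIn (shift_name c)) P\<^sub>2" "a \<noteq> c"
      "nsub (lift \<sigma>) a = nsub (lift \<sigma>) c"
      "X \<equiv>\<^sub>\<pi> PNu (psub (case_nat (Nm (Var 0)) (lift (lift \<sigma>))) P\<^sub>2)"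
    obtain a' c' where a: "a = shift_name a'" "c = shift_name c'" and
      ac: "a' \<noteq> c'" "nsub \<sigma> a' = nsub \<sigma> c'" using names[OF *(3,4)] by blast
    have 1: "trans_pi (PNu P) (LBOut a') (PNu (pren swap01 P\<^sub>1))"
      using tr_Res[of P "LBOut a'"] * a by simp
    have "nsub (renaming swap01) (shift_name (shift_name c')) = shift_name (shift_name c')"
      by (cases c') auto
    then have "trans_pi (pren swap01 P\<^sub>1) (LIn (shift_name (shift_name c')))
        (psub (lift (renaming swap01)) P\<^sub>2)"
      using trans_pren[OF *(2), of swap01] a by simp
    then have 2: "trans_pi (PNu (pren swap01 P\<^sub>1)) (LIn (shift_name c'))
        (PNu (pren swap01 (psub (lift (renaming swap01)) P\<^sub>2)))"
      using tr_Res[of "pren swap01 P\<^sub>1" "LIn (shift_name c')"]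
      by (simp del: psub_psub)
    have "PNu X \<equiv>\<^sub>\<pi> PNu (PNu (psub (case_nat (Nm (Var 0)) (lift (lift \<sigma>))) P\<^sub>2))"
      using * peq_Nu by blast
    \<comment> \<open>Seen from outside, the extruded name is bound around the restriction of
      \<open>P\<close>; seen from inside, it was bound below it. Hence the exchange of the two
      binders.\<close>
    also note peq_swap
    also have "PNu (PNu (pren swap01 (psub (case_nat (Nm (Var 0)) (lift (lift \<sigma>))) P\<^sub>2)))
      = PNu (psub (case_nat (Nm (Var 0)) (lift \<sigma>)) (PNu (pren swap01 (psub (lift (renaming swap01)) P\<^sub>2))))"
      unfolding psub.simps psub_psub
    proof (intro arg_cong[where f = PNu] psub_cong)
      fix n
      show "vsub (renaming swap01) (case_nat (Nm (Var 0)) (lift (lift \<sigma>)) n) =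
        vsub (lift (case_nat (Nm (Var 0)) (lift \<sigma>)))
          (vsub (renaming swap01) (lift (renaming swap01) n))"
        by (cases n rule: nat_cases_2; cases "n - 2") (auto simp: vsub_vsub lift_def)
    qed
    finally show ?thesis by (rule reacts_bout[OF 1 2 ac])
  qed
qed

text \<open>The partners of a communication have subjects that are equal after
  \<open>\<sigma>\<close>. If they were equal before, \<open>P\<close> has the same communication.
  If not, the two components can still act one after the other; the output is put first, so that a
  simulating process can hold the message until its input is ready.\<close>

lemma trans_psub_inv:
  assumes "trans_pi (psub \<sigma> P) l X"
  shows "(\<exists>l' P'. trans_pi P l' P' \<and> l = lsub \<sigma> l' \<and> X = psub (lifts l' \<sigma>) P') \<or>
    l = LTau \<and> reacts \<sigma> P X"
  using assms
proof (induction P arbitrary: \<sigma> l X)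
  case PInert
  then show ?case by auto
next
  case (PIn a P)
  then show ?case by (cases "(\<sigma>, a)" rule: vsub.cases) (auto intro!: exI trans_pi.tr_In split: val.splits)
next
  case (PRep a P)
  then obtain b where b: "vsub \<sigma> a = Nm b" "l = LIn b"
    "X = PPar (psub (lift \<sigma>) P) (pren Suc (psub \<sigma> (PRep a P)))"
    by (auto simp flip: lift_comp)
  then obtain b' where "a = Nm b'" "nsub \<sigma> b' = b"
    by (cases "(\<sigma>, a)" rule: vsub.cases) (auto split: val.splits)
  then have "trans_pi (PRep a P) (LIn b') (PPar P (pren Suc (PRep a P)))" "l = lsub \<sigma> (LIn b')"
    using b tr_Rep by auto
  moreover have "X = psub (lifts (LIn b') \<sigma>) (PPar P (pren Suc (PRep a P)))"
    unfolding b(3) binds.simps if_True psub.simps(2) psub_psub by simp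
  ultimately show ?case by metis
next
  case (POut a v)
  then show ?case by (cases "(\<sigma>, a)" rule: vsub.cases) (auto intro!: exI trans_pi.tr_Out split: val.splits)
next
  case (PPar P Q)
  note IH = PPar.IH
  from PPar.prems have "trans_pi (PPar (psub \<sigma> P) (psub \<sigma> Q)) l X" by simp
  then show ?case
  proof (cases rule: PPar_trans)
    case (1 P')
    from IH(1)[OF 1(2)] show ?thesis
    proof (elim disjE exE conjE)
      fix l' P''
      assume *: "trans_pi P l' P''" "l = lsub \<sigma> l'" "P' = psub (lifts l' \<sigma>) P''"
      have "X = psub (lifts l' \<sigma>) (PPar P'' (under l' Q))"
        using * 1 by (simp only: psub.simps lift_under under_lsub)
      with tr_ParL[OF *(1)] *(2) show ?thesis by blast
    qed (use 1 reacts_ParL in auto)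
  next
    case (2 Q')
    from IH(2)[OF 2(2)] show ?thesis
    proof (elim disjE exE conjE)
      fix l' Q''
      assume *: "trans_pi Q l' Q''" "l = lsub \<sigma> l'" "Q' = psub (lifts l' \<sigma>) Q''"
      have "X = psub (lifts l' \<sigma>) (PPar (under l' P) Q'')"
        using * 2 by (simp only: psub.simps lift_under under_lsub)
      with tr_ParR[OF *(1)] *(2) show ?thesis by blast
    qed (use 2 reacts_ParR in auto)
  next
    case (3 a P' v Q')
    from IH(1)[OF 3(3)] obtain b P'' where P: "trans_pi P (LIn b) P''" "nsub \<sigma> b = a"
      "P' = psub (lift \<sigma>) P''" by auto
    from IH(2)[OF 3(4)] obtain c w Q'' where Q: "trans_pi Q (LOut c w) Q''" "nsub \<sigma> c = a"
      "vsub \<sigma> w = v" "Q' = psub \<sigma> Q''" by auto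
    show ?thesis
    proof (cases "b = c")
      case True
      with P Q tr_ComL[OF P(1)] have "trans_pi (PPar P Q) LTau (PPar (psub (inst w) P'') Q'')" by simp
      moreover have "X = psub \<sigma> (PPar (psub (inst w) P'') Q'')"
        using 3 P Q by (simp flip: lift_inst del: psub_psub)
      ultimately show ?thesis using 3 by fastforce
    next
      case False
      have "X = psub (case_nat (vsub \<sigma> w) \<sigma>) (PPar P'' (pren Suc Q''))"
        using 3 P Q by (simp add: inst_lift)
      then have "reacts \<sigma> (PPar P Q) X"
        using reacts_out[OF tr_ParR[OF Q(1), of P, unfolded under_simps] tr_ParL[OF P(1)]] False P Q by auto
      with 3 show ?thesis by simp
    qed
  next
    case (4 a v P' Q')
    from IH(1)[OF 4(3)] obtain c w P'' where P: "trans_pi P (LOut c w) P''" "nsub \<sigma> c = a"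
      "vsub \<sigma> w = v" "P' = psub \<sigma> P''" by auto
    from IH(2)[OF 4(4)] obtain b Q'' where Q: "trans_pi Q (LIn b) Q''" "nsub \<sigma> b = a"
      "Q' = psub (lift \<sigma>) Q''" by auto
    show ?thesis
    proof (cases "b = c")
      case True
      with P Q tr_ComR[OF P(1)] have "trans_pi (PPar P Q) LTau (PPar P'' (psub (inst w) Q''))" by simp
      moreover have "X = psub \<sigma> (PPar P'' (psub (inst w) Q''))"
        using 4 P Q by (simp flip: lift_inst del: psub_psub)
      ultimately show ?thesis using 4 by fastforce
    next
      case False
      have "X = psub (case_nat (vsub \<sigma> w) \<sigma>) (PPar (pren Suc P'') Q'')"
        using 4 P Q by (simp add: inst_lift)
      then have "reacts \<sigma> (PPar P Q) X"
        using reacts_out[OF tr_ParL[OF P(1), of Q, unfolded under_simps] tr_ParR[OF Q(1)]] False P Q by auto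
      with 4 show ?thesis by simp
    qed
  next
    case (5 a P' Q')
    from IH(1)[OF 5(3)] obtain b P'' where P: "trans_pi P (LIn b) P''" "nsub \<sigma> b = a"
      "P' = psub (lift \<sigma>) P''" by auto
    from IH(2)[OF 5(4)] obtain c Q'' where Q: "trans_pi Q (LBOut c) Q''" "nsub \<sigma> c = a"
      "Q' = psub (lift \<sigma>) Q''" by auto
    show ?thesis
    proof (cases "b = c")
      case True
      with P Q tr_CloseL[OF P(1)] have "trans_pi (PPar P Q) LTau (PNu (PPar P'' Q''))" by simp
      then show ?thesis using 5 P Q by fastforce
    next
      case False
      \<comment> \<open>Fired after the bound output, the input of \<open>P\<close> takes place in
        the scope of the extruded name, hence its shifted subject.\<close>
      have "trans_pi (pren Suc P) (LIn (shift_name b)) (psub (lift (renaming Suc)) P'')"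
        using trans_pren[OF P(1), of Suc] by simp
      note T = tr_ParL[OF this, of Q'']
      have "(\<lambda>n. vsub (case_nat (Nm (Var 0)) (lift \<sigma>)) (lift (renaming Suc) n)) = lift \<sigma>"
        by (auto simp: fun_eq_iff lift_def split: nat.splits)
      then have "X = PNu (psub (case_nat (Nm (Var 0)) (lift \<sigma>))
          (PPar (psub (lift (renaming Suc)) P'') (pren Suc Q'')))"
        using 5 P Q by simp
      then have "reacts \<sigma> (PPar P Q) X"
        using reacts_bout[OF tr_ParR[OF Q(1)], of P b] T False P Q by auto
      with 5 show ?thesis by simp
    qed
  next
    case (6 a P' Q')
    from IH(1)[OF 6(3)] obtain c P'' where P: "trans_pi P (LBOut c) P''" "nsub \<sigma> c = a"
      "P' = psub (lift \<sigma>) P''" by auto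
    from IH(2)[OF 6(4)] obtain b Q'' where Q: "trans_pi Q (LIn b) Q''" "nsub \<sigma> b = a"
      "Q' = psub (lift \<sigma>) Q''" by auto
    show ?thesis
    proof (cases "b = c")
      case True
      with P Q tr_CloseR[OF P(1)] have "trans_pi (PPar P Q) LTau (PNu (PPar P'' Q''))" by simp
      then show ?thesis using 6 P Q by fastforce
    next
      case False
      have "trans_pi (pren Suc Q) (LIn (shift_name b)) (psub (lift (renaming Suc)) Q'')"
        using trans_pren[OF Q(1), of Suc] by simp
      note T = tr_ParR[OF this, of P'']
      have "(\<lambda>n. vsub (case_nat (Nm (Var 0)) (lift \<sigma>)) (lift (renaming Suc) n)) = lift \<sigma>"
        by (auto simp: fun_eq_iff lift_def split: nat.splits)
      then have "X = PNu (psub (case_nat (Nm (Var 0)) (lift \<sigma>))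
          (PPar (pren Suc P'') (psub (lift (renaming Suc)) Q'')))"
        using 6 P Q by simp
      then have "reacts \<sigma> (PPar P Q) X"
        using reacts_bout[OF tr_ParL[OF P(1)], of Q b] T False P Q by auto
      with 6 show ?thesis by simp
    qed
  qed
next
  case (PNu P)
  from PNu.prems have "trans_pi (PNu (psub (lift \<sigma>) P)) l X" by simp
  then show ?case
  proof (cases rule: PNu_trans)
    case (1 X')
    from PNu.IH[OF 1(2)] show ?thesis
    proof (elim disjE exE conjE)
      fix l' P'
      assume *: "trans_pi P l' P'" "shift_label l = lsub (lift \<sigma>) l'" "X' = psub (lifts l' (lift \<sigma>)) P'"
      obtain k where k: "l' = shift_label k" "lsub \<sigma> k = l"
        using *(2)[symmetric] by (rule lsub_lift_eq_shift)
      from *(1) have "trans_pi (PNu P) k (PNu (if binds k then pren swap01 P' else P'))"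
        unfolding k by (rule tr_Res)
      moreover have "X = psub (lifts k \<sigma>) (PNu (if binds k then pren swap01 P' else P'))"
        unfolding 1(1) *(3) k(1) k(2)[symmetric]
        by (cases "binds k") (simp_all add: lift_swap del: psub_psub)
      ultimately show ?thesis using k by blast
    next
      assume "shift_label l = LTau" "reacts (lift \<sigma>) P X'"
      moreover from this have "l = LTau" by (cases l) auto
      ultimately show ?thesis using 1 reacts_Nu by auto
    qed
  next
    case (2 a)
    from PNu.IH[OF 2(2)] obtain b v P' where *: "trans_pi P (LOut b v) P'"
      "nsub (lift \<sigma>) b = shift_name a" "v = Nm (Var 0)" "X = psub (lift \<sigma>) P'"
      by (auto simp: vsub_lift_eq_0)
    from *(2) obtain b' where b: "b = shift_name b'" "nsub \<sigma> b' = a" by (rule nsub_lift_eq_shift)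
    from * b tr_Open have "trans_pi (PNu P) (LBOut b') P'" by simp
    then show ?thesis using * b 2 by fastforce
  qed
qed

section \<open>Structural congruence is a strong bisimulation\<close>

text \<open>Weakening is injective on names, so it creates no communication.\<close>

lemma trans_shift_inv:
  assumes "trans_pi (pren Suc P) l X"
  obtains l' P' where "trans_pi P l' P'" "l = shift_label l'" "X = psub (lifts l' (renaming Suc)) P'"
proof -
  have "\<not> reacts (renaming Suc) P X" by (auto simp: reacts_def)
  with trans_psub_inv[OF assms] that show ?thesis by (auto simp: shift_label_lsub)
qed

text \<open>Half of the bisimulation game for one fixed pair, with derivatives compared by
  \<open>peq\<close> itself. This form admits an induction on the derivation of \<open>peq\<close>,
  where \<open>peq_sym\<close> asks for both halves together.\<close>

definition simulated :: "pi \<Rightarrow> pi \<Rightarrow> bool" where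
  "simulated P Q \<longleftrightarrow> (\<forall>l P'. trans_pi P l P' \<longrightarrow> (\<exists>Q'. trans_pi Q l Q' \<and> P' \<equiv>\<^sub>\<pi> Q'))"

lemma simulatedI:
  "(\<And>l P'. trans_pi P l P' \<Longrightarrow> \<exists>Q'. trans_pi Q l Q' \<and> P' \<equiv>\<^sub>\<pi> Q') \<Longrightarrow> simulated P Q"
  by (simp add: simulated_def)

lemma simulatedD: "simulated P Q \<Longrightarrow> trans_pi P l P' \<Longrightarrow> \<exists>Q'. trans_pi Q l Q' \<and> P' \<equiv>\<^sub>\<pi> Q'"
  by (simp add: simulated_def)

lemma simulated_trans: "simulated P Q \<Longrightarrow> simulated Q R \<Longrightarrow> simulated P R"
  unfolding simulated_def by (meson peq_trans)

lemma peq_under: "P \<equiv>\<^sub>\<pi> Q \<Longrightarrow> under l P \<equiv>\<^sub>\<pi> under l Q"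
  by (simp add: under_def peq_psub)

lemma matched: "trans_pi Q l Q' \<Longrightarrow> P' \<equiv>\<^sub>\<pi> Q' \<Longrightarrow> \<exists>Q'. trans_pi Q l Q' \<and> P' \<equiv>\<^sub>\<pi> Q'"
  by blast

text \<open>The premises on \<open>peq\<close> relate the component that stays idle and reappears in
  the derivative.\<close>

lemma simulated_Par:
  assumes "simulated P P'" "simulated Q Q'" "P \<equiv>\<^sub>\<pi> P'" "Q \<equiv>\<^sub>\<pi> Q'"
  shows "simulated (PPar P Q) (PPar P' Q')"
proof (rule simulatedI)
  fix l X assume "trans_pi (PPar P Q) l X"
  then show "\<exists>X'. trans_pi (PPar P' Q') l X' \<and> X \<equiv>\<^sub>\<pi> X'"
  proof (cases rule: PPar_trans)
    case (1 Y)
    from simulatedD[OF assms(1) 1(2)] obtain Y' where "trans_pi P' l Y'" "Y \<equiv>\<^sub>\<pi> Y'" by blast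
    then show ?thesis using 1 assms(4) by (blast intro: tr_ParL peq_Par peq_under)
  next
    case (2 Y)
    from simulatedD[OF assms(2) 2(2)] obtain Y' where "trans_pi Q' l Y'" "Y \<equiv>\<^sub>\<pi> Y'" by blast
    then show ?thesis using 2 assms(3) by (blast intro: tr_ParR peq_Par peq_under)
  next
    case (3 a Y v Z)
    from simulatedD[OF assms(1) 3(3)] simulatedD[OF assms(2) 3(4)] show ?thesis
      unfolding 3 by (blast intro: tr_ComL peq_Par peq_psub)
  next
    case (4 a Y v Z)
    from simulatedD[OF assms(1) 4(3)] simulatedD[OF assms(2) 4(4)] show ?thesis
      unfolding 4 by (blast intro: tr_ComR peq_Par peq_psub)
  next
    case (5 a Y Z)
    from simulatedD[OF assms(1) 5(3)] simulatedD[OF assms(2) 5(4)] show ?thesis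
      unfolding 5 by (blast intro: tr_CloseL peq_Par peq_Nu)
  next
    case (6 a Y Z)
    from simulatedD[OF assms(1) 6(3)] simulatedD[OF assms(2) 6(4)] show ?thesis
      unfolding 6 by (blast intro: tr_CloseR peq_Par peq_Nu)
  qed
qed

lemma simulated_Nu:
  assumes "simulated P P'" shows "simulated (PNu P) (PNu P')"
proof (rule simulatedI)
  fix l X assume "trans_pi (PNu P) l X"
  then show "\<exists>X'. trans_pi (PNu P') l X' \<and> X \<equiv>\<^sub>\<pi> X'"
  proof (cases rule: PNu_trans)
    case (1 Y)
    from simulatedD[OF assms(1) 1(2)] obtain Y' where "trans_pi P' (shift_label l) Y'" "Y \<equiv>\<^sub>\<pi> Y'" by blast
    then show ?thesis unfolding 1 by (intro matched[OF tr_Res]) (auto intro: peq_Nu peq_psub)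
  next
    case (2 a)
    from simulatedD[OF assms(1) 2(2)] show ?thesis unfolding 2 by (blast intro: tr_Open)
  qed
qed

lemma simulated_comm: "simulated (PPar P Q) (PPar Q P)"
  by (rule simulatedI)
    (erule PPar_trans; blast intro: tr_ParL tr_ParR tr_ComL tr_ComR tr_CloseL tr_CloseR peq_comm peq_Nu)

lemma simulated_assoc: "simulated (PPar (PPar P Q) R) (PPar P (PPar Q R))"
proof (rule simulatedI)
  fix l X assume "trans_pi (PPar (PPar P Q) R) l X"
  then show "\<exists>X'. trans_pi (PPar P (PPar Q R)) l X' \<and> X \<equiv>\<^sub>\<pi> X'"
  proof (cases rule: PPar_trans)
    case (1 Y)
    from 1(2) show ?thesis
    proof (cases rule: PPar_trans)
      case (1 P')
      show ?thesis using \<open>X = _\<close> 1 by (intro matched[OF tr_ParL[OF 1(2)]]) (simp add: peq_assoc)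
    next
      case (2 Q')
      show ?thesis using \<open>X = _\<close> 2
        by (intro matched[OF tr_ParR[OF tr_ParL[OF 2(2)]]]) (simp add: peq_assoc)
    next
      case (3 a P' v Q')
      show ?thesis using \<open>X = _\<close> 3
        by simp (intro matched[OF tr_ComL[OF 3(3) tr_ParL[OF 3(4)]]], simp add: peq_assoc)
    next
      case (4 a v P' Q')
      show ?thesis using \<open>X = _\<close> 4
        by simp (intro matched[OF tr_ComR[OF 4(3) tr_ParL[OF 4(4)]]], simp add: peq_assoc)
    next
      case (5 a P' Q')
      show ?thesis using \<open>X = _\<close> 5
        by simp (intro matched[OF tr_CloseL[OF 5(3) tr_ParL[OF 5(4)]]],
            simp, meson peq_extrude_left peq_Nu peq_assoc peq_trans)
    next
      case (6 a P' Q')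
      show ?thesis using \<open>X = _\<close> 6
        by simp (intro matched[OF tr_CloseR[OF 6(3) tr_ParL[OF 6(4)]]],
            simp, meson peq_extrude_left peq_Nu peq_assoc peq_trans)
    qed
  next
    case (2 R')
    show ?thesis using 2 by (intro matched[OF tr_ParR[OF tr_ParR[OF 2(2)]]]) (simp add: peq_assoc)
  next
    case (3 a Y v R')
    from 3(3) show ?thesis
    proof (cases rule: PPar_trans)
      case (1 P')
      show ?thesis using \<open>l = _\<close> \<open>X = _\<close> 1
        by simp (intro matched[OF tr_ComL[OF 1(2) tr_ParR[OF 3(4)]]], simp add: peq_assoc)
    next
      case (2 Q')
      show ?thesis using \<open>l = _\<close> \<open>X = _\<close> 2
        by simp (intro matched[OF tr_ParR[OF tr_ComL[OF 2(2) 3(4)]]], simp add: peq_assoc)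
    qed auto
  next
    case (4 a v Y R')
    from 4(3) show ?thesis
    proof (cases rule: PPar_trans)
      case (1 P')
      show ?thesis using \<open>l = _\<close> \<open>X = _\<close> 1
        by simp (intro matched[OF tr_ComR[OF 1(2) tr_ParR[OF 4(4)]]], simp add: peq_assoc)
    next
      case (2 Q')
      show ?thesis using \<open>l = _\<close> \<open>X = _\<close> 2
        by simp (intro matched[OF tr_ParR[OF tr_ComR[OF 2(2) 4(4)]]], simp add: peq_assoc)
    qed auto
  next
    case (5 a Y R')
    from 5(3) show ?thesis
    proof (cases rule: PPar_trans)
      case (1 P')
      show ?thesis using \<open>l = _\<close> \<open>X = _\<close> 1
        by simp (intro matched[OF tr_CloseL[OF 1(2) tr_ParR[OF 5(4)]]], simp add: peq_assoc peq_Nu)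
    next
      case (2 Q')
      show ?thesis using \<open>l = _\<close> \<open>X = _\<close> 2
        by simp (intro matched[OF tr_ParR[OF tr_CloseL[OF 2(2) 5(4)]]], simp,
            meson peq_extrude peq_Nu peq_assoc peq_trans peq_sym)
    qed auto
  next
    case (6 a Y R')
    from 6(3) show ?thesis
    proof (cases rule: PPar_trans)
      case (1 P')
      show ?thesis using \<open>l = _\<close> \<open>X = _\<close> 1
        by simp (intro matched[OF tr_CloseR[OF 1(2) tr_ParR[OF 6(4)]]], simp add: peq_assoc peq_Nu)
    next
      case (2 Q')
      show ?thesis using \<open>l = _\<close> \<open>X = _\<close> 2
        by simp (intro matched[OF tr_ParR[OF tr_CloseR[OF 2(2) 6(4)]]], simp,
            meson peq_extrude peq_Nu peq_assoc peq_trans peq_sym)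
    qed auto
  qed
qed

lemma simulated_assoc_right: "simulated (PPar P (PPar Q R)) (PPar (PPar P Q) R)"
  by (meson simulated_comm simulated_assoc simulated_trans)

lemma simulated_unit: "simulated (PPar P PInert) P" "simulated P (PPar P PInert)"
  by (rule simulatedI, erule PPar_trans; auto simp: under_def intro: peq_unit)
    (rule simulatedI, auto simp: under_def intro!: matched[OF tr_ParL] peq_sym[OF peq_unit])

section \<open>Index identities for scope extrusion, and extrusion as a bisimulation\<close>

lemma swap_lift_shift: "pren swap01 (psub (lift (renaming Suc)) P) = pren Suc P"
  unfolding psub_psub
proof (rule psub_cong)
  show "vsub (renaming swap01) (lift (renaming Suc) n) = renaming Suc n" for n
    by (cases n) simp_all
qed

lemma swap_shift: "pren swap01 (pren Suc P) = psub (lift (renaming Suc)) P"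
  unfolding psub_psub
proof (rule psub_cong)
  show "vsub (renaming swap01) (renaming Suc n) = lift (renaming Suc) n" for n
    by (cases n) simp_all
qed

lemma lift_shift_shift: "psub (lift (renaming Suc)) (pren Suc P) = pren Suc (pren Suc P)"
  by simp

lemma swap_swap: "pren swap01 (pren swap01 P) = P"
proof -
  have "swap01 (swap01 n) = n" for n by (cases n rule: nat_cases_2) simp_all
  then show ?thesis by simp
qed

lemma inst_0_lift_shift: "psub (inst (Nm (Var 0))) (psub (lift (renaming Suc)) P) = P"
  unfolding psub_psub
proof (rule psub_eq_id)
  show "vsub (inst (Nm (Var 0))) (lift (renaming Suc) n) = Nm (Var n)" for n
    by (cases n) simp_all
qed

lemma under_shift_Par_swap:
  "(if binds l then pren swap01 (PPar (psub (lifts l (renaming Suc)) P) (under (shift_label l) Q))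
    else PPar (psub (lifts l (renaming Suc)) P) (under (shift_label l) Q)) =
   PPar (pren Suc P) (if binds l then psub (lift (renaming Suc)) Q else Q)"
  by (simp add: under_def swap_lift_shift swap_shift del: psub_psub)

lemma inst_shift_swap: "psub (inst (vsub (renaming Suc) v)) (P) = psub (lift (inst v)) (pren swap01 P)"
  unfolding psub_psub
proof (rule psub_cong)
  show "inst (vsub (renaming Suc) v) n = vsub (lift (inst v)) (renaming swap01 n)" for n
    by (cases n rule: nat_cases_2) (simp_all add: vsub_vsub)
qed

lemma simulated_extrude: "simulated (PPar P (PNu Q)) (PNu (PPar (pren Suc P) Q))"
proof (rule simulatedI)
  let ?R = "PNu (PPar (pren Suc P) Q)"
  note shiftP = trans_pren[of P _ _ Suc, folded shift_label_lsub]
  fix l X assume "trans_pi (PPar P (PNu Q)) l X"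
  then show "\<exists>X'. trans_pi ?R l X' \<and> X \<equiv>\<^sub>\<pi> X'"
  proof (cases rule: PPar_trans)
    case (1 P')
    have "X \<equiv>\<^sub>\<pi> PNu (if binds l then pren swap01 (PPar (psub (lifts l (renaming Suc)) P') (under (shift_label l) Q))
    else PPar (psub (lifts l (renaming Suc)) P') (under (shift_label l) Q))"
      unfolding under_shift_Par_swap 1 by (simp add: under_def peq_extrude)
    with tr_Res[OF tr_ParL[OF shiftP[OF 1(2)]], of Q] show ?thesis by blast
  next
    case (2 Y)
    from 2(2) show ?thesis
    proof (cases rule: PNu_trans)
      case (1 Q')
      show ?thesis unfolding 2 1
        by (rule matched[OF tr_Res[OF tr_ParR[OF 1(2)]]])
          (auto simp: under_def swap_shift lift_shift_shift peq_extrude simp del: psub_psub intro: peq_extrude)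
    next
      case (2 a)
      show ?thesis unfolding \<open>X = _\<close> 2
        by (rule matched[OF tr_Open[OF tr_ParR[OF 2(2)]]]) simp
    qed
  next
    case (3 a P' v Y)
    from 3(4) show ?thesis
    proof (cases rule: PNu_trans)
      case (1 Q')
      have "trans_pi ?R LTau (PNu (PPar (psub (inst (vsub (renaming Suc) v)) (psub (lift (renaming Suc)) P')) Q'))"
        using tr_Res[of _ LTau, simplified, OF tr_ComL[OF shiftP[OF 3(3), simplified], of Q]] 1 by simp
      then show ?thesis using 3 1 by (auto simp: lift_inst peq_extrude simp del: psub_psub)
    qed auto
  next
    case (4 a v P' Y)
    from 4(4) show ?thesis
    proof (cases rule: PNu_trans)
      case (1 Q')
      have "trans_pi ?R LTau (PNu (PPar (pren Suc P') (psub (inst (vsub (renaming Suc) v)) Q')))"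
        using tr_Res[of _ LTau, simplified, OF tr_ComR[OF shiftP[OF 4(3), simplified], of Q]] 1 by simp
      then show ?thesis using 4 1 by (auto simp: inst_shift_swap peq_extrude simp del: psub_psub)
    qed auto
  next
    case (5 a P' Y)
    from 5(4) show ?thesis
    proof (cases rule: PNu_trans)
      case (1 Q')
      have T: "trans_pi ?R LTau (PNu (PNu (PPar (psub (lift (renaming Suc)) P') Q')))"
        using tr_Res[of _ LTau, simplified, OF tr_CloseL[OF shiftP[OF 5(3), simplified], of Q]] 1 by simp
      have "X \<equiv>\<^sub>\<pi> PNu (PNu (PPar (pren Suc P') (pren swap01 Q')))"
        using 5 1 by (simp add: peq_Nu peq_extrude)
      also have "PPar (pren Suc P') (pren swap01 Q') = pren swap01 (PPar (psub (lift (renaming Suc)) P') Q')"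
        by (simp add: swap_lift_shift del: psub_psub)
      also note peq_sym[OF peq_swap]
      finally show ?thesis using T 5 by blast
    next
      case (2 b)
      \<comment> \<open>The private name sent is the restricted one: once its scope is widened, the
        close step becomes an ordinary communication of \<open>Var 0\<close>.\<close>
      have "trans_pi ?R LTau (PNu (PPar (psub (inst (Nm (Var 0))) (psub (lift (renaming Suc)) P')) Y))"
        using tr_Res[of _ LTau, simplified, OF tr_ComL[OF shiftP[OF 5(3), simplified], of Q]] 2 by simp
      then show ?thesis using 5 2 by (auto simp: inst_0_lift_shift simp del: psub_psub)
    qed
  next
    case (6 a P' Y)
    from 6(4) show ?thesis
    proof (cases rule: PNu_trans)
      case (1 Q')
      have T: "trans_pi ?R LTau (PNu (PNu (PPar (psub (lift (renaming Suc)) P') Q')))"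
        using tr_Res[of _ LTau, simplified, OF tr_CloseR[OF shiftP[OF 6(3), simplified], of Q]] 1 by simp
      have "X \<equiv>\<^sub>\<pi> PNu (PNu (PPar (pren Suc P') (pren swap01 Q')))"
        using 6 1 by (simp add: peq_Nu peq_extrude)
      also have "PPar (pren Suc P') (pren swap01 Q') = pren swap01 (PPar (psub (lift (renaming Suc)) P') Q')"
        by (simp add: swap_lift_shift del: psub_psub)
      also note peq_sym[OF peq_swap]
      finally show ?thesis using T 6 by blast
    qed auto
  qed
qed

lemma shift_label_eq_simps [simp]:
  "shift_label l = LTau \<longleftrightarrow> l = LTau" "LTau = shift_label l \<longleftrightarrow> l = LTau"
  "LIn a = shift_label l \<longleftrightarrow> (\<exists>b. l = LIn b \<and> shift_name b = a)"
  "LOut a v = shift_label l \<longleftrightarrow> (\<exists>b w. l = LOut b w \<and> shift_name b = a \<and> vsub (renaming Suc) w = v)"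
  "LBOut a = shift_label l \<longleftrightarrow> (\<exists>b. l = LBOut b \<and> shift_name b = a)"
  "shift_label l = LIn a \<longleftrightarrow> (\<exists>b. l = LIn b \<and> shift_name b = a)"
  "shift_label l = LOut a v \<longleftrightarrow> (\<exists>b w. l = LOut b w \<and> shift_name b = a \<and> vsub (renaming Suc) w = v)"
  "shift_label l = LBOut a \<longleftrightarrow> (\<exists>b. l = LBOut b \<and> shift_name b = a)"
  "shift_label l = shift_label k \<longleftrightarrow> l = k"
  by (cases l; cases k; auto)+

lemma simulated_extrude_back: "simulated (PNu (PPar (pren Suc P) Q)) (PPar P (PNu Q))"
proof (rule simulatedI)
  let ?R = "PPar P (PNu Q)"
  fix l X assume "trans_pi (PNu (PPar (pren Suc P) Q)) l X"
  then show "\<exists>X'. trans_pi ?R l X' \<and> X \<equiv>\<^sub>\<pi> X'"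
  proof (cases rule: PNu_trans)
    case (1 Y)
    note X = 1(1)
    from 1(2) show ?thesis
    proof (cases rule: PPar_trans)
      case (1 Z)
      from 1(2) obtain P' where P: "trans_pi P l P'" "Z = psub (lifts l (renaming Suc)) P'"
        by (elim trans_shift_inv) auto
      have "X = PNu (PPar (pren Suc P') (if binds l then psub (lift (renaming Suc)) Q else Q))"
        unfolding X 1 P under_shift_Par_swap ..
      also have "\<dots> \<equiv>\<^sub>\<pi> PPar P' (under l (PNu Q))"
        by (auto simp: under_def intro: peq_sym peq_extrude)
      finally show ?thesis using tr_ParL[OF P(1)] by blast
    next
      case (2 Q')
      show ?thesis unfolding X 2
        by (rule matched[OF tr_ParR[OF tr_Res[OF 2(2)]]])
          (auto simp: under_def swap_shift lift_shift_shift simp del: psub_psub intro: peq_extrude peq_sym)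
    next
      case (3 a Z v Q')
      from 3(3) obtain b P' where P: "trans_pi P (LIn b) P'" "a = shift_name b"
        "Z = psub (lift (renaming Suc)) P'" by (elim trans_shift_inv) auto
      show ?thesis
      proof (cases v rule: val_shift_cases)
        case 1
        \<comment> \<open>The value is the restricted name. With the narrower scope it must be
          extruded, and the communication becomes a close step.\<close>
        with 3 P have "trans_pi (PNu Q) (LBOut b) Q'" by (auto intro: tr_Open)
        from tr_CloseL[OF P(1) this] show ?thesis
          using X 3 P 1 by (auto simp: inst_0_lift_shift simp del: psub_psub)
      next
        case (2 w)
        with 3 P have "trans_pi (PNu Q) (LOut b w) (PNu Q')" using tr_Res[of Q "LOut b w"] by auto
        from tr_ComL[OF P(1) this] show ?thesis
          using X 3 P 2 by (auto simp: lift_inst simp del: psub_psub intro: peq_extrude peq_sym)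
      qed
    next
      case (4 a v Z Q')
      from 4(3) obtain b w P' where P: "trans_pi P (LOut b w) P'" "a = shift_name b"
        "v = vsub (renaming Suc) w" "Z = pren Suc P'" by (elim trans_shift_inv) auto
      with 4 have "trans_pi (PNu Q) (LIn b) (PNu (pren swap01 Q'))" using tr_Res[of Q "LIn b"] by auto
      from tr_ComR[OF P(1) this] show ?thesis
        using X 4 P by (auto simp: inst_shift_swap simp del: psub_psub intro: peq_extrude peq_sym)
    next
      case (5 a Z Q')
      from 5(3) obtain b P' where P: "trans_pi P (LIn b) P'" "a = shift_name b"
        "Z = psub (lift (renaming Suc)) P'" by (elim trans_shift_inv) auto
      with 5 have "trans_pi (PNu Q) (LBOut b) (PNu (pren swap01 Q'))" using tr_Res[of Q "LBOut b"] by auto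
      note T = tr_CloseL[OF P(1) this]
      have "X = PNu (PNu (PPar (psub (lift (renaming Suc)) P') Q'))" using X 5 P by simp
      also note peq_swap
      also have "pren swap01 (PPar (psub (lift (renaming Suc)) P') Q') = PPar (pren Suc P') (pren swap01 Q')"
        by (simp add: swap_lift_shift del: psub_psub)
      also have "PNu (PNu (PPar (pren Suc P') (pren swap01 Q'))) \<equiv>\<^sub>\<pi> PNu (PPar P' (PNu (pren swap01 Q')))"
        by (meson peq_extrude peq_sym peq_Nu)
      finally show ?thesis using T 5 X by auto
    next
      case (6 a Z Q')
      from 6(3) obtain b P' where P: "trans_pi P (LBOut b) P'" "a = shift_name b"
        "Z = psub (lift (renaming Suc)) P'" by (elim trans_shift_inv) auto
      with 6 have "trans_pi (PNu Q) (LIn b) (PNu (pren swap01 Q'))" using tr_Res[of Q "LIn b"] by auto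
      note T = tr_CloseR[OF P(1) this]
      have "X = PNu (PNu (PPar (psub (lift (renaming Suc)) P') Q'))" using X 6 P by simp
      also note peq_swap
      also have "pren swap01 (PPar (psub (lift (renaming Suc)) P') Q') = PPar (pren Suc P') (pren swap01 Q')"
        by (simp add: swap_lift_shift del: psub_psub)
      also have "PNu (PNu (PPar (pren Suc P') (pren swap01 Q'))) \<equiv>\<^sub>\<pi> PNu (PPar P' (PNu (pren swap01 Q')))"
        by (meson peq_extrude peq_sym peq_Nu)
      finally show ?thesis using T 6 X by auto
    qed
  next
    case (2 a)
    from 2(2) show ?thesis
    proof (cases rule: PPar_trans)
      case (1 Z)
      from 1(2) show ?thesis by (elim trans_shift_inv) auto
    next
      case (2 Q')
      from tr_ParR[OF tr_Open[OF 2(2)], of P] show ?thesis using \<open>l = _\<close> 2 by auto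
    qed auto
  qed
qed

lemma lsub_swap_shift2: "lsub (renaming swap01) (shift_label (shift_label l)) = shift_label (shift_label l)"
proof -
  have "nsub (renaming swap01) (shift_name (shift_name a)) = shift_name (shift_name a)" for a
    by (cases a) auto
  moreover have "vsub (renaming swap01) (vsub (renaming Suc) (vsub (renaming Suc) v)) =
      vsub (renaming Suc) (vsub (renaming Suc) v)" for v
    by (simp add: vsub_vsub)
  ultimately show ?thesis by (cases l) simp_all
qed

text \<open>The braid relation of the two adjacent transpositions of the indices 0, 1, 2, since
  \<open>lift (renaming swap01)\<close> exchanges 1 and 2. It aligns the two restrictions with the
  name bound by the label.\<close>

lemma swap_braid: "pren swap01 (psub (lift (renaming swap01)) (pren swap01 P)) =
    psub (lift (renaming swap01)) (pren swap01 (psub (lift (renaming swap01)) P))"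
  unfolding psub_psub
proof (rule psub_cong, goal_cases)
  case (1 n)
  then show ?case
    by (cases n rule: nat_cases_2; cases "n - 2") (auto simp: lift_def)
qed

lemma simulated_swap: "simulated (PNu (PNu P)) (PNu (PNu (pren swap01 P)))"
proof (rule simulatedI)
  let ?R = "PNu (PNu (pren swap01 P))"
  fix l X assume "trans_pi (PNu (PNu P)) l X"
  then show "\<exists>X'. trans_pi ?R l X' \<and> X \<equiv>\<^sub>\<pi> X'"
  proof (cases rule: PNu_trans)
    case (1 Y)
    note X = 1(1)
    from 1(2) show ?thesis
    proof (cases rule: PNu_trans)
      case (1 P')
      note T = tr_Res[OF tr_Res[OF trans_pren[OF 1(2), of swap01, unfolded lsub_swap_shift2]]]
      show ?thesis
      proof (cases "binds l")
        case True
        have "X \<equiv>\<^sub>\<pi> PNu (PNu (pren swap01 (psub (lift (renaming swap01)) (pren swap01 P'))))"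
          using X 1 True peq_swap by (simp del: psub_psub)
        also note swap_braid
        finally show ?thesis using T True by (auto simp del: psub_psub)
      next
        case False
        then show ?thesis using X 1 T by (auto intro: peq_swap)
      qed
    next
      case (2 a)
      then obtain b where l: "l = LBOut b" "a = shift_name b" by auto
      have "nsub (renaming swap01) (shift_name (shift_name b)) = shift_name (shift_name b)"
        by (cases b) auto
      then have "trans_pi (pren swap01 P) (shift_label (LOut (shift_name b) (Nm (Var 0)))) (pren swap01 Y)"
        using trans_pren[OF 2(2), of swap01] l by simp
      from tr_Open[OF tr_Res[OF this]] show ?thesis using X l by auto
    qed
  next
    case (2 a)
    from 2(2) show ?thesis
    proof (cases rule: PNu_trans)
      case (1 P')
      have "nsub (renaming swap01) (shift_name (shift_name a)) = shift_name (shift_name a)"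
        by (cases a) auto
      then have "trans_pi (pren swap01 P) (LOut (shift_name (shift_name a)) (Nm (Var 0))) (pren swap01 P')"
        using trans_pren[OF 1(2), of swap01] by simp
      from tr_Res[of _ "LBOut a", simplified, OF tr_Open[OF this]] show ?thesis
        using 2 1 by (auto simp: swap_swap simp del: psub_psub)
    qed auto
  qed
qed

lemma simulated_swap_back: "simulated (PNu (PNu (pren swap01 P))) (PNu (PNu P))"
  using simulated_swap[of "pren swap01 P"] by (simp only: swap_swap)

lemma peq_simulated: "P \<equiv>\<^sub>\<pi> Q \<Longrightarrow> simulated P Q \<and> simulated Q P"
proof (induction rule: peq.induct)
  case (peq_refl P)
  show ?case by (auto simp: simulated_def)
next
  case (peq_trans P Q R)
  then show ?case by (meson simulated_trans)
next
  case (peq_Par P P' Q Q')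
  then show ?case by (meson simulated_Par peq_sym)
next
  case (peq_In P P' a)
  then show ?case by (auto intro!: simulatedI intro: tr_In peq_sym)
next
  case (peq_Rep P P' a)
  have "simulated (PRep a P) (PRep a P')" if "P \<equiv>\<^sub>\<pi> P'" for P P'
    using that
    by (auto intro!: simulatedI matched[OF tr_Rep] peq.peq_Par peq.peq_Rep peq_psub)
  with peq_Rep peq_sym show ?case by blast
next
  case (peq_gc)
  show ?case by (auto intro!: simulatedI elim!: PNu_trans)
qed (simp_all add: simulated_Nu simulated_comm simulated_assoc simulated_assoc_right
    simulated_unit simulated_extrude simulated_extrude_back simulated_swap simulated_swap_back)

lemma peq_trans_pi:
  assumes "P \<equiv>\<^sub>\<pi> Q" "trans_pi P l P'"
  obtains Q' where "trans_pi Q l Q'" "P' \<equiv>\<^sub>\<pi> Q'"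
  using assms peq_simulated simulatedD by blast

section \<open>Simple types\<close>

type_synonym tyenv = "nat \<Rightarrow> ty option"

abbreviation tcons :: "ty \<Rightarrow> tyenv \<Rightarrow> tyenv" (infixr "\<cdot>" 65) where
  "T \<cdot> \<Gamma> \<equiv> case_nat (Some T) \<Gamma>"

fun nty :: "tyenv \<Rightarrow> name \<Rightarrow> ty option" where
  "nty \<Gamma> (Var n) = \<Gamma> n"
| "nty \<Gamma> (Success w) = Some (OT UnitT)"

fun vty :: "tyenv \<Rightarrow> val \<Rightarrow> ty option" where
  "vty \<Gamma> (Nm a) = nty \<Gamma> a"
| "vty \<Gamma> Star = Some UnitT"

definition sub_typed :: "tyenv \<Rightarrow> (nat \<Rightarrow> val) \<Rightarrow> tyenv \<Rightarrow> bool" where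
  "sub_typed \<Gamma> \<sigma> \<Delta> \<longleftrightarrow> (\<forall>n T. \<Gamma> n = Some T \<longrightarrow> vty \<Delta> (\<sigma> n) = Some T)"

lemma nty_shift [simp]: "nty (case_nat S \<Gamma>) (shift_name a) = nty \<Gamma> a"
  by (cases a) auto

lemma vty_shift [simp]: "vty (case_nat S \<Gamma>) (vsub (renaming Suc) v) = vty \<Gamma> v"
  by (cases v) (simp_all del: vsub.simps(1,2))

lemma vty_vsub: "sub_typed \<Gamma> \<sigma> \<Delta> \<Longrightarrow> vty \<Gamma> v = Some T \<Longrightarrow> vty \<Delta> (vsub \<sigma> v) = Some T"
  by (cases "(\<sigma>, v)" rule: vsub.cases) (auto simp: sub_typed_def)

lemma nty_nsub:
  assumes "sub_typed \<Gamma> \<sigma> \<Delta>" "nty \<Gamma> a = Some (OT T)"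
  shows "vsub \<sigma> (Nm a) = Nm (nsub \<sigma> a)" "nty \<Delta> (nsub \<sigma> a) = Some (OT T)"
proof -
  have *: "vty \<Delta> (vsub \<sigma> (Nm a)) = Some (OT T)" using vty_vsub[OF assms(1), of "Nm a"] assms(2) by simp
  then show 1: "vsub \<sigma> (Nm a) = Nm (nsub \<sigma> a)" by (intro vsub_Nm) auto
  from * show "nty \<Delta> (nsub \<sigma> a) = Some (OT T)" unfolding 1 by simp
qed

lemma sub_typed_lift: "sub_typed \<Gamma> \<sigma> \<Delta> \<Longrightarrow> sub_typed (T \<cdot> \<Gamma>) (lift \<sigma>) (T \<cdot> \<Delta>)"
  by (auto simp: sub_typed_def split: nat.splits)

lemma sub_typed_cons: "sub_typed \<Gamma> \<sigma> \<Delta> \<Longrightarrow> vty \<Delta> v = Some T \<Longrightarrow> sub_typed (T \<cdot> \<Gamma>) (case_nat v \<sigma>) \<Delta>"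
  by (auto simp: sub_typed_def split: nat.splits)

lemma sub_typed_id: "sub_typed \<Gamma> (\<lambda>n. Nm (Var n)) \<Gamma>"
  by (auto simp: sub_typed_def)

lemma sub_typed_inst: "vty \<Gamma> v = Some T \<Longrightarrow> sub_typed (T \<cdot> \<Gamma>) (inst v) \<Gamma>"
  by (auto simp: sub_typed_def inst_def split: nat.splits)

lemma sub_typed_shift: "sub_typed \<Gamma> (renaming Suc) (T \<cdot> \<Gamma>)"
  by (auto simp: sub_typed_def)

lemma sub_typed_swap: "sub_typed (S \<cdot> T \<cdot> \<Gamma>) (renaming swap01) (T \<cdot> S \<cdot> \<Gamma>)"
  by (auto simp: sub_typed_def swap01_def split: nat.splits)

lemma sub_typed_comp:
  "sub_typed \<Gamma> \<tau> \<Delta> \<Longrightarrow> sub_typed \<Delta> \<sigma> \<Theta> \<Longrightarrow> sub_typed \<Gamma> (\<lambda>n. vsub \<sigma> (\<tau> n)) \<Theta>"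
  by (auto simp: sub_typed_def intro: vty_vsub[unfolded sub_typed_def])

text \<open>In the \<open>\<pi>\<close>-calculus both capabilities of a channel carrying \<open>T\<close> have the type \<open>OT T\<close>.\<close>

primrec pok :: "pi \<Rightarrow> tyenv \<Rightarrow> bool" where
  "pok PInert \<Gamma> \<longleftrightarrow> True"
| "pok (PPar P Q) \<Gamma> \<longleftrightarrow> pok P \<Gamma> \<and> pok Q \<Gamma>"
| "pok (PIn a P) \<Gamma> \<longleftrightarrow> (\<exists>T. vty \<Gamma> a = Some (OT T) \<and> pok P (T \<cdot> \<Gamma>))"
| "pok (POut a v) \<Gamma> \<longleftrightarrow> (\<exists>T. vty \<Gamma> a = Some (OT T) \<and> vty \<Gamma> v = Some T)"
| "pok (PNu P) \<Gamma> \<longleftrightarrow> (\<exists>T. pok P (T \<cdot> \<Gamma>))"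
| "pok (PRep a P) \<Gamma> \<longleftrightarrow> (\<exists>T. vty \<Gamma> a = Some (OT T) \<and> pok P (T \<cdot> \<Gamma>))"

lemma pok_psub: "pok P \<Gamma> \<Longrightarrow> sub_typed \<Gamma> \<sigma> \<Delta> \<Longrightarrow> pok (psub \<sigma> P) \<Delta>"
proof (induction P arbitrary: \<Gamma> \<sigma> \<Delta>)
  case (PIn a P)
  then show ?case by simp (meson vty_vsub sub_typed_lift)
next
  case (PRep a P)
  then show ?case by simp (meson vty_vsub sub_typed_lift)
next
  case (POut a v)
  then show ?case by simp (meson vty_vsub)
next
  case (PNu P)
  then show ?case by simp (meson sub_typed_lift)
qed auto

lemmas pok_shift = pok_psub[OF _ sub_typed_shift]

text \<open>Subjects have a type of the form \<open>OT T\<close>, whereas \<open>Star\<close> only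
  has \<open>UnitT\<close>. This is how typing excludes the substitutions that silence a
  prefix.\<close>

lemma sok_pok: "pok P \<Gamma> \<Longrightarrow> sub_typed \<Gamma> \<sigma> \<Delta> \<Longrightarrow> sok \<sigma> P"
proof (induction P arbitrary: \<Gamma> \<sigma> \<Delta>)
  case (PNu P)
  then show ?case by simp (meson sub_typed_lift)
qed (auto dest: vty_vsub)

text \<open>The type of a name bound by the label is dictated by the subject, so two processes that
  match each other's label have derivatives typed in the same environment.\<close>

fun derivative_ok :: "tyenv \<Rightarrow> label \<Rightarrow> pi \<Rightarrow> bool" where
  "derivative_ok \<Gamma> LTau P \<longleftrightarrow> pok P \<Gamma>"
| "derivative_ok \<Gamma> (LIn a) P \<longleftrightarrow> (\<exists>T. nty \<Gamma> a = Some (OT T) \<and> pok P (T \<cdot> \<Gamma>))"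
| "derivative_ok \<Gamma> (LOut a v) P \<longleftrightarrow> (\<exists>T. nty \<Gamma> a = Some (OT T) \<and> vty \<Gamma> v = Some T \<and> pok P \<Gamma>)"
| "derivative_ok \<Gamma> (LBOut a) P \<longleftrightarrow> (\<exists>T. nty \<Gamma> a = Some (OT T) \<and> pok P (T \<cdot> \<Gamma>))"

lemma derivative_ok_trans: "trans_pi P l P' \<Longrightarrow> pok P \<Gamma> \<Longrightarrow> derivative_ok \<Gamma> l P'"
proof (induction arbitrary: \<Gamma> rule: trans_pi.induct)
  case (tr_Rep a P)
  then obtain T where "nty \<Gamma> a = Some (OT T)" "pok P (T \<cdot> \<Gamma>)" by auto
  then show ?case using pok_shift[of "PRep (Nm a) P" \<Gamma> T] tr_Rep by auto
next
  case (tr_ParL P l P' Q)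
  then show ?case by (cases l) (force simp: under_def intro: pok_shift)+
next
  case (tr_ParR P l P' Q)
  then show ?case by (cases l) (force simp: under_def intro: pok_shift)+
next
  case (tr_ComL P a P' Q v Q')
  then show ?case by (force intro: pok_psub sub_typed_inst)
next
  case (tr_ComR P a v P' Q Q')
  then show ?case by (force intro: pok_psub sub_typed_inst)
next
  case (tr_CloseL P a P' Q Q')
  then show ?case by force
next
  case (tr_CloseR P a P' Q Q')
  then show ?case by force
next
  case (tr_Res P l P')
  then obtain T where "derivative_ok (T \<cdot> \<Gamma>) (shift_label l) P'" by auto
  then show ?case by (cases l) (auto intro: pok_psub[OF _ sub_typed_swap])
next
  case (tr_Open P a P')
  from tr_Open.prems obtain T where "pok P (T \<cdot> \<Gamma>)" by auto
  from tr_Open.IH[OF this] show ?case by auto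
qed auto

section \<open>Weak transitions\<close>

lemma taus_refl [simp]: "taus P P"
  by (simp add: taus_def)

lemma taus_trans [trans]: "taus P Q \<Longrightarrow> taus Q R \<Longrightarrow> taus P R"
  by (simp add: taus_def)

lemma taus_step: "trans_pi P LTau Q \<Longrightarrow> taus P Q"
  unfolding taus_def by (rule r_into_rtranclp)

lemma taus_snoc: "taus P Q \<Longrightarrow> trans_pi Q LTau R \<Longrightarrow> taus P R"
  by (blast intro: taus_trans taus_step)

lemma taus_induct [consumes 1, case_names refl step]:
  assumes "taus P Q" "R P" "\<And>Q Q'. taus P Q \<Longrightarrow> trans_pi Q LTau Q' \<Longrightarrow> R Q \<Longrightarrow> R Q'"
  shows "R Q"
  using assms unfolding taus_def by (induction rule: rtranclp_induct) blast+

lemma pok_taus: "taus P P' \<Longrightarrow> pok P \<Gamma> \<Longrightarrow> pok P' \<Gamma>"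
  by (induction rule: taus_induct) (auto dest: derivative_ok_trans)

lemma taus_ParL: "taus P P' \<Longrightarrow> taus (PPar P Q) (PPar P' Q)"
  by (induction rule: taus_induct) (simp, metis taus_snoc tr_ParL under_simps(1))

lemma taus_ParR: "taus P P' \<Longrightarrow> taus (PPar Q P) (PPar Q P')"
  by (induction rule: taus_induct) (simp, metis taus_snoc tr_ParR under_simps(1))

lemma tr_Res_tau: "trans_pi P LTau P' \<Longrightarrow> trans_pi (PNu P) LTau (PNu P')"
  using tr_Res[of P LTau P'] by simp

lemma taus_Nu: "taus P P' \<Longrightarrow> taus (PNu P) (PNu P')"
  by (induction rule: taus_induct) (auto intro: taus_snoc tr_Res_tau)

text \<open>Typing is carried along because \<open>sok\<close> must hold at every intermediate
  process.\<close>

lemma taus_psub: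
  assumes "taus P P'" "pok P \<Gamma>" "sub_typed \<Gamma> \<sigma> \<Delta>"
  shows "taus (psub \<sigma> P) (psub \<sigma> P')"
  using assms
proof (induction rule: taus_induct)
  case (step Q Q')
  then have "trans_pi (psub \<sigma> Q) LTau (psub \<sigma> Q')"
    using trans_psub[of Q LTau Q' \<sigma>] sok_pok[OF pok_taus] by simp
  with step show ?case by (blast intro: taus_snoc)
qed simp

lemma taus_pren: "taus P P' \<Longrightarrow> taus (pren f P) (pren f P')"
proof (induction rule: taus_induct)
  case (step Q Q')
  have "trans_pi (pren f Q) LTau (pren f Q')" using trans_pren[OF step(2), of f] by simp
  with step(3) show ?case by (rule taus_snoc)
qed simp

lemma peq_taus:
  assumes "taus P P'" "P \<equiv>\<^sub>\<pi> Q"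
  shows "\<exists>Q'. taus Q Q' \<and> P' \<equiv>\<^sub>\<pi> Q'"
  using assms
proof (induction rule: taus_induct)
  case (step R R')
  then obtain Q' where Q': "taus Q Q'" "R \<equiv>\<^sub>\<pi> Q'" by blast
  from peq_trans_pi[OF Q'(2) step(2)] obtain Q'' where "trans_pi Q' LTau Q''" "R' \<equiv>\<^sub>\<pi> Q''" .
  with Q' show ?case by (blast intro: taus_snoc)
qed (use assms(2) taus_refl in blast)

lemma weak_transI: "taus P P' \<Longrightarrow> trans_pi P' l Q' \<Longrightarrow> taus Q' Q \<Longrightarrow> weak_trans P l Q"
  by (cases "l = LTau") (auto simp: weak_trans_def intro: taus_snoc taus_trans)

lemma weak_transE:
  assumes "weak_trans P l Q" "l \<noteq> LTau"
  obtains P' Q' where "taus P P'" "trans_pi P' l Q'" "taus Q' Q"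
  using assms by (auto simp: weak_trans_def)

lemma weak_LTau [simp]: "weak_trans P LTau Q \<longleftrightarrow> taus P Q"
  by (simp add: weak_trans_def)

lemma derivative_ok_taus: "derivative_ok \<Gamma> l P \<Longrightarrow> taus P P' \<Longrightarrow> derivative_ok \<Gamma> l P'"
  by (cases l) (auto intro: pok_taus)

lemma derivative_ok_weak: "weak_trans P l P' \<Longrightarrow> pok P \<Gamma> \<Longrightarrow> derivative_ok \<Gamma> l P'"
  by (cases "l = LTau")
    (auto elim!: weak_transE intro: pok_taus derivative_ok_taus dest: derivative_ok_trans)

lemma peq_weak:
  assumes "weak_trans P l P'" "P \<equiv>\<^sub>\<pi> Q"
  shows "\<exists>Q'. weak_trans Q l Q' \<and> P' \<equiv>\<^sub>\<pi> Q'"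
proof (cases "l = LTau")
  case True
  then show ?thesis using assms peq_taus by auto
next
  case False
  from weak_transE[OF assms(1) False] obtain P1 P2 where
    *: "taus P P1" "trans_pi P1 l P2" "taus P2 P'" .
  obtain Q1 where Q1: "taus Q Q1" "P1 \<equiv>\<^sub>\<pi> Q1" using peq_taus[OF *(1) assms(2)] by blast
  obtain Q2 where Q2: "trans_pi Q1 l Q2" "P2 \<equiv>\<^sub>\<pi> Q2" using peq_trans_pi[OF Q1(2) *(2)] by blast
  obtain Q' where "taus Q2 Q'" "P' \<equiv>\<^sub>\<pi> Q'" using peq_taus[OF *(3) Q2(2)] by blast
  then show ?thesis using Q1 Q2 weak_transI by blast
qed

lemma weak_ParL:
  assumes "weak_trans P l P'" shows "weak_trans (PPar P Q) l (PPar P' (under l Q))"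
proof (cases "l = LTau")
  case False
  from weak_transE[OF assms False] show ?thesis by (blast intro: weak_transI taus_ParL tr_ParL)
qed (use assms taus_ParL in auto)

lemma weak_psub:
  assumes "weak_trans P l P'" "pok P \<Gamma>" "sub_typed \<Gamma> \<sigma> \<Delta>"
  shows "weak_trans (psub \<sigma> P) (lsub \<sigma> l) (psub (lifts l \<sigma>) P')"
proof (cases "l = LTau")
  case True
  then show ?thesis using assms taus_psub by auto
next
  case False
  from weak_transE[OF assms(1) False] obtain P1 P2 where
    *: "taus P P1" "trans_pi P1 l P2" "taus P2 P'" .
  have ok: "pok P1 \<Gamma>" using * assms pok_taus by blast
  have "taus (psub (lifts l \<sigma>) P2) (psub (lifts l \<sigma>) P')"
    using derivative_ok_trans[OF *(2) ok] *(3) assms(3)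
    by (cases l) (auto intro: taus_psub sub_typed_lift)
  moreover have "trans_pi (psub \<sigma> P1) (lsub \<sigma> l) (psub (lifts l \<sigma>) P2)"
    using trans_psub * ok assms sok_pok by blast
  ultimately show ?thesis using taus_psub * assms weak_transI by blast
qed

text \<open>The internal steps after the weak input happen once the value has arrived, that is under
  \<open>inst v\<close>. They survive because the subject \<open>a\<close> forces \<open>v\<close>
  to have the type that the receiver expects. In \<open>weak_ComR\<close> the input is a single step
  and this question does not arise.\<close>

lemma weak_ComL:
  assumes "weak_trans P (LIn a) P'" "pok P \<Gamma>" "trans_pi Q (LOut a v) Q'" "pok Q \<Gamma>"
  shows "taus (PPar P Q) (PPar (psub (inst v) P') Q')"
proof -
  from assms(1) obtain P1 P2 where *: "taus P P1" "trans_pi P1 (LIn a) P2" "taus P2 P'"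
    by (auto elim: weak_transE)
  have "pok P1 \<Gamma>" using * assms pok_taus by blast
  from derivative_ok_trans[OF *(2) this] obtain T where
    T: "nty \<Gamma> a = Some (OT T)" "pok P2 (T \<cdot> \<Gamma>)" by auto
  from derivative_ok_trans[OF assms(3,4)] T have "vty \<Gamma> v = Some T" by auto
  with T * have "taus (psub (inst v) P2) (psub (inst v) P')"
    by (blast intro: taus_psub sub_typed_inst)
  then show ?thesis
    using taus_ParL[OF *(1)] tr_ComL[OF *(2) assms(3)] taus_ParL taus_step taus_trans by meson
qed

lemma weak_ComR:
  assumes "weak_trans P (LOut a v) P'" "trans_pi Q (LIn a) Q'"
  shows "taus (PPar P Q) (PPar P' (psub (inst v) Q'))"
  using assms by (auto elim!: weak_transE) (meson taus_ParL tr_ComR taus_step taus_trans)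

lemma weak_CloseL:
  assumes "weak_trans P (LIn a) P'" "trans_pi Q (LBOut a) Q'"
  shows "taus (PPar P Q) (PNu (PPar P' Q'))"
  using assms by (auto elim!: weak_transE) (meson taus_ParL taus_Nu tr_CloseL taus_step taus_trans)

lemma weak_CloseR:
  assumes "weak_trans P (LBOut a) P'" "trans_pi Q (LIn a) Q'"
  shows "taus (PPar P Q) (PNu (PPar P' Q'))"
  using assms by (auto elim!: weak_transE) (meson taus_ParL taus_Nu tr_CloseR taus_step taus_trans)

lemma weak_Nu:
  assumes "weak_trans P (shift_label l) P'"
  shows "weak_trans (PNu P) l (PNu (if binds l then pren swap01 P' else P'))"
proof (cases "l = LTau")
  case False
  then have "shift_label l \<noteq> LTau" by simp
  from weak_transE[OF assms this] obtain P1 P2 where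
    *: "taus P P1" "trans_pi P1 (shift_label l) P2" "taus P2 P'" .
  have "taus (PNu (if binds l then pren swap01 P2 else P2)) (PNu (if binds l then pren swap01 P' else P'))"
    using *(3) taus_Nu taus_pren by simp
  then show ?thesis by (rule weak_transI[OF taus_Nu[OF *(1)] tr_Res[OF *(2)]])
qed (use assms taus_Nu in auto)

lemma weak_Open:
  assumes "weak_trans P (LOut (shift_name a) (Nm (Var 0))) P'"
  shows "weak_trans (PNu P) (LBOut a) P'"
  using assms by (auto elim!: weak_transE) (meson weak_transI taus_Nu tr_Open)

section \<open>Outputs float to the top level, and replaying them after a substitution\<close>

lemma LOut_peq:
  "trans_pi P l P' \<Longrightarrow> l = LOut a v \<Longrightarrow> P \<equiv>\<^sub>\<pi> PPar (POut (Nm a) v) P'"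
proof (induction arbitrary: a v rule: trans_pi.induct)
  case (tr_Out a v)
  then show ?case by (auto intro: peq_sym peq_unit)
next
  case (tr_ParL P l P' Q)
  then have "PPar P Q \<equiv>\<^sub>\<pi> PPar (PPar (POut (Nm a) v) P') Q" by (simp add: peq_Par)
  also note peq_assoc
  finally show ?case using tr_ParL by simp
next
  case (tr_ParR Q l Q' P)
  then have "PPar P Q \<equiv>\<^sub>\<pi> PPar P (PPar (POut (Nm a) v) Q')" by (simp add: peq_Par)
  also note peq_left_commute
  finally show ?case using tr_ParR by simp
next
  case (tr_Res P l P')
  then have "PNu P \<equiv>\<^sub>\<pi> PNu (PPar (pren Suc (POut (Nm a) v)) P')" by (simp add: peq_Nu)
  also note peq_sym[OF peq_extrude]
  finally show ?case using tr_Res by simp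
qed auto

text \<open>Undoes an extrusion: the private name returns under its binder, with the message beside
  the derivative. A restriction crossed on the way has to change places with that binder, hence
  \<open>peq_swap\<close>.\<close>

lemma LBOut_peq:
  "trans_pi P l P' \<Longrightarrow> l = LBOut a \<Longrightarrow>
    P \<equiv>\<^sub>\<pi> PNu (PPar (POut (Nm (shift_name a)) (Nm (Var 0))) P')"
proof (induction arbitrary: a rule: trans_pi.induct)
  case (tr_ParL P l P' Q)
  let ?O = "POut (Nm (shift_name a)) (Nm (Var 0))"
  have "PPar P Q \<equiv>\<^sub>\<pi> PPar (PNu (PPar ?O P')) Q" using tr_ParL by (simp add: peq_Par)
  also note peq_extrude_left
  also have "PNu (PPar (PPar ?O P') (pren Suc Q)) \<equiv>\<^sub>\<pi> PNu (PPar ?O (PPar P' (pren Suc Q)))"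
    by (simp add: peq_assoc peq_Nu)
  finally show ?case using tr_ParL by simp
next
  case (tr_ParR Q l Q' P)
  let ?O = "POut (Nm (shift_name a)) (Nm (Var 0))"
  have "PPar P Q \<equiv>\<^sub>\<pi> PPar P (PNu (PPar ?O Q'))" using tr_ParR by (simp add: peq_Par)
  also note peq_extrude
  also have "PNu (PPar (pren Suc P) (PPar ?O Q')) \<equiv>\<^sub>\<pi> PNu (PPar ?O (PPar (pren Suc P) Q'))"
    by (simp add: peq_left_commute peq_Nu)
  finally show ?case using tr_ParR by simp
next
  case (tr_Res P l P')
  let ?O = "POut (Nm (shift_name a)) (Nm (Var 0))"
  have "nsub (renaming swap01) (shift_name (shift_name a)) = shift_name (shift_name a)"
    by (cases a) auto
  then have O: "pren swap01 (POut (Nm (shift_name (shift_name a))) (Nm (Var 0))) = pren Suc ?O"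
    by (cases a) simp_all
  have "PNu P \<equiv>\<^sub>\<pi> PNu (PNu (PPar (POut (Nm (shift_name (shift_name a))) (Nm (Var 0))) P'))"
    using tr_Res by (simp add: peq_Nu)
  also note peq_swap
  also have "PNu (PNu (pren swap01 (PPar (POut (Nm (shift_name (shift_name a))) (Nm (Var 0))) P'))) =
      PNu (PNu (PPar (pren Suc ?O) (pren swap01 P')))"
    using O by simp
  also have "\<dots> \<equiv>\<^sub>\<pi> PNu (PPar ?O (PNu (pren swap01 P')))" by (meson peq_extrude peq_sym peq_Nu)
  finally show ?case using tr_Res by simp
next
  case (tr_Open P b P')
  then show ?case using LOut_peq peq_Nu by simp
qed auto

text \<open>The output may precede internal steps on which the input depends. By
  \<open>LOut_peq\<close> the message is put back beside the rest and held during these steps, until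
  the input, now on the same channel, consumes it.\<close>

lemma weak_out_in:
  assumes "weak_trans P (LOut a v) P\<^sub>1" "weak_trans P\<^sub>1 (LIn c) P\<^sub>2"
    and ok: "pok P \<Gamma>" "sub_typed \<Gamma> \<sigma> \<Delta>" and ac: "nsub \<sigma> a = nsub \<sigma> c"
  shows "\<exists>X. taus (psub \<sigma> P) X \<and> X \<equiv>\<^sub>\<pi> psub (case_nat (vsub \<sigma> v) \<sigma>) P\<^sub>2"
proof -
  let ?O = "POut (Nm a) v"
  from assms(1,2) obtain Pa Pb Pc Pd where
    *: "taus P Pa" "trans_pi Pa (LOut a v) Pb" "taus Pb Pc" "trans_pi Pc (LIn c) Pd" "taus Pd P\<^sub>2"
    by (auto elim!: weak_transE) (metis taus_trans)
  have "pok Pa \<Gamma>" using * ok pok_taus by blast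
  then obtain T where T: "nty \<Gamma> a = Some (OT T)" "vty \<Gamma> v = Some T" "pok Pb \<Gamma>"
    using derivative_ok_trans[OF *(2)] by fastforce
  have c: "pok Pc \<Gamma>" using * T pok_taus by blast
  obtain S where S: "nty \<Gamma> c = Some (OT S)" "pok Pd (S \<cdot> \<Gamma>)"
    using derivative_ok_trans[OF *(4) c] by fastforce
  \<comment> \<open>\<open>\<sigma>\<close> preserves types and sends both subjects to one name, so
    the object fits the input.\<close>
  have "S = T" using nty_nsub(2)[OF ok(2) T(1)] nty_nsub(2)[OF ok(2) S(1)] ac by simp
  have "psub \<sigma> Pa \<equiv>\<^sub>\<pi> psub \<sigma> (PPar ?O Pb)" using LOut_peq[OF *(2)] peq_psub by blast
  have "taus (psub \<sigma> (PPar ?O Pb)) (psub \<sigma> (PPar ?O Pc))"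
    by (rule taus_psub[OF taus_ParR[OF *(3)]]) (use T ok in auto)
  also have "trans_pi (psub \<sigma> (PPar ?O Pc)) LTau (PPar PInert (psub (inst (vsub \<sigma> v)) (psub (lift \<sigma>) Pd)))"
  proof -
    have "trans_pi (psub \<sigma> ?O) (LOut (nsub \<sigma> a) (vsub \<sigma> v)) PInert"
      using trans_psub[OF tr_Out[of a v], of \<sigma>] sok_pok[of ?O \<Gamma> \<sigma> \<Delta>] T ok by simp
    moreover have "trans_pi (psub \<sigma> Pc) (LIn (nsub \<sigma> a)) (psub (lift \<sigma>) Pd)"
      using trans_psub[OF *(4)] sok_pok[OF c ok(2)] ac by simp
    ultimately show ?thesis unfolding psub.simps(2) by (rule tr_ComR)
  qed
  then have "taus (psub \<sigma> (PPar ?O Pc)) (PPar PInert (psub (case_nat (vsub \<sigma> v) \<sigma>) Pd))"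
    using taus_step by (simp add: inst_lift)
  also have "taus (PPar PInert (psub (case_nat (vsub \<sigma> v) \<sigma>) Pd)) (PPar PInert (psub (case_nat (vsub \<sigma> v) \<sigma>) P\<^sub>2))"
    by (rule taus_ParR[OF taus_psub[OF *(5) S(2) sub_typed_cons[OF ok(2)]]])
      (use \<open>S = T\<close> T vty_vsub ok in auto)
  finally obtain X where "taus (psub \<sigma> Pa) X" "X \<equiv>\<^sub>\<pi> psub (case_nat (vsub \<sigma> v) \<sigma>) P\<^sub>2"
    using peq_taus[OF _ peq_sym[OF \<open>psub \<sigma> Pa \<equiv>\<^sub>\<pi> _\<close>]] peq_unit_left peq_sym peq_trans by metis
  moreover have "taus (psub \<sigma> P) (psub \<sigma> Pa)" using taus_psub * ok by blast
  ultimately show ?thesis using taus_trans by blast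
qed

text \<open>After \<open>LBOut_peq\<close> the extruded name is an ordinary name below a
  restriction, and there the claim is that of \<open>weak_out_in\<close> for
  \<open>lift \<sigma>\<close> and the object \<open>Var 0\<close>.\<close>

lemma weak_bout_in:
  assumes "weak_trans P (LBOut a) P\<^sub>1" "weak_trans P\<^sub>1 (LIn (shift_name c)) P\<^sub>2"
    and ok: "pok P \<Gamma>" "sub_typed \<Gamma> \<sigma> \<Delta>" and ac: "nsub \<sigma> a = nsub \<sigma> c"
  shows "\<exists>X. taus (psub \<sigma> P) X \<and> X \<equiv>\<^sub>\<pi> PNu (psub (case_nat (Nm (Var 0)) (lift \<sigma>)) P\<^sub>2)"
proof -
  let ?O = "POut (Nm (shift_name a)) (Nm (Var 0))"
  let ?\<tau> = "case_nat (Nm (Var 0)) (lift \<sigma>)"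
  from assms(1,2) obtain Pa Pb where *: "taus P Pa" "trans_pi Pa (LBOut a) Pb" "taus Pb P\<^sub>1"
    by (auto elim!: weak_transE)
  have "pok Pa \<Gamma>" using * ok pok_taus by blast
  then obtain T where T: "nty \<Gamma> a = Some (OT T)" "pok Pb (T \<cdot> \<Gamma>)"
    using derivative_ok_trans[OF *(2)] by fastforce
  have eq: "psub \<sigma> Pa \<equiv>\<^sub>\<pi> psub \<sigma> (PNu (PPar ?O Pb))" using LBOut_peq[OF *(2)] peq_psub by blast
  have "weak_trans (PPar ?O Pb) (LOut (shift_name a) (Nm (Var 0))) (PPar PInert P\<^sub>1)"
    by (rule weak_transI[OF taus_refl tr_ParL[OF tr_Out]]) (simp add: * taus_ParR)
  moreover have "weak_trans (PPar PInert P\<^sub>1) (LIn (shift_name c)) (PPar PInert P\<^sub>2)"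
    using assms(2) by (auto elim!: weak_transE) (metis weak_transI taus_ParR tr_ParR under_simps(3) psub.simps(1))
  ultimately obtain X where X: "taus (psub (lift \<sigma>) (PPar ?O Pb)) X" "X \<equiv>\<^sub>\<pi> psub ?\<tau> (PPar PInert P\<^sub>2)"
    using weak_out_in[of "PPar ?O Pb" _ _ _ _ _ "T \<cdot> \<Gamma>" "lift \<sigma>" "T \<cdot> \<Delta>"] T ok ac
    by (force simp: sub_typed_lift)
  obtain Y where "taus (psub \<sigma> Pa) Y" "Y \<equiv>\<^sub>\<pi> PNu (psub ?\<tau> P\<^sub>2)"
  proof -
    have "psub \<sigma> (PNu (PPar ?O Pb)) = PNu (psub (lift \<sigma>) (PPar ?O Pb))" by simp
    with peq_taus[OF taus_Nu[OF X(1)]] eq obtain Y where Y: "taus (psub \<sigma> Pa) Y" "PNu X \<equiv>\<^sub>\<pi> Y"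
      using peq_sym by metis
    have "X \<equiv>\<^sub>\<pi> psub ?\<tau> P\<^sub>2" using X(2) peq_unit_left peq_trans by (metis psub.simps(1,2))
    with Y that show ?thesis by (blast intro: peq_sym peq_trans peq_Nu)
  qed
  moreover have "taus (psub \<sigma> P) (psub \<sigma> Pa)" using taus_psub * ok by blast
  ultimately show ?thesis using taus_trans by blast
qed

section \<open>Congruence of weak bisimilarity\<close>

lemma weak_bisimilar_sym: "P \<approx>\<^sub>\<pi> Q \<Longrightarrow> Q \<approx>\<^sub>\<pi> P"
  unfolding weak_bisimilar_def weak_bisimulation_def by (blast dest: sympD)

lemma weak_bisimilarD:
  assumes "P \<approx>\<^sub>\<pi> Q" "trans_pi P l P'"
  obtains Q' where "weak_trans Q l Q'" "P' \<approx>\<^sub>\<pi> Q'"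
  using assms unfolding weak_bisimilar_def weak_bisimulation_def by blast

lemma weak_bisimilarI:
  assumes "\<And>P Q. R P Q \<Longrightarrow> R Q P"
    and "\<And>P Q l P'. R P Q \<Longrightarrow> trans_pi P l P' \<Longrightarrow> \<exists>Q'. weak_trans Q l Q' \<and> R P' Q'"
    and "R P Q"
  shows "P \<approx>\<^sub>\<pi> Q"
  unfolding weak_bisimilar_def weak_bisimulation_def
  using assms by (intro exI[of _ R]) (auto intro: sympI)

text \<open>Bisimilarity is required before the substitution, because that is where a communication
  created by \<open>\<sigma>\<close> is still visible as two steps. \<open>R\<close> stands for the
  surrounding processes and is already written in the target names. \<open>ec_Nu\<close> serves
  private names exchanged in communications, \<open>ec_peq\<close> serves replayed outputs, whose
  result is known only up to \<open>peq\<close>.\<close>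

inductive eval_closure :: "tyenv \<Rightarrow> pi \<Rightarrow> pi \<Rightarrow> bool" where
  ec_base: "\<lbrakk>P \<approx>\<^sub>\<pi> Q; pok P \<Gamma>; pok Q \<Gamma>; sub_typed \<Gamma> \<sigma> \<Delta>; pok R \<Delta>\<rbrakk>
    \<Longrightarrow> eval_closure \<Delta> (PPar (psub \<sigma> P) R) (PPar (psub \<sigma> Q) R)"
| ec_Nu: "eval_closure (T \<cdot> \<Gamma>) A B \<Longrightarrow> eval_closure \<Gamma> (PNu A) (PNu B)"
| ec_peq: "A \<equiv>\<^sub>\<pi> A' \<Longrightarrow> eval_closure \<Gamma> A' B' \<Longrightarrow> B' \<equiv>\<^sub>\<pi> B \<Longrightarrow> eval_closure \<Gamma> A B"

lemma eval_closure_sym: "eval_closure \<Gamma> A B \<Longrightarrow> eval_closure \<Gamma> B A"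
  by (induction rule: eval_closure.induct)
    (blast intro: eval_closure.intros weak_bisimilar_sym peq_sym)+

lemma eval_closure_psub:
  "eval_closure \<Gamma> A B \<Longrightarrow> sub_typed \<Gamma> \<sigma> \<Delta> \<Longrightarrow> eval_closure \<Delta> (psub \<sigma> A) (psub \<sigma> B)"
proof (induction arbitrary: \<sigma> \<Delta> rule: eval_closure.induct)
  case (ec_base P Q \<Gamma> \<tau> \<Theta> R)
  then show ?case
    using eval_closure.ec_base[OF ec_base(1-3) sub_typed_comp pok_psub, of \<tau> \<Theta> \<sigma> \<Delta>] by simp
next
  case (ec_Nu T \<Gamma> A B)
  show ?case unfolding psub.simps
    by (rule eval_closure.ec_Nu[OF ec_Nu.IH[OF sub_typed_lift[OF ec_Nu.prems]]])
next
  case (ec_peq A A' \<Gamma> B' B)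
  then show ?case using eval_closure.ec_peq peq_psub by blast
qed

lemma eval_closure_psub_step:
  assumes bis: "P \<approx>\<^sub>\<pi> Q" "pok P \<Gamma>" "pok Q \<Gamma>" "sub_typed \<Gamma> \<sigma> \<Delta>" "pok R \<Delta>"
    and l: "trans_pi P l P'"
  shows "\<exists>Q'. weak_trans (psub \<sigma> Q) (lsub \<sigma> l) (psub (lifts l \<sigma>) Q') \<and> P' \<approx>\<^sub>\<pi> Q' \<and>
    derivative_ok \<Gamma> l P' \<and> derivative_ok \<Gamma> l Q'"
  using weak_bisimilarD[OF bis(1) l] weak_psub[OF _ bis(3,4)] derivative_ok_weak[OF _ bis(3)]
    derivative_ok_trans[OF l bis(2)] by metis

lemma eval_closure_base_step:
  assumes bis: "P \<approx>\<^sub>\<pi> Q" "pok P \<Gamma>" "pok Q \<Gamma>" "sub_typed \<Gamma> \<sigma> \<Delta>" "pok R \<Delta>"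
    and "trans_pi (PPar (psub \<sigma> P) R) l A'"
  shows "\<exists>B'. weak_trans (PPar (psub \<sigma> Q) R) l B' \<and>
    (if binds l then \<exists>T. eval_closure (T \<cdot> \<Delta>) A' B' else eval_closure \<Delta> A' B')"
  using assms(6)
proof (cases rule: PPar_trans)
  case (1 X)
  from trans_psub_inv[OF 1(2)] show ?thesis
  proof (elim disjE exE conjE)
    fix k P'
    assume *: "trans_pi P k P'" "l = lsub \<sigma> k" "X = psub (lifts k \<sigma>) P'"
    from eval_closure_psub_step[OF bis *(1)] obtain Q' where
      Q': "weak_trans (psub \<sigma> Q) l (psub (lifts k \<sigma>) Q')" "P' \<approx>\<^sub>\<pi> Q'"
      "derivative_ok \<Gamma> k P'" "derivative_ok \<Gamma> k Q'" unfolding *(2) by blast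
    have "pok P' \<Gamma> \<and> pok Q' \<Gamma> \<and> \<not> binds k \<or> (\<exists>S. pok P' (S \<cdot> \<Gamma>) \<and> pok Q' (S \<cdot> \<Gamma>)) \<and> binds k"
      using Q'(3,4) by (cases k) auto
    then have "if binds k then \<exists>T. eval_closure (T \<cdot> \<Delta>)
          (PPar (psub (lifts k \<sigma>) P') (under k R)) (PPar (psub (lifts k \<sigma>) Q') (under k R))
        else eval_closure \<Delta> (PPar (psub (lifts k \<sigma>) P') (under k R)) (PPar (psub (lifts k \<sigma>) Q') (under k R))"
      using ec_base[OF Q'(2) _ _ bis(4,5)] ec_base[OF Q'(2) _ _ sub_typed_lift[OF bis(4)] pok_shift[OF bis(5)]]
      by (auto simp: under_def)
    with weak_ParL[OF Q'(1), of R] show ?thesis using 1 * by (auto simp: under_lsub)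
  next
    assume l: "l = LTau" "reacts \<sigma> P X"
    \<comment> \<open>A communication created by \<open>\<sigma>\<close>: \<open>Q\<close> answers
      the output and then the input of \<open>P\<close>, and \<open>weak_out_in\<close> or
      \<open>weak_bout_in\<close> merges the two answers into internal steps.\<close>
    have "\<exists>Y. taus (psub \<sigma> Q) Y \<and> eval_closure \<Delta> (PPar X R) (PPar Y R)"
      using l(2) unfolding reacts_def
    proof (elim disjE exE conjE)
      fix a c v P\<^sub>1 P\<^sub>2
      assume *: "trans_pi P (LOut a v) P\<^sub>1" "trans_pi P\<^sub>1 (LIn c) P\<^sub>2" "nsub \<sigma> a = nsub \<sigma> c"
        "X \<equiv>\<^sub>\<pi> psub (case_nat (vsub \<sigma> v) \<sigma>) P\<^sub>2"
      obtain Q\<^sub>1 where Q1: "weak_trans Q (LOut a v) Q\<^sub>1" "P\<^sub>1 \<approx>\<^sub>\<pi> Q\<^sub>1"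
        using weak_bisimilarD[OF bis(1) *(1)] .
      obtain Q\<^sub>2 where Q2: "weak_trans Q\<^sub>1 (LIn c) Q\<^sub>2" "P\<^sub>2 \<approx>\<^sub>\<pi> Q\<^sub>2"
        using weak_bisimilarD[OF Q1(2) *(2)] .
      obtain Y where Y: "taus (psub \<sigma> Q) Y" "Y \<equiv>\<^sub>\<pi> psub (case_nat (vsub \<sigma> v) \<sigma>) Q\<^sub>2"
        using weak_out_in[OF Q1(1) Q2(1) bis(3,4) *(3)] by blast
      obtain T where T: "nty \<Gamma> a = Some (OT T)" "vty \<Gamma> v = Some T" "pok P\<^sub>1 \<Gamma>"
        using derivative_ok_trans[OF *(1) bis(2)] by auto
      obtain S where S: "nty \<Gamma> c = Some (OT S)" "pok P\<^sub>2 (S \<cdot> \<Gamma>)"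
        using derivative_ok_trans[OF *(2) T(3)] by auto
      have "pok Q\<^sub>1 \<Gamma>" using derivative_ok_weak[OF Q1(1) bis(3)] by auto
      then have Q2ok: "pok Q\<^sub>2 (S \<cdot> \<Gamma>)" using derivative_ok_weak[OF Q2(1)] S by fastforce
      have "S = T" using nty_nsub(2)[OF bis(4) T(1)] nty_nsub(2)[OF bis(4) S(1)] *(3) by simp
      then have "sub_typed (S \<cdot> \<Gamma>) (case_nat (vsub \<sigma> v) \<sigma>) \<Delta>"
        using T bis vty_vsub sub_typed_cons by metis
      from ec_base[OF Q2(2) S(2) Q2ok this bis(5)] have "eval_closure \<Delta> (PPar X R) (PPar Y R)"
        by (rule ec_peq[rotated]) (simp_all add: peq_Par * Y peq_sym)
      with Y show ?thesis by blast
    next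
      fix a c P\<^sub>1 P\<^sub>2
      assume *: "trans_pi P (LBOut a) P\<^sub>1" "trans_pi P\<^sub>1 (LIn (shift_name c)) P\<^sub>2" "nsub \<sigma> a = nsub \<sigma> c"
        "X \<equiv>\<^sub>\<pi> PNu (psub (case_nat (Nm (Var 0)) (lift \<sigma>)) P\<^sub>2)"
      let ?\<tau> = "case_nat (Nm (Var 0)) (lift \<sigma>)"
      obtain Q\<^sub>1 where Q1: "weak_trans Q (LBOut a) Q\<^sub>1" "P\<^sub>1 \<approx>\<^sub>\<pi> Q\<^sub>1"
        using weak_bisimilarD[OF bis(1) *(1)] .
      obtain Q\<^sub>2 where Q2: "weak_trans Q\<^sub>1 (LIn (shift_name c)) Q\<^sub>2" "P\<^sub>2 \<approx>\<^sub>\<pi> Q\<^sub>2"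
        using weak_bisimilarD[OF Q1(2) *(2)] .
      obtain Y where Y: "taus (psub \<sigma> Q) Y" "Y \<equiv>\<^sub>\<pi> PNu (psub ?\<tau> Q\<^sub>2)"
        using weak_bout_in[OF Q1(1) Q2(1) bis(3,4) *(3)] by blast
      obtain T where T: "nty \<Gamma> a = Some (OT T)" "pok P\<^sub>1 (T \<cdot> \<Gamma>)"
        using derivative_ok_trans[OF *(1) bis(2)] by auto
      obtain S where S: "nty \<Gamma> c = Some (OT S)" "pok P\<^sub>2 (S \<cdot> T \<cdot> \<Gamma>)"
        using derivative_ok_trans[OF *(2) T(2)] by auto
      have "pok Q\<^sub>1 (T \<cdot> \<Gamma>)" using derivative_ok_weak[OF Q1(1) bis(3)] T by auto
      then have Q2ok: "pok Q\<^sub>2 (S \<cdot> T \<cdot> \<Gamma>)" using derivative_ok_weak[OF Q2(1)] S by fastforce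
      have "S = T" using nty_nsub(2)[OF bis(4) T(1)] nty_nsub(2)[OF bis(4) S(1)] *(3) by simp
      then have "sub_typed (S \<cdot> T \<cdot> \<Gamma>) ?\<tau> (T \<cdot> \<Delta>)"
        using bis by (intro sub_typed_cons sub_typed_lift) auto
      from ec_Nu[OF ec_base[OF Q2(2) S(2) Q2ok this pok_shift[OF bis(5)]]]
      have "eval_closure \<Delta> (PPar X R) (PPar Y R)"
      proof (rule ec_peq[rotated])
        show "PPar X R \<equiv>\<^sub>\<pi> PNu (PPar (psub ?\<tau> P\<^sub>2) (pren Suc R))"
          using peq_Par[OF *(4) peq_refl] peq_extrude_left peq_trans by blast
        show "PNu (PPar (psub ?\<tau> Q\<^sub>2) (pren Suc R)) \<equiv>\<^sub>\<pi> PPar Y R"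
          using peq_Par[OF Y(2) peq_refl] peq_extrude_left peq_trans peq_sym by blast
      qed
      with Y show ?thesis by blast
    qed
    then show ?thesis using 1 l by (auto intro: taus_ParL)
  qed
next
  case (2 R')
  note R' = derivative_ok_trans[OF 2(2) bis(5)]
  have "weak_trans (PPar (psub \<sigma> Q) R) l (PPar (under l (psub \<sigma> Q)) R')"
    using weak_transI[OF taus_refl tr_ParR[OF 2(2)] taus_refl] .
  moreover have "if binds l then \<exists>T. eval_closure (T \<cdot> \<Delta>)
        (PPar (under l (psub \<sigma> P)) R') (PPar (under l (psub \<sigma> Q)) R')
      else eval_closure \<Delta> (PPar (under l (psub \<sigma> P)) R') (PPar (under l (psub \<sigma> Q)) R')"
    using R' bis(1-4)
    by (cases l) (auto simp: under_def intro: ec_base sub_typed_comp[OF _ sub_typed_shift])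
  ultimately show ?thesis using 2 by blast
next
  case (3 a X v R')
  from trans_psub_inv[OF 3(3)] obtain b P' where P': "trans_pi P (LIn b) P'" "a = nsub \<sigma> b"
    "X = psub (lift \<sigma>) P'" by auto
  from eval_closure_psub_step[OF bis P'(1)] obtain Q' T where
    Q': "weak_trans (psub \<sigma> Q) (LIn a) (psub (lift \<sigma>) Q')" "P' \<approx>\<^sub>\<pi> Q'" and
    T: "nty \<Gamma> b = Some (OT T)" "pok P' (T \<cdot> \<Gamma>)" "pok Q' (T \<cdot> \<Gamma>)" unfolding P'(2) by fastforce
  have R': "pok R' \<Delta>" "vty \<Delta> v = Some T"
    using derivative_ok_trans[OF 3(4) bis(5)] nty_nsub(2)[OF bis(4) T(1)] P'(2) by auto
  have "taus (PPar (psub \<sigma> Q) R) (PPar (psub (inst v) (psub (lift \<sigma>) Q')) R')"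
    using weak_ComL[OF Q'(1) pok_psub[OF bis(3,4)] 3(4) bis(5)] .
  \<comment> \<open>The value coming from \<open>R\<close> is absorbed into the substitution, so
    that the processes compared are still \<open>P'\<close> and \<open>Q'\<close> before any
    substitution.\<close>
  moreover have "eval_closure \<Delta> (PPar (psub (case_nat v \<sigma>) P') R') (PPar (psub (case_nat v \<sigma>) Q') R')"
    using ec_base[OF Q'(2) T(2,3) sub_typed_cons[OF bis(4) R'(2)] R'(1)] .
  ultimately show ?thesis using 3 P' by (auto simp: inst_lift)
next
  case (4 a v X R')
  from trans_psub_inv[OF 4(3)] obtain b w P' where P': "trans_pi P (LOut b w) P'" "a = nsub \<sigma> b"
    "v = vsub \<sigma> w" "X = psub \<sigma> P'" by auto
  from eval_closure_psub_step[OF bis P'(1)] obtain Q' T where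
    Q': "weak_trans (psub \<sigma> Q) (LOut a v) (psub \<sigma> Q')" "P' \<approx>\<^sub>\<pi> Q'" and
    T: "nty \<Gamma> b = Some (OT T)" "vty \<Gamma> w = Some T" "pok P' \<Gamma>" "pok Q' \<Gamma>" unfolding P'(2,3) by fastforce
  have R': "pok R' (T \<cdot> \<Delta>)"
    using derivative_ok_trans[OF 4(4) bis(5)] nty_nsub(2)[OF bis(4) T(1)] P'(2) by auto
  have "vty \<Delta> v = Some T" using T(2) bis(4) P'(3) vty_vsub by blast
  then have "pok (psub (inst v) R') \<Delta>" using R' pok_psub sub_typed_inst by blast
  from ec_base[OF Q'(2) T(3,4) bis(4) this] weak_ComR[OF Q'(1) 4(4)]
  show ?thesis using 4 P' by auto
next
  case (5 a X R')
  from trans_psub_inv[OF 5(3)] obtain b P' where P': "trans_pi P (LIn b) P'" "a = nsub \<sigma> b"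
    "X = psub (lift \<sigma>) P'" by auto
  from eval_closure_psub_step[OF bis P'(1)] obtain Q' T where
    Q': "weak_trans (psub \<sigma> Q) (LIn a) (psub (lift \<sigma>) Q')" "P' \<approx>\<^sub>\<pi> Q'" and
    T: "nty \<Gamma> b = Some (OT T)" "pok P' (T \<cdot> \<Gamma>)" "pok Q' (T \<cdot> \<Gamma>)" unfolding P'(2) by fastforce
  have R': "pok R' (T \<cdot> \<Delta>)"
    using derivative_ok_trans[OF 5(4) bis(5)] nty_nsub(2)[OF bis(4) T(1)] P'(2) by auto
  from ec_Nu[OF ec_base[OF Q'(2) T(2,3) sub_typed_lift[OF bis(4)] R']] weak_CloseL[OF Q'(1) 5(4)]
  show ?thesis using 5 P' by auto
next
  case (6 a X R')
  from trans_psub_inv[OF 6(3)] obtain b P' where P': "trans_pi P (LBOut b) P'" "a = nsub \<sigma> b"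
    "X = psub (lift \<sigma>) P'" by auto
  from eval_closure_psub_step[OF bis P'(1)] obtain Q' T where
    Q': "weak_trans (psub \<sigma> Q) (LBOut a) (psub (lift \<sigma>) Q')" "P' \<approx>\<^sub>\<pi> Q'" and
    T: "nty \<Gamma> b = Some (OT T)" "pok P' (T \<cdot> \<Gamma>)" "pok Q' (T \<cdot> \<Gamma>)" unfolding P'(2) by fastforce
  have R': "pok R' (T \<cdot> \<Delta>)"
    using derivative_ok_trans[OF 6(4) bis(5)] nty_nsub(2)[OF bis(4) T(1)] P'(2) by auto
  from ec_Nu[OF ec_base[OF Q'(2) T(2,3) sub_typed_lift[OF bis(4)] R']] weak_CloseR[OF Q'(1) 6(4)]
  show ?thesis using 6 P' by auto
qed

lemma eval_closure_step:
  assumes "eval_closure \<Gamma> A B" "trans_pi A l A'"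
  shows "\<exists>B'. weak_trans B l B' \<and>
    (if binds l then \<exists>T. eval_closure (T \<cdot> \<Gamma>) A' B' else eval_closure \<Gamma> A' B')"
  using assms
proof (induction arbitrary: l A' rule: eval_closure.induct)
  case (ec_base P Q \<Gamma> \<sigma> \<Delta> R)
  then show ?case by (rule eval_closure_base_step)
next
  case (ec_Nu T \<Gamma> A B)
  from ec_Nu.prems show ?case
  proof (cases rule: PNu_trans)
    case (1 X)
    from ec_Nu.IH[OF 1(2)] obtain B' where B': "weak_trans B (shift_label l) B'"
      "if binds l then \<exists>S. eval_closure (S \<cdot> T \<cdot> \<Gamma>) X B' else eval_closure (T \<cdot> \<Gamma>) X B'" by auto
    show ?thesis
    proof (cases "binds l")
      case True
      with B'(2) obtain S where "eval_closure (S \<cdot> T \<cdot> \<Gamma>) X B'" by auto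
      \<comment> \<open>The derivative has the name of the label at 0 and the restricted name at 1;
        \<open>swap01\<close> brings the restricted one back to 0 before it is bound.\<close>
      from eval_closure.ec_Nu[OF eval_closure_psub[OF this sub_typed_swap]]
      show ?thesis using weak_Nu[OF B'(1)] True unfolding 1(1) by auto
    next
      case False
      with B'(2) have "eval_closure (T \<cdot> \<Gamma>) X B'" by simp
      from eval_closure.ec_Nu[OF this]
      show ?thesis using weak_Nu[OF B'(1)] False unfolding 1(1) by auto
    qed
  next
    case (2 a)
    from ec_Nu.IH[OF 2(2)] show ?thesis using weak_Open 2 by auto
  qed
next
  case (ec_peq A A0 \<Gamma> B0 B)
  from peq_trans_pi[OF ec_peq.hyps(1) ec_peq.prems] obtain A1 where
    A1: "trans_pi A0 l A1" "A' \<equiv>\<^sub>\<pi> A1" .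
  from ec_peq.IH[OF A1(1)] obtain B1 where B1: "weak_trans B0 l B1"
    "if binds l then \<exists>S. eval_closure (S \<cdot> \<Gamma>) A1 B1 else eval_closure \<Gamma> A1 B1" by blast
  from peq_weak[OF B1(1) ec_peq.hyps(3)] obtain B' where "weak_trans B l B'" "B1 \<equiv>\<^sub>\<pi> B'" by blast
  moreover have "if binds l then \<exists>S. eval_closure (S \<cdot> \<Gamma>) A' B' else eval_closure \<Gamma> A' B'"
    using B1(2) eval_closure.ec_peq[OF A1(2) _ \<open>B1 \<equiv>\<^sub>\<pi> B'\<close>] by (auto split: if_splits)
  ultimately show ?case by blast
qed

lemma eval_closure_bisimilar:
  assumes "eval_closure \<Gamma> A B" shows "A \<approx>\<^sub>\<pi> B"
proof (rule weak_bisimilarI[of "\<lambda>A B. \<exists>\<Gamma>. eval_closure \<Gamma> A B"])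
  fix A B l A'
  assume "\<exists>\<Gamma>. eval_closure \<Gamma> A B" "trans_pi A l A'"
  then show "\<exists>B'. weak_trans B l B' \<and> (\<exists>\<Gamma>. eval_closure \<Gamma> A' B')"
    using eval_closure_step by metis
qed (use assms eval_closure_sym in blast)+

definition tbis :: "tyenv \<Rightarrow> pi \<Rightarrow> pi \<Rightarrow> bool" where
  "tbis \<Gamma> P Q \<longleftrightarrow> pok P \<Gamma> \<and> pok Q \<Gamma> \<and> P \<approx>\<^sub>\<pi> Q"

lemma eval_closure_tbis: "tbis \<Gamma> P Q \<Longrightarrow> eval_closure \<Gamma> P Q"
  unfolding tbis_def
  by (metis ec_peq ec_base[OF _ _ _ sub_typed_id, of P Q \<Gamma> PInert] psub_id pok.simps(1) peq_unit peq_sym)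

lemma tbis_psub:
  "tbis \<Gamma> P Q \<Longrightarrow> sub_typed \<Gamma> \<sigma> \<Delta> \<Longrightarrow> tbis \<Delta> (psub \<sigma> P) (psub \<sigma> Q)"
  using eval_closure_psub[OF eval_closure_tbis] eval_closure_bisimilar pok_psub
  unfolding tbis_def by blast

lemma tbis_Nu: "tbis (T \<cdot> \<Gamma>) P Q \<Longrightarrow> tbis \<Gamma> (PNu P) (PNu Q)"
  using eval_closure_bisimilar[OF ec_Nu[OF eval_closure_tbis]] unfolding tbis_def by auto

lemma tbis_ParL: "tbis \<Gamma> P Q \<Longrightarrow> pok R \<Gamma> \<Longrightarrow> tbis \<Gamma> (PPar P R) (PPar Q R)"
  using ec_base[OF _ _ _ sub_typed_id, of P Q \<Gamma> R] eval_closure_bisimilar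
  unfolding tbis_def by simp

lemma tbis_peq:
  assumes "tbis \<Gamma> P Q" "P' \<equiv>\<^sub>\<pi> P" "Q \<equiv>\<^sub>\<pi> Q'" "pok P' \<Gamma>" "pok Q' \<Gamma>"
  shows "tbis \<Gamma> P' Q'"
  using eval_closure_bisimilar[OF ec_peq[OF assms(2) eval_closure_tbis[OF assms(1)] assms(3)]] assms
  unfolding tbis_def by auto

lemma tbis_ParR: "tbis \<Gamma> P Q \<Longrightarrow> pok R \<Gamma> \<Longrightarrow> tbis \<Gamma> (PPar R P) (PPar R Q)"
  by (rule tbis_peq[OF tbis_ParL peq_comm peq_comm]) (auto simp: tbis_def)

section \<open>Transitivity of weak bisimilarity\<close>

lemma weak_bisimilar_taus:
  assumes "taus P P'" "P \<approx>\<^sub>\<pi> Q"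
  shows "\<exists>Q'. taus Q Q' \<and> P' \<approx>\<^sub>\<pi> Q'"
  using assms
proof (induction rule: taus_induct)
  case refl
  then show ?case using taus_refl by blast
next
  case (step R R')
  then obtain Q' where Q': "taus Q Q'" "R \<approx>\<^sub>\<pi> Q'" by blast
  from weak_bisimilarD[OF Q'(2) step(2)] obtain Q'' where "weak_trans Q' LTau Q''" "R' \<approx>\<^sub>\<pi> Q''" .
  with Q' show ?case using taus_trans by auto
qed

lemma weak_bisimilar_weak:
  assumes "P \<approx>\<^sub>\<pi> Q" "weak_trans P l P'"
  shows "\<exists>Q'. weak_trans Q l Q' \<and> P' \<approx>\<^sub>\<pi> Q'"
proof (cases "l = LTau")
  case True
  then show ?thesis using assms weak_bisimilar_taus by auto
next
  case False
  from weak_transE[OF assms(2) False] obtain P1 P2 where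
    *: "taus P P1" "trans_pi P1 l P2" "taus P2 P'" .
  obtain Q1 where Q1: "taus Q Q1" "P1 \<approx>\<^sub>\<pi> Q1" using weak_bisimilar_taus[OF *(1) assms(1)] by blast
  obtain Q2 where Q2: "weak_trans Q1 l Q2" "P2 \<approx>\<^sub>\<pi> Q2" using weak_bisimilarD[OF Q1(2) *(2)] .
  obtain Q' where Q': "taus Q2 Q'" "P' \<approx>\<^sub>\<pi> Q'" using weak_bisimilar_taus[OF *(3) Q2(2)] by blast
  from weak_transE[OF Q2(1) False] obtain R1 R2 where
    R: "taus Q1 R1" "trans_pi R1 l R2" "taus R2 Q2" .
  have "weak_trans Q l Q'"
    by (rule weak_transI[OF taus_trans[OF Q1(1) R(1)] R(2) taus_trans[OF R(3) Q'(1)]])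
  with Q' show ?thesis by blast
qed

lemma weak_bisimilar_trans:
  assumes "P \<approx>\<^sub>\<pi> Q" "Q \<approx>\<^sub>\<pi> R" shows "P \<approx>\<^sub>\<pi> R"
proof (rule weak_bisimilarI[of "\<lambda>P R. \<exists>Q. P \<approx>\<^sub>\<pi> Q \<and> Q \<approx>\<^sub>\<pi> R"])
  fix P R l P' assume "\<exists>Q. P \<approx>\<^sub>\<pi> Q \<and> Q \<approx>\<^sub>\<pi> R" "trans_pi P l P'"
  then show "\<exists>R'. weak_trans R l R' \<and> (\<exists>Q. P' \<approx>\<^sub>\<pi> Q \<and> Q \<approx>\<^sub>\<pi> R')"
    by (meson weak_bisimilarD weak_bisimilar_weak)
next
  show "\<exists>Q. P \<approx>\<^sub>\<pi> Q \<and> Q \<approx>\<^sub>\<pi> R" using assms by blast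
next
  show "\<exists>Q. P \<approx>\<^sub>\<pi> Q \<and> Q \<approx>\<^sub>\<pi> R \<Longrightarrow> \<exists>Q. R \<approx>\<^sub>\<pi> Q \<and> Q \<approx>\<^sub>\<pi> P" for P R
    using weak_bisimilar_sym by blast
qed

lemma tbis_Par: "tbis \<Gamma> P Q \<Longrightarrow> tbis \<Gamma> P' Q' \<Longrightarrow> tbis \<Gamma> (PPar P P') (PPar Q Q')"
  using tbis_ParL[of \<Gamma> P Q P'] tbis_ParR[of \<Gamma> P' Q' Q] weak_bisimilar_trans
  unfolding tbis_def by (meson pok.simps(2))

text \<open>In the ground system an input only uncovers its body with a fresh received name, so
  bisimilar bodies suffice. Instances of the bodies are the business of
  \<open>tbis_psub\<close>.\<close>

lemma weak_bisimilar_In: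
  assumes "P \<approx>\<^sub>\<pi> Q" shows "PIn a P \<approx>\<^sub>\<pi> PIn a Q"
proof -
  let ?R = "\<lambda>A B. A \<approx>\<^sub>\<pi> B \<or> (\<exists>P Q. P \<approx>\<^sub>\<pi> Q \<and> A = PIn a P \<and> B = PIn a Q)"
  have sym: "?R A B \<Longrightarrow> ?R B A" for A B using weak_bisimilar_sym by blast
  have step: "\<exists>B'. weak_trans B l B' \<and> ?R A' B'" if "?R A B" "trans_pi A l A'" for A B l A'
    using that(1)
  proof
    assume "A \<approx>\<^sub>\<pi> B"
    then show ?thesis using weak_bisimilarD that(2) by metis
  next
    assume "\<exists>P Q. P \<approx>\<^sub>\<pi> Q \<and> A = PIn a P \<and> B = PIn a Q"
    then show ?thesis using that(2) weak_transI[OF taus_refl tr_In taus_refl] by blast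
  qed
  show ?thesis by (rule weak_bisimilarI[of ?R, OF sym step]) (use assms in blast)+
qed

text \<open>Each copy spawned by the replication joins the first component of the pair.\<close>

inductive rep_closure :: "pi \<Rightarrow> pi \<Rightarrow> bool" where
  "\<lbrakk>tbis \<Gamma> P\<^sub>0 Q\<^sub>0; tbis (T \<cdot> \<Gamma>) P Q; vty \<Gamma> a = Some (OT T);
    A \<equiv>\<^sub>\<pi> PPar P\<^sub>0 (PRep a P); PPar Q\<^sub>0 (PRep a Q) \<equiv>\<^sub>\<pi> B\<rbrakk> \<Longrightarrow> rep_closure A B"

lemma tbis_sym: "tbis \<Gamma> P Q \<Longrightarrow> tbis \<Gamma> Q P"
  unfolding tbis_def using weak_bisimilar_sym by blast

lemma rep_closure_sym: "rep_closure A B \<Longrightarrow> rep_closure B A"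
  by (induction rule: rep_closure.induct)
    (blast intro: rep_closure.intros peq_sym tbis_sym)

text \<open>The replication acts by inputs only: from outside, or from \<open>P\<^sub>0\<close> by a
  free or a bound output. The spawned copy is an instance of \<open>P\<close>, related to the
  corresponding instance of \<open>Q\<close> by closure under substitution.\<close>

lemma rep_closure_base_step:
  assumes P0: "tbis \<Gamma> P\<^sub>0 Q\<^sub>0" and P: "tbis (T \<cdot> \<Gamma>) P Q" and a: "vty \<Gamma> a = Some (OT T)"
    and "trans_pi (PPar P\<^sub>0 (PRep a P)) l A'"
  shows "\<exists>B'. weak_trans (PPar Q\<^sub>0 (PRep a Q)) l B' \<and> rep_closure A' B'"
proof -
  note step = weak_bisimilarD[OF conjunct2[OF conjunct2[OF P0[unfolded tbis_def]]]]
  have ok: "pok P\<^sub>0 \<Gamma>" "pok Q\<^sub>0 \<Gamma>" using P0 by (auto simp: tbis_def)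
  have comm: "PPar P' (PPar P (PRep a R)) \<equiv>\<^sub>\<pi> PPar (PPar P' P) (PRep a R)" for P' P a R
    by (blast intro: peq_sym peq_assoc)
  have shiftP: "tbis (T \<cdot> S \<cdot> \<Gamma>) (psub (lift (renaming Suc)) P) (psub (lift (renaming Suc)) Q)" for S
    using P tbis_psub sub_typed_lift sub_typed_shift by blast
  have shifta: "vty (case_nat S \<Gamma>) (vsub (renaming Suc) a) = Some (OT T)" for S using a by simp
  show ?thesis using assms(4)
  proof (cases rule: PPar_trans)
    case (1 P')
    from step[OF 1(2)] obtain Q' where Q': "weak_trans Q\<^sub>0 l Q'" "P' \<approx>\<^sub>\<pi> Q'" .
    have "derivative_ok \<Gamma> l P'" "derivative_ok \<Gamma> l Q'"
      using ok 1 Q' derivative_ok_trans derivative_ok_weak by blast+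
    then have "tbis \<Gamma> P' Q' \<and> \<not> binds l \<or> (\<exists>S. tbis (S \<cdot> \<Gamma>) P' Q') \<and> binds l"
      using Q'(2) by (cases l) (auto simp: tbis_def)
    then have "rep_closure (PPar P' (under l (PRep a P))) (PPar Q' (under l (PRep a Q)))"
      using rep_closure.intros[OF _ P a peq_refl peq_refl]
        rep_closure.intros[OF _ shiftP shifta peq_refl peq_refl]
      by (auto simp: under_def)
    with weak_ParL[OF Q'(1)] show ?thesis using 1 by blast
  next
    case (2 R')
    from 2(2) obtain b where b: "a = Nm b" "l = LIn b" "R' = PPar P (pren Suc (PRep a P))"
      by auto
    have "weak_trans (PPar Q\<^sub>0 (PRep a Q)) l (PPar (pren Suc Q\<^sub>0) (PPar Q (pren Suc (PRep a Q))))"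
      using weak_transI[OF taus_refl tr_ParR[OF tr_Rep] taus_refl] b by simp
    moreover have "tbis (T \<cdot> \<Gamma>) (PPar (pren Suc P\<^sub>0) P) (PPar (pren Suc Q\<^sub>0) Q)"
      using tbis_Par tbis_psub[OF P0 sub_typed_shift] P by blast
    from rep_closure.intros[OF this shiftP shifta comm peq_sym[OF comm]]
    have "rep_closure A' (PPar (pren Suc Q\<^sub>0) (PPar Q (pren Suc (PRep a Q))))"
      using 2 b by simp
    ultimately show ?thesis by blast
  next
    case (4 b v P' R')
    from 4(4) have R': "a = Nm b" "R' = PPar P (pren Suc (PRep a P))" by auto
    from step[OF 4(3)] obtain Q' where Q': "weak_trans Q\<^sub>0 (LOut b v) Q'" "P' \<approx>\<^sub>\<pi> Q'" .
    have "derivative_ok \<Gamma> (LOut b v) P'" "derivative_ok \<Gamma> (LOut b v) Q'"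
      using ok 4 Q' derivative_ok_trans derivative_ok_weak by blast+
    then have ok': "tbis \<Gamma> P' Q'" "vty \<Gamma> v = Some T" using a R' Q'(2) by (auto simp: tbis_def)
    \<comment> \<open>The persisting replication was shifted past the received name, so
      \<open>inst v\<close> gives it back unchanged.\<close>
    have inst: "psub (inst v) (PPar P (pren Suc (PRep a P))) = PPar (psub (inst v) P) (PRep a P)" for P
      by (simp add: lift_id vsub_vsub del: psub.simps(6))
    have "taus (PPar Q\<^sub>0 (PRep a Q)) (PPar Q' (PPar (psub (inst v) Q) (PRep a Q)))"
      using weak_ComR[OF Q'(1) tr_Rep[of b Q]] inst R' by simp
    moreover have "tbis \<Gamma> (PPar P' (psub (inst v) P)) (PPar Q' (psub (inst v) Q))"
      using tbis_Par[OF ok'(1) tbis_psub[OF P sub_typed_inst[OF ok'(2)]]] .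
    from rep_closure.intros[OF this P a comm peq_sym[OF comm]]
    have "rep_closure A' (PPar Q' (PPar (psub (inst v) Q) (PRep a Q)))"
      unfolding 4(2) R'(2) inst .
    ultimately show ?thesis using 4 by auto
  next
    case (6 b P' R')
    from 6(4) have R': "a = Nm b" "R' = PPar P (pren Suc (PRep a P))" by auto
    from step[OF 6(3)] obtain Q' where Q': "weak_trans Q\<^sub>0 (LBOut b) Q'" "P' \<approx>\<^sub>\<pi> Q'" .
    have "derivative_ok \<Gamma> (LBOut b) P'" "derivative_ok \<Gamma> (LBOut b) Q'"
      using ok 6 Q' derivative_ok_trans derivative_ok_weak by blast+
    then have ok': "tbis (T \<cdot> \<Gamma>) P' Q'" using a R' Q'(2) by (auto simp: tbis_def)
    have collect: "PNu (PPar P' (PPar P (pren Suc (PRep a P)))) \<equiv>\<^sub>\<pi> PPar (PNu (PPar P' P)) (PRep a P)"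
      for P' P
      using peq_Nu[OF peq_assoc[of P' P "pren Suc (PRep a P)"]] peq_extrude_left[of "PPar P' P" "PRep a P"]
      by (blast intro: peq_sym peq_trans)
    have "taus (PPar Q\<^sub>0 (PRep a Q)) (PNu (PPar Q' (PPar Q (pren Suc (PRep a Q)))))"
      using weak_CloseR[OF Q'(1) tr_Rep[of b Q]] R' by simp
    moreover from rep_closure.intros[OF tbis_Nu[OF tbis_Par[OF ok' P]] P a collect peq_sym[OF collect]]
    have "rep_closure A' (PNu (PPar Q' (PPar Q (pren Suc (PRep a Q)))))"
      unfolding 6(2) R'(2) .
    ultimately show ?thesis using 6 by auto
  qed auto
qed

lemma tbis_Rep:
  assumes "tbis (T \<cdot> \<Gamma>) P Q" "vty \<Gamma> a = Some (OT T)"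
  shows "tbis \<Gamma> (PRep a P) (PRep a Q)"
proof -
  have "tbis \<Gamma> PInert PInert" unfolding tbis_def
    by (auto intro!: weak_bisimilarI[of "\<lambda>P Q. P = PInert \<and> Q = PInert"])
  then have "rep_closure (PRep a P) (PRep a Q)"
    using assms peq_unit_left peq_sym by (blast intro: rep_closure.intros)
  then have "PRep a P \<approx>\<^sub>\<pi> PRep a Q"
  proof (rule weak_bisimilarI[rotated 2])
    fix A B l A' assume "rep_closure A B" "trans_pi A l A'"
    then show "\<exists>B'. weak_trans B l B' \<and> rep_closure A' B'"
    proof (induction)
      case (1 \<Gamma> P\<^sub>0 Q\<^sub>0 T P Q a A B)
      from peq_trans_pi[OF 1(4) 1(6)] obtain A1 where
        A1: "trans_pi (PPar P\<^sub>0 (PRep a P)) l A1" "A' \<equiv>\<^sub>\<pi> A1" .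
      from rep_closure_base_step[OF 1(1-3) A1(1)] obtain B1 where
        B1: "weak_trans (PPar Q\<^sub>0 (PRep a Q)) l B1" "rep_closure A1 B1" by blast
      from peq_weak[OF B1(1) 1(5)] obtain B' where B': "weak_trans B l B'" "B1 \<equiv>\<^sub>\<pi> B'" by blast
      have "rep_closure A' B'"
        using B1(2) A1(2) B'(2) by (cases) (blast intro: rep_closure.intros peq_trans)
      with B' show ?case by blast
    qed
  qed (rule rep_closure_sym)
  then show ?thesis using assms unfolding tbis_def by auto
qed

lemma tbis_In:
  assumes "tbis (T \<cdot> \<Gamma>) P Q" "vty \<Gamma> a = Some (OT T)"
  shows "tbis \<Gamma> (PIn a P) (PIn a Q)"
  using assms weak_bisimilar_In unfolding tbis_def by auto

section \<open>Operational correspondence of the translation\<close>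

text \<open>Holds because \<open>identify\<close> merges the two names of the pair and lowers all
  others, while a substitution lifted twice leaves the pair alone.\<close>

lemma translate_sub: "translate (sub \<sigma> P) = psub \<sigma> (translate P)"
proof (induction P arbitrary: \<sigma>)
  case (Res T P)
  have "vsub (renaming identify) (lift (lift \<sigma>) n) = vsub (lift \<sigma>) (renaming identify n)" for n
    by (cases n rule: nat_cases_2) (simp_all add: identify_def vsub_vsub renaming_def)
  with Res show ?case by simp
qed auto

section \<open>Simple typing with polarities and its preservation by reduction\<close>

lemma lift_renaming: "lift (renaming f) = renaming (case_nat 0 (\<lambda>n. Suc (f n)))"
  by (auto simp: fun_eq_iff lift_def split: nat.splits)

text \<open>
  The annotation \<open>S\<close> of a restriction is ignored, since structural congruence may create restrictions
  with arbitrary annotations around \<open>Inert\<close>.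
\<close>

primrec ok :: "proc \<Rightarrow> tyenv \<Rightarrow> bool" where
  "ok Inert \<Gamma> \<longleftrightarrow> True"
| "ok (Par P Q) \<Gamma> \<longleftrightarrow> ok P \<Gamma> \<and> ok Q \<Gamma>"
| "ok (In a P) \<Gamma> \<longleftrightarrow> (\<exists>T. vty \<Gamma> a = Some (IT T) \<and> ok P (T \<cdot> \<Gamma>))"
| "ok (Out a v) \<Gamma> \<longleftrightarrow> (\<exists>T. vty \<Gamma> a = Some (OT T) \<and> vty \<Gamma> v = Some T)"
| "ok (Res S P) \<Gamma> \<longleftrightarrow> (\<exists>T. ok P (OT T \<cdot> IT T \<cdot> \<Gamma>))"
| "ok (Rep a P) \<Gamma> \<longleftrightarrow> (\<exists>T. vty \<Gamma> a = Some (IT T) \<and> ok P (T \<cdot> \<Gamma>))"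

lemma ok_sub: "ok P \<Gamma> \<Longrightarrow> sub_typed \<Gamma> \<sigma> \<Delta> \<Longrightarrow> ok (sub \<sigma> P) \<Delta>"
proof (induction P arbitrary: \<Gamma> \<sigma> \<Delta>)
  case (In a P)
  then show ?case by simp (meson vty_vsub sub_typed_lift)
next
  case (Rep a P)
  then show ?case by simp (meson vty_vsub sub_typed_lift)
next
  case (Out a v)
  then show ?case by simp (meson vty_vsub)
next
  case (Res T P)
  then show ?case by simp (meson sub_typed_lift)
qed auto

lemma vty_renaming [simp]: "vty \<Gamma> (vsub (renaming f) v) = vty (\<lambda>n. \<Gamma> (f n)) v"
  by (cases "(renaming f, v)" rule: vsub.cases) auto

lemma case_nat_renaming:
  "(\<lambda>n. case_nat x \<Gamma> (case_nat 0 (\<lambda>n. Suc (f n)) n)) = case_nat x (\<lambda>n. \<Gamma> (f n))"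
  by (auto simp: fun_eq_iff split: nat.splits)

text \<open>An equivalence, unlike \<open>ok_sub\<close>: structural congruence is symmetric, so
  typing must also be pulled back through the renamings in its rules.\<close>

lemma ok_ren: "ok (ren f P) \<Gamma> \<longleftrightarrow> ok P (\<lambda>n. \<Gamma> (f n))"
  by (induction P arbitrary: f \<Gamma>) (simp_all add: lift_renaming case_nat_renaming)

lemma scong_ok: "P \<simeq> Q \<Longrightarrow> ok P \<Gamma> \<longleftrightarrow> ok Q \<Gamma>"
proof (induction arbitrary: \<Gamma> rule: scong.induct)
  case (sc_swap S T P)
  have "(\<lambda>n. (OT A \<cdot> IT A \<cdot> OT B \<cdot> IT B \<cdot> \<Gamma>) (swap_pairs n)) = OT B \<cdot> IT B \<cdot> OT A \<cdot> IT A \<cdot> \<Gamma>" for A B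
    by (auto simp: fun_eq_iff swap_pairs_def numeral_eq_Suc less_Suc_eq split: nat.splits)
  then show ?case by (auto simp: ok_ren)
qed (auto simp: ok_ren numeral_eq_Suc)

lemma red_ok: "P \<longmapsto> Q \<Longrightarrow> ok P \<Gamma> \<Longrightarrow> ok Q \<Gamma>"
proof (induction arbitrary: \<Gamma> rule: red.induct)
  case (red_In T P v Q)
  then show ?case by (fastforce intro: ok_sub sub_typed_inst)
next
  case (red_Rep T P v Q)
  then show ?case by (fastforce intro: ok_sub sub_typed_inst)
next
  case (red_scong P Q Q' P')
  then show ?case using scong_ok by blast
qed auto

lemma val_names_typed: "vty \<Gamma> v = Some T \<Longrightarrow> val_names v \<subseteq> Var ` dom \<Gamma> \<union> range Success"
proof (cases v)
  case (Nm a)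
  then show "vty \<Gamma> v = Some T \<Longrightarrow> ?thesis" by (cases a) auto
qed simp

lemma unbind_dom:
  assumes "A \<subseteq> Var ` dom (T \<cdot> \<Gamma>) \<union> range Success"
  shows "unbind A \<subseteq> Var ` dom \<Gamma> \<union> range Success"
proof -
  have "n \<in> dom \<Gamma>" if "Var (Suc n) \<in> A" for n
    using assms that by (auto simp: dom_def split: nat.splits)
  then show ?thesis by (auto simp: unbind_def)
qed

lemma ok_fn: "ok P \<Gamma> \<Longrightarrow> fn P \<subseteq> Var ` dom \<Gamma> \<union> range Success"
proof (induction P arbitrary: \<Gamma>)
  case (Par P Q)
  then show ?case by (metis Un_least fn.simps(2) ok.simps(2))
next
  case (Out a v)
  then show ?case by (metis Un_least fn.simps(4) ok.simps(4) val_names_typed)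
next
  case (In a P)
  then show ?case by (metis Un_least fn.simps(3) ok.simps(3) val_names_typed unbind_dom)
next
  case (Res T P)
  then show ?case by (metis fn.simps(5) ok.simps(5) unbind_dom)
next
  case (Rep a P)
  then show ?case by (metis Un_least fn.simps(6) ok.simps(6) val_names_typed unbind_dom)
qed simp

lemma ok_closed: "ok P (\<lambda>_. None) \<Longrightarrow> closed_proc P"
  using ok_fn[of P "\<lambda>_. None"] by (auto simp: closed_proc_def)

section \<open>Erasure of polarities\<close>

primrec erase :: "ty \<Rightarrow> ty" where
  "erase (OT T) = OT (erase T)"
| "erase (IT T) = OT (erase T)"
| "erase UnitT = UnitT"

definition erase_env :: "tyenv \<Rightarrow> tyenv" where
  "erase_env \<Gamma> = (\<lambda>n. map_option erase (\<Gamma> n))"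

lemma nty_erase [simp]: "nty (erase_env \<Gamma>) a = map_option erase (nty \<Gamma> a)"
  by (cases a) (simp_all add: erase_env_def)

lemma vty_erase [simp]: "vty (erase_env \<Gamma>) v = map_option erase (vty \<Gamma> v)"
  by (cases v) simp_all

lemma erase_env_cons [simp]: "erase_env (T \<cdot> \<Gamma>) = erase T \<cdot> erase_env \<Gamma>"
  by (auto simp: fun_eq_iff erase_env_def split: nat.splits)

text \<open>Meant for erased environments, in which the two ends of a pair have the same type and
  can be merged.\<close>

lemma sub_typed_identify: "sub_typed (T \<cdot> T \<cdot> \<Gamma>) (renaming identify) (T \<cdot> \<Gamma>)"
  by (auto simp: sub_typed_def identify_def split: nat.splits)

lemma ok_translate: "ok P \<Gamma> \<Longrightarrow> pok (translate P) (erase_env \<Gamma>)"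
proof (induction P arbitrary: \<Gamma>)
  case (In a P)
  then show ?case by (fastforce dest: In.IH)
next
  case (Rep a P)
  then show ?case by (fastforce dest: Rep.IH)
next
  case (Res T P)
  then obtain S where "ok P (OT S \<cdot> IT S \<cdot> \<Gamma>)" by auto
  from Res.IH[OF this] pok_psub[OF _ sub_typed_identify] show ?case by auto
qed auto

section \<open>The translation preserves structural congruence and reduction\<close>

lemma scong_translate: "P \<simeq> Q \<Longrightarrow> translate P \<equiv>\<^sub>\<pi> translate Q"
proof (induction rule: scong.induct)
  case (sc_extrude P T Q)
  have "pren identify (pren (\<lambda>n. n + 2) (translate P)) = pren Suc (translate P)"
    by (simp add: identify_def renaming_def)
  then show ?case using peq_extrude by (simp add: translate_sub del: psub_psub)
next
  case (sc_swap S T P)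
  let ?P = "psub (lift (renaming identify)) (pren identify (translate P))"
  have "psub (lift (renaming identify)) (pren identify (pren swap_pairs (translate P))) = pren swap01 ?P"
    unfolding psub_psub
  proof (rule psub_cong, goal_cases)
    case (1 n)
    show ?case by (cases n rule: nat_cases_2; cases "n - 2" rule: nat_cases_2) (auto simp: identify_def numeral_eq_Suc)
  qed
  then show ?case using peq_swap[of ?P] by (simp add: translate_sub del: psub_psub)
qed (auto intro: peq.intros peq_psub)

text \<open>Exact only up to \<open>peq\<close>: a consumed output leaves \<open>PInert\<close>, and
  \<open>tr_Rep\<close> places the spawned copy on the other side of the replication.\<close>

lemma red_translate: "P \<longmapsto> Q \<Longrightarrow> \<exists>N. trans_pi (translate P) LTau N \<and> N \<equiv>\<^sub>\<pi> translate Q"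
proof (induction rule: red.induct)
  case (red_In T P v Q)
  let ?v = "vsub (renaming identify) v"
  have "trans_pi (translate (Res T (Par (In (Nm (Var 1)) P) (Par (Out (Nm (Var 0)) v) Q)))) LTau
      (PNu (PPar (psub (inst ?v) (psub (lift (renaming identify)) (translate P)))
        (PPar PInert (pren identify (translate Q)))))"
    using tr_Res_tau[OF tr_ComL[OF tr_In tr_ParL[OF tr_Out]]] by (simp add: identify_def del: psub_psub)
  moreover have "PPar (psub (inst ?v) (psub (lift (renaming identify)) (translate P)))
        (PPar PInert (pren identify (translate Q))) \<equiv>\<^sub>\<pi>
      pren identify (translate (Par (sub (inst v) P) Q))"
    by (simp add: lift_inst translate_sub peq_Par peq_unit_left del: psub_psub)
  ultimately show ?case using peq_Nu by auto
next
  case (red_Rep T P v Q)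
  let ?v = "vsub (renaming identify) v"
  let ?P = "psub (lift (renaming identify)) (translate P)"
  have "trans_pi (translate (Res T (Par (Rep (Nm (Var 1)) P) (Par (Out (Nm (Var 0)) v) Q)))) LTau
      (PNu (PPar (psub (inst ?v) (PPar ?P (pren Suc (PRep (Nm (Var 0)) ?P))))
        (PPar PInert (pren identify (translate Q)))))"
    using tr_Res_tau[OF tr_ComL[OF tr_Rep[of "Var 0" ?P] tr_ParL[OF tr_Out[of "Var 0" ?v]]]]
    by (simp add: identify_def del: psub_psub)
  moreover have "PPar (psub (inst ?v) (PPar ?P (pren Suc (PRep (Nm (Var 0)) ?P))))
        (PPar PInert (pren identify (translate Q))) \<equiv>\<^sub>\<pi>
      pren identify (translate (Par (Rep (Nm (Var 1)) P) (Par (sub (inst v) P) Q)))"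
  proof -
    let ?R = "PRep (Nm (Var 0)) ?P" and ?Q = "pren identify (translate Q)"
    have "psub (inst ?v) (pren Suc ?R) = ?R" unfolding psub_psub by (rule psub_eq_id) simp
    then have "psub (inst ?v) (PPar ?P (pren Suc ?R)) =
        PPar (pren identify (psub (inst v) (translate P))) ?R"
      by (simp only: psub.simps lift_inst)
    moreover have "PPar (PPar P' ?R) (PPar PInert ?Q) \<equiv>\<^sub>\<pi> PPar ?R (PPar P' ?Q)" for P'
      by (meson peq_Par peq_assoc peq_comm peq_refl peq_trans peq_unit_left)
    ultimately show ?thesis by (simp add: translate_sub identify_def del: psub_psub)
  qed
  ultimately show ?case using peq_Nu by auto
next
  case (red_Par P P' Q)
  then show ?case using tr_ParL[of _ LTau] peq_Par by fastforce
next
  case (red_Res P P' T)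
  then obtain N where N: "trans_pi (translate P) LTau N" "N \<equiv>\<^sub>\<pi> translate P'" by blast
  from tr_Res_tau[OF trans_pren[OF N(1), of identify, simplified]] peq_Nu[OF peq_psub[OF N(2)]]
  show ?case by auto
next
  case (red_scong P Q Q' P')
  then show ?case by (meson peq_trans_pi peq_trans peq_sym scong_translate)
qed

section \<open>Transitions of a translated restriction, and polarity of labels\<close>

lemma nsub_identify_shift: "nsub (renaming identify) a = shift_name b \<longleftrightarrow> a = shift_name (shift_name b)"
  by (cases a; cases b) (auto simp: identify_def)

lemma vsub_renaming_Nm: "vsub (renaming f) (Nm a) = Nm (nsub (renaming f) a)"
  by (cases a) auto

lemma vsub_identify_shift:
  "vsub (renaming identify) v = vsub (renaming Suc) w \<longleftrightarrow> v = vsub (renaming Suc) (vsub (renaming Suc) w)"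
  by (cases v; cases w)
    (simp_all add: vsub_renaming_Nm nsub_identify_shift del: vsub.simps(1,2))

lemma vsub_identify_0: "vsub (renaming identify) v = Nm (Var 0) \<longleftrightarrow> (\<exists>u<2. v = Nm (Var u))"
proof (cases v)
  case (Nm a)
  then show ?thesis by (cases a) (auto simp: identify_def)
qed simp

lemma identify_trans:
  assumes "trans_pi (pren identify P) l N" "l \<noteq> LTau"
  obtains k N\<^sub>0 where "trans_pi P k N\<^sub>0" "l = lsub (renaming identify) k" "N = psub (lifts k (renaming identify)) N\<^sub>0"
  using trans_psub_inv[OF assms(1)] assms(2) by blast

lemma Res_LOut:
  assumes "trans_pi (translate (Res T M)) (LOut a v) N"
  obtains N\<^sub>0 where "trans_pi (translate M)
      (LOut (shift_name (shift_name a)) (vsub (renaming Suc) (vsub (renaming Suc) v))) N\<^sub>0"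
    "N = PNu (pren identify N\<^sub>0)"
  using assms
  by (auto elim!: PNu_trans identify_trans simp: nsub_identify_shift vsub_identify_shift simp del: vsub_shift)

lemma Res_LIn:
  assumes "trans_pi (translate (Res T M)) (LIn a) N"
  obtains N\<^sub>0 where "trans_pi (translate M) (LIn (shift_name (shift_name a))) N\<^sub>0"
    "N = PNu (pren swap01 (psub (lift (renaming identify)) N\<^sub>0))"
  using assms
  by (auto elim!: PNu_trans identify_trans simp: nsub_identify_shift simp del: psub_psub)

text \<open>Either a deeper restriction is opened, or one end of this pair is sent. Both ends, of
  index 0 and 1, are possible objects, since input types may be carried too.\<close>

lemma Res_LBOut:
  assumes "trans_pi (translate (Res T M)) (LBOut a) N"
  obtains (ext) N\<^sub>0 where "trans_pi (translate M) (LBOut (shift_name (shift_name a))) N\<^sub>0"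
    "N = PNu (pren swap01 (psub (lift (renaming identify)) N\<^sub>0))"
  | (int) u N\<^sub>0 where "trans_pi (translate M) (LOut (shift_name (shift_name a)) (Nm (Var u))) N\<^sub>0"
    "u < 2" "N = pren identify N\<^sub>0"
  using assms
  by (auto elim!: PNu_trans identify_trans simp: nsub_identify_shift vsub_identify_0 simp del: psub_psub)

fun polarised :: "tyenv \<Rightarrow> label \<Rightarrow> bool" where
  "polarised \<Gamma> LTau \<longleftrightarrow> True"
| "polarised \<Gamma> (LIn a) \<longleftrightarrow> (\<exists>T. nty \<Gamma> a = Some (IT T))"
| "polarised \<Gamma> (LOut a v) \<longleftrightarrow> (\<exists>T. nty \<Gamma> a = Some (OT T))"
| "polarised \<Gamma> (LBOut a) \<longleftrightarrow> (\<exists>T. nty \<Gamma> a = Some (OT T))"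

text \<open>In a typed process a free name is the subject of inputs only or of outputs only. So two
  parallel components never communicate directly, and every internal step arises at a
  restriction.\<close>

lemma trans_polarised: "trans_pi (translate M) l N \<Longrightarrow> ok M \<Gamma> \<Longrightarrow> polarised \<Gamma> l"
proof (induction M arbitrary: l N \<Gamma>)
  case (Par M M')
  from Par.prems(1) have "trans_pi (PPar (translate M) (translate M')) l N" by simp
  then show ?case using Par.IH Par.prems(2) by (cases rule: PPar_trans) auto
next
  case (Res T M)
  from Res.prems(2) obtain S where S: "ok M (OT S \<cdot> IT S \<cdot> \<Gamma>)" by auto
  show ?case
  proof (cases l)
    case (LIn a)
    then show ?thesis using Res.prems(1) by (auto elim!: Res_LIn dest: Res.IH[OF _ S] simp del: translate.simps)
  next
    case (LOut a v)
    then show ?thesis using Res.prems(1) by (auto elim!: Res_LOut dest: Res.IH[OF _ S] simp del: translate.simps)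
  next
    case (LBOut a)
    then show ?thesis using Res.prems(1) by (auto elim!: Res_LBOut dest: Res.IH[OF _ S] simp del: translate.simps)
  qed simp
qed auto

section \<open>The translation reflects transitions\<close>

declare sc_trans [trans]

lemma scong_extrude_left: "Par (Res T P) Q \<simeq> Res T (Par P (ren (\<lambda>n. n + 2) Q))"
  by (rule sc_trans[OF sc_comm sc_trans[OF sc_extrude sc_Res[OF sc_comm]]])

lemma scong_left_commute: "Par P (Par Q R) \<simeq> Par Q (Par P R)"
  by (rule sc_trans[OF sc_sym[OF sc_assoc] sc_trans[OF sc_Par[OF sc_comm sc_refl] sc_assoc]])

lemma ren_add2_Out: "ren (\<lambda>n. n + 2) (Out (Nm a) v) =
    Out (Nm (shift_name (shift_name a))) (vsub (renaming Suc) (vsub (renaming Suc) v))"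
  by (cases a) (simp_all add: vsub_vsub renaming_def)

text \<open>Source counterpart of \<open>LOut_peq\<close>, which moreover exhibits the derivative as
  a translation.\<close>

lemma LOut_scong:
  "trans_pi (translate M) (LOut a v) N \<Longrightarrow> \<exists>M'. M \<simeq> Par (Out (Nm a) v) M' \<and> N \<equiv>\<^sub>\<pi> translate M'"
proof (induction M arbitrary: a v N)
  case (Par M M')
  from Par.prems have "trans_pi (PPar (translate M) (translate M')) (LOut a v) N" by simp
  then show ?case
  proof (cases rule: PPar_trans)
    case (1 X)
    from Par.IH(1)[OF 1(2)] obtain M1 where M1: "M \<simeq> Par (Out (Nm a) v) M1" "X \<equiv>\<^sub>\<pi> translate M1" by blast
    have "Par M M' \<simeq> Par (Out (Nm a) v) (Par M1 M')"
      by (rule sc_trans[OF sc_Par[OF M1(1) sc_refl] sc_assoc])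
    moreover have "N \<equiv>\<^sub>\<pi> translate (Par M1 M')" using 1 M1 peq_Par by simp
    ultimately show ?thesis by blast
  next
    case (2 X)
    from Par.IH(2)[OF 2(2)] obtain M1 where M1: "M' \<simeq> Par (Out (Nm a) v) M1" "X \<equiv>\<^sub>\<pi> translate M1" by blast
    have "Par M M' \<simeq> Par (Out (Nm a) v) (Par M M1)"
      by (rule sc_trans[OF sc_Par[OF sc_refl M1(1)] scong_left_commute])
    moreover have "N \<equiv>\<^sub>\<pi> translate (Par M M1)" using 2 M1 peq_Par by simp
    ultimately show ?thesis by blast
  qed auto
next
  case (Res T M)
  from Res.prems obtain N\<^sub>0 where N0: "trans_pi (translate M)
      (LOut (shift_name (shift_name a)) (vsub (renaming Suc) (vsub (renaming Suc) v))) N\<^sub>0"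
    "N = PNu (pren identify N\<^sub>0)" by (rule Res_LOut)
  from Res.IH[OF N0(1)] obtain M1 where M1: "M \<simeq> Par (ren (\<lambda>n. n + 2) (Out (Nm a) v)) M1" "N\<^sub>0 \<equiv>\<^sub>\<pi> translate M1"
    unfolding ren_add2_Out by blast
  have "Res T M \<simeq> Par (Out (Nm a) v) (Res T M1)"
    by (rule sc_trans[OF sc_Res[OF M1(1)] sc_sym[OF sc_extrude]])
  moreover have "N \<equiv>\<^sub>\<pi> translate (Res T M1)" using N0 M1 peq_Nu peq_psub by simp
  ultimately show ?case by blast
qed (auto intro!: exI[of _ Inert] sc_sym[OF sc_unit])

lemma swap_pairs_involutive [simp]: "swap_pairs (swap_pairs n) = n"
  by (auto simp: swap_pairs_def)

text \<open>\<open>u\<close> tells which end of the extruded pair is sent, a distinction that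
  \<open>identify\<close> erases. Unlike in \<open>tr_Open\<close>, the pair stays bound; a
  restriction around it is passed by \<open>sc_swap\<close>.\<close>

lemma LBOut_scong:
  "trans_pi (translate M) (LBOut a) N \<Longrightarrow>
    \<exists>T u M'. M \<simeq> Res T (Par (Out (Nm (shift_name (shift_name a))) (Nm (Var u))) M') \<and> u < 2 \<and>
      N \<equiv>\<^sub>\<pi> pren identify (translate M')"
proof (induction M arbitrary: a N)
  case (Par M M')
  let ?O = "\<lambda>u. Out (Nm (shift_name (shift_name a))) (Nm (Var u))"
  have shift: "pren identify (translate (ren (\<lambda>n. n + 2) P)) = pren Suc (translate P)" for P
    by (simp add: translate_sub identify_def renaming_def)
  from Par.prems have "trans_pi (PPar (translate M) (translate M')) (LBOut a) N" by simp
  then show ?case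
  proof (cases rule: PPar_trans)
    case (1 X)
    from Par.IH(1)[OF 1(2)] obtain T u M1 where M1: "M \<simeq> Res T (Par (?O u) M1)" "u < 2"
      "X \<equiv>\<^sub>\<pi> pren identify (translate M1)" by blast
    have "Par M M' \<simeq> Res T (Par (?O u) (Par M1 (ren (\<lambda>n. n + 2) M')))"
      by (rule sc_trans[OF sc_Par[OF M1(1) sc_refl] sc_trans[OF scong_extrude_left sc_Res[OF sc_assoc]]])
    moreover have "N \<equiv>\<^sub>\<pi> pren identify (translate (Par M1 (ren (\<lambda>n. n + 2) M')))"
      unfolding translate.simps psub.simps shift 1(1) under_simps by (rule peq_Par[OF M1(3) peq_refl])
    ultimately show ?thesis using M1(2) by blast
  next
    case (2 X)
    from Par.IH(2)[OF 2(2)] obtain T u M1 where M1: "M' \<simeq> Res T (Par (?O u) M1)" "u < 2"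
      "X \<equiv>\<^sub>\<pi> pren identify (translate M1)" by blast
    have "Par M M' \<simeq> Res T (Par (?O u) (Par (ren (\<lambda>n. n + 2) M) M1))"
      by (rule sc_trans[OF sc_Par[OF sc_refl M1(1)] sc_trans[OF sc_extrude sc_Res[OF scong_left_commute]]])
    moreover have "N \<equiv>\<^sub>\<pi> pren identify (translate (Par (ren (\<lambda>n. n + 2) M) M1))"
      unfolding translate.simps psub.simps shift 2(1) under_simps by (rule peq_Par[OF peq_refl M1(3)])
    ultimately show ?thesis using M1(2) by blast
  qed auto
next
  case (Res T M)
  from Res.prems show ?case
  proof (cases rule: Res_LBOut)
    case (int u N\<^sub>0)
    from LOut_scong[OF int(1)] obtain M1 where
      "M \<simeq> Par (Out (Nm (shift_name (shift_name a))) (Nm (Var u))) M1" "N\<^sub>0 \<equiv>\<^sub>\<pi> translate M1" by blast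
    with int show ?thesis using sc_Res peq_psub by blast
  next
    case (ext N\<^sub>0)
    let ?a = "shift_name (shift_name a)"
    let ?O = "\<lambda>u. Out (Nm (shift_name (shift_name ?a))) (Nm (Var u))"
    from Res.IH[OF ext(1)] obtain S u M1 where M1: "M \<simeq> Res S (Par (?O u) M1)" "u < 2"
      "N\<^sub>0 \<equiv>\<^sub>\<pi> pren identify (translate M1)" by blast
    have O: "ren swap_pairs (?O u) = ren (\<lambda>n. n + 2) (Out (Nm ?a) (Nm (Var u)))"
      using M1(2) by (cases a) (auto simp: swap_pairs_def)
    let ?M = "Res T (ren swap_pairs M1)"
    have "Res T M \<simeq> Res T (Res S (Par (?O u) M1))" using M1(1) by (rule sc_Res)
    also have "\<dots> \<simeq> Res S (Res T (ren swap_pairs (Par (?O u) M1)))" by (rule sc_swap)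
    also have "\<dots> \<simeq> Res S (Par (Out (Nm ?a) (Nm (Var u))) ?M)"
      unfolding sub.simps(2) O by (rule sc_Res[OF sc_sym[OF sc_extrude]])
    finally have "Res T M \<simeq> Res S (Par (Out (Nm ?a) (Nm (Var u))) ?M)" .
    moreover have "N \<equiv>\<^sub>\<pi> pren identify (translate ?M)"
    proof -
      have "N \<equiv>\<^sub>\<pi> PNu (pren swap01 (psub (lift (renaming identify)) (pren identify (translate M1))))"
        unfolding ext(2) by (intro peq_Nu peq_psub M1(3))
      also have "\<dots> = pren identify (translate ?M)"
        unfolding translate.simps translate_sub psub.simps psub_psub
      proof (rule arg_cong[where f = PNu], rule psub_cong, goal_cases)
        case (1 n)
        show ?case
          by (cases n rule: nat_cases_2; cases "n - 2" rule: nat_cases_2)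
            (auto simp: identify_def numeral_eq_Suc)
      qed
      finally show ?thesis .
    qed
    ultimately show ?thesis using M1(2) by blast
  qed
qed auto

lemma red_Par_right: "Q \<longmapsto> Q' \<Longrightarrow> Par P Q \<longmapsto> Par P Q'"
  by (rule red_scong[OF sc_comm red_Par sc_comm])

text \<open>The renaming \<open>f\<close> moves the subject of the input to the position of the I-name of the pair
  \<open>T\<close> that is to be connected, so that a restriction in \<open>M\<close> can be swapped with \<open>T\<close>.\<close>

lemma LIn_red:
  assumes "trans_pi (translate M) (LIn (Var c)) N" "f c = 1"
  shows "\<exists>M'. (\<forall>T Q. Res T (Par (ren f M) (Par (Out (Nm (Var 0)) v) Q)) \<longmapsto> Res T (Par M' Q)) \<and>
    translate M' \<equiv>\<^sub>\<pi> psub (case_nat v (renaming f)) N"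
  using assms
proof (induction M arbitrary: c N f v)
  case (In a M)
  then have a: "a = Nm (Var c)" "N = translate M" by auto
  let ?M = "sub (inst v) (sub (lift (renaming f)) M)"
  have "ren f (In a M) = In (Nm (Var 1)) (sub (lift (renaming f)) M)"
    using a In.prems(2) by simp
  then have "Res T (Par (ren f (In a M)) (Par (Out (Nm (Var 0)) v) Q)) \<longmapsto> Res T (Par ?M Q)" for T Q
    by (simp only: red_In)
  moreover have "translate ?M = psub (case_nat v (renaming f)) N"
    unfolding a by (simp add: translate_sub inst_lift)
  ultimately show ?case by (metis peq_refl)
next
  case (Rep a M)
  let ?M = "sub (lift (renaming f)) M"
  have a: "a = Nm (Var c)" "N = PPar (translate M) (pren Suc (PRep a (translate M)))"
    using Rep.prems by auto
  have "translate (Par (sub (inst v) ?M) (Rep (Nm (Var 1)) ?M)) = psub (case_nat v (renaming f)) N"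
    unfolding a using Rep.prems(2) by (simp add: translate_sub inst_lift renaming_def flip: lift_comp)
  moreover have "Res T (Par (ren f (Rep a M)) (Par (Out (Nm (Var 0)) v) Q)) \<longmapsto>
      Res T (Par (Par (sub (inst v) ?M) (Rep (Nm (Var 1)) ?M)) Q)" for T Q
  proof (rule red_scong[OF sc_refl])
    show "Res T (Par (ren f (Rep a M)) (Par (Out (Nm (Var 0)) v) Q)) \<longmapsto>
        Res T (Par (Rep (Nm (Var 1)) ?M) (Par (sub (inst v) ?M) Q))"
      using red_Rep[of T ?M v Q] a Rep.prems(2) by (simp del: sub_sub)
    show "Res T (Par (Rep (Nm (Var 1)) ?M) (Par (sub (inst v) ?M) Q)) \<simeq>
        Res T (Par (Par (sub (inst v) ?M) (Rep (Nm (Var 1)) ?M)) Q)"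
      by (rule sc_Res[OF sc_trans[OF scong_left_commute sc_sym[OF sc_assoc]]])
  qed
  ultimately show ?case by (metis peq_refl)
next
  case (Par M1 M2)
  let ?O = "Out (Nm (Var 0)) v"
  have shift: "psub (case_nat v (renaming f)) (pren Suc P) = pren f P" for P
    by (simp add: renaming_def)
  from Par.prems(1) have "trans_pi (PPar (translate M1) (translate M2)) (LIn (Var c)) N" by simp
  then show ?case
  proof (cases rule: PPar_trans)
    case (1 X)
    from Par.IH(1)[of c X f v, OF 1(2) Par.prems(2)] obtain M' where
      M': "\<And>T Q. Res T (Par (ren f M1) (Par ?O Q)) \<longmapsto> Res T (Par M' Q)"
      "translate M' \<equiv>\<^sub>\<pi> psub (case_nat v (renaming f)) X" by blast
    have "Res T (Par (ren f (Par M1 M2)) (Par ?O Q)) \<longmapsto> Res T (Par (Par M' (ren f M2)) Q)" for T Q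
    proof (rule red_scong[OF _ M'(1) sc_Res[OF sc_sym[OF sc_assoc]]])
      show "Res T (Par (ren f (Par M1 M2)) (Par ?O Q)) \<simeq> Res T (Par (ren f M1) (Par ?O (Par (ren f M2) Q)))"
        unfolding sub.simps
        by (rule sc_Res[OF sc_trans[OF sc_assoc sc_Par[OF sc_refl scong_left_commute]]])
    qed
    moreover have "translate (Par M' (ren f M2)) \<equiv>\<^sub>\<pi> psub (case_nat v (renaming f)) N"
      using 1 M'(2) peq_Par shift by (simp add: translate_sub del: psub_psub)
    ultimately show ?thesis by blast
  next
    case (2 X)
    from Par.IH(2)[of c X f v, OF 2(2) Par.prems(2)] obtain M' where
      M': "\<And>T Q. Res T (Par (ren f M2) (Par ?O Q)) \<longmapsto> Res T (Par M' Q)"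
      "translate M' \<equiv>\<^sub>\<pi> psub (case_nat v (renaming f)) X" by blast
    have "Res T (Par (ren f (Par M1 M2)) (Par ?O Q)) \<longmapsto> Res T (Par (Par (ren f M1) M') Q)" for T Q
    proof (rule red_scong[OF _ M'(1) sc_Res])
      show "Res T (Par (ren f (Par M1 M2)) (Par ?O Q)) \<simeq> Res T (Par (ren f M2) (Par ?O (Par (ren f M1) Q)))"
        unfolding sub.simps
        by (rule sc_Res[OF sc_trans[OF sc_Par[OF sc_comm sc_refl] sc_trans[OF sc_assoc sc_Par[OF sc_refl scong_left_commute]]]])
      show "Par M' (Par (ren f M1) Q) \<simeq> Par (Par (ren f M1) M') Q"
        by (rule sc_trans[OF scong_left_commute sc_sym[OF sc_assoc]])
    qed
    moreover have "translate (Par (ren f M1) M') \<equiv>\<^sub>\<pi> psub (case_nat v (renaming f)) N"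
      using 2 M'(2) peq_Par shift by (simp add: translate_sub del: psub_psub)
    ultimately show ?thesis by blast
  qed auto
next
  case (Res S M)
  let ?O = "Out (Nm (Var 0)) v"
  \<comment> \<open>This is \<open>f\<close> lifted below the pair of \<open>S\<close>, followed by
    the exchange of that pair with the pair of \<open>T\<close>. The subject thus goes from
    \<open>f c + 2 = 3\<close> to 1, again the I-name of \<open>T\<close>; \<open>?v\<close> is
    \<open>v\<close> transported in the same way.\<close>
  let ?g = "\<lambda>n. swap_pairs (case n of 0 \<Rightarrow> 0 | Suc 0 \<Rightarrow> 1 | Suc (Suc m) \<Rightarrow> f m + 2)"
  let ?v = "vsub (renaming (\<lambda>n. swap_pairs (n + 2))) v"
  from Res.prems(1) obtain N\<^sub>0 where N0: "trans_pi (translate M) (LIn (Var (Suc (Suc c)))) N\<^sub>0"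
    "N = PNu (pren swap01 (psub (lift (renaming identify)) N\<^sub>0))"
    by (rule Res_LIn) simp
  have "?g (Suc (Suc c)) = 1" using Res.prems(2) by simp
  from Res.IH[of _ _ ?g ?v, OF N0(1) this] obtain M' where
    M': "\<And>T Q. Res T (Par (ren ?g M) (Par (Out (Nm (Var 0)) ?v) Q)) \<longmapsto> Res T (Par M' Q)"
    "translate M' \<equiv>\<^sub>\<pi> psub (case_nat ?v (renaming ?g)) N\<^sub>0" by blast
  let ?M' = "Res S (ren swap_pairs M')"
  have "Res T (Par (ren f (Res S M)) (Par ?O Q)) \<longmapsto> Res T (Par ?M' Q)" for T Q
  proof -
    let ?Q = "ren swap_pairs (ren (\<lambda>n. n + 2) Q)"
    have eq: "ren swap_pairs (Par (sub (lift (lift (renaming f))) M) (ren (\<lambda>n. n + 2) (Par ?O Q))) =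
        Par (ren ?g M) (Par (Out (Nm (Var 0)) ?v) ?Q)"
    proof -
      have "vsub (renaming swap_pairs) (lift (lift (renaming f)) n) = renaming ?g n" for n
        by (cases n rule: nat_cases_2) simp_all
      then show ?thesis by (simp add: vsub_vsub renaming_def numeral_eq_Suc)
    qed
    have "Res T (Par (ren f (Res S M)) (Par ?O Q)) \<simeq>
        Res T (Res S (Par (sub (lift (lift (renaming f))) M) (ren (\<lambda>n. n + 2) (Par ?O Q))))"
      unfolding sub.simps(5) by (rule sc_Res[OF scong_extrude_left])
    also have "\<dots> \<simeq> Res S (Res T (Par (ren ?g M) (Par (Out (Nm (Var 0)) ?v) ?Q)))"
      unfolding eq[symmetric] by (rule sc_swap)
    finally have 1: "Res T (Par (ren f (Res S M)) (Par ?O Q)) \<simeq>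
      Res S (Res T (Par (ren ?g M) (Par (Out (Nm (Var 0)) ?v) ?Q)))" .
    \<comment> \<open>\<open>swap_pairs\<close> is an involution, so the exchange back restores the
      idle part \<open>Q\<close>.\<close>
    have "ren swap_pairs ?Q = ren (\<lambda>n. n + 2) Q" by (simp add: renaming_def)
    then have "Res S (Res T (Par M' ?Q)) \<simeq> Res T (Res S (Par (ren swap_pairs M') (ren (\<lambda>n. n + 2) Q)))"
      using sc_swap[of S T "Par M' ?Q"] by (simp del: sub_sub)
    also have "\<dots> \<simeq> Res T (Par ?M' Q)"
      by (rule sc_Res[OF sc_sym[OF scong_extrude_left]])
    finally have 2: "Res S (Res T (Par M' ?Q)) \<simeq> Res T (Par ?M' Q)" .
    show ?thesis by (rule red_scong[OF 1 red_Res[OF M'(1)] 2])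
  qed
  moreover have "translate ?M' \<equiv>\<^sub>\<pi> psub (case_nat v (renaming f)) N"
  proof -
    have "translate ?M' \<equiv>\<^sub>\<pi> PNu (pren identify (pren swap_pairs (psub (case_nat ?v (renaming ?g)) N\<^sub>0)))"
      unfolding translate.simps translate_sub by (intro peq_Nu peq_psub M'(2))
    also have "\<dots> = psub (case_nat v (renaming f)) N"
      unfolding N0(2) psub.simps psub_psub
    proof (rule arg_cong[where f = PNu], rule psub_cong, goal_cases)
      case (1 n)
      show ?case
        by (cases n rule: nat_cases_2; cases "n - 2" rule: nat_cases_2)
          (auto simp: identify_def numeral_eq_Suc vsub_vsub renaming_def)
    qed
    finally show ?thesis .
  qed
  ultimately show ?case by blast
qed auto

lemma out_last: "Par P Q \<simeq> Par Q (Par P Inert)"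
  by (rule sc_trans[OF sc_comm sc_Par[OF sc_refl sc_sym[OF sc_unit]]])

text \<open>Below \<open>Par\<close> a communication contradicts polarity. Below a restriction,
  \<open>trans_psub_inv\<close> for \<open>identify\<close> leaves an internal step of the body or a
  communication created by merging the pair; the redex of the latter is assembled from
  \<open>LOut_scong\<close> or \<open>LBOut_scong\<close> together with
  \<open>LIn_red\<close>.\<close>

lemma tau_red:
  "trans_pi (translate M) LTau N \<Longrightarrow> ok M \<Gamma> \<Longrightarrow> \<exists>M'. M \<longmapsto> M' \<and> N \<equiv>\<^sub>\<pi> translate M'"
proof (induction M arbitrary: N \<Gamma>)
  case (Par M M')
  then have ok: "ok M \<Gamma>" "ok M' \<Gamma>" by auto
  note pol = trans_polarised[OF _ ok(1)] trans_polarised[OF _ ok(2)]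
  from Par.prems have "trans_pi (PPar (translate M) (translate M')) LTau N" by simp
  then show ?case
  proof (cases rule: PPar_trans)
    case (1 X)
    from Par.IH(1)[OF 1(2) ok(1)] obtain M1 where M1: "M \<longmapsto> M1" "X \<equiv>\<^sub>\<pi> translate M1" by blast
    have "N \<equiv>\<^sub>\<pi> translate (Par M1 M')" using 1 M1 peq_Par by simp
    with red_Par[OF M1(1)] show ?thesis by blast
  next
    case (2 X)
    from Par.IH(2)[OF 2(2) ok(2)] obtain M1 where M1: "M' \<longmapsto> M1" "X \<equiv>\<^sub>\<pi> translate M1" by blast
    have "N \<equiv>\<^sub>\<pi> translate (Par M M1)" using 2 M1 peq_Par by simp
    with red_Par_right[OF M1(1)] show ?thesis by blast
  next
    case (3 a X v Y)
    with pol(1)[OF 3(3)] pol(2)[OF 3(4)] show ?thesis by auto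
  next
    case (4 a v X Y)
    with pol(1)[OF 4(3)] pol(2)[OF 4(4)] show ?thesis by auto
  next
    case (5 a X Y)
    with pol(1)[OF 5(3)] pol(2)[OF 5(4)] show ?thesis by auto
  next
    case (6 a X Y)
    with pol(1)[OF 6(3)] pol(2)[OF 6(4)] show ?thesis by auto
  qed
next
  case (Res T M)
  from Res.prems(2) obtain S where S: "ok M (OT S \<cdot> IT S \<cdot> \<Gamma>)" by auto
  let ?\<Gamma> = "OT S \<cdot> IT S \<cdot> \<Gamma>"
  \<comment> \<open>\<open>identify\<close> merges only the indices 0 and 1, and polarity makes 0
    the output subject and 1 the input subject.\<close>
  have pair: "a = Var 0 \<and> c = Var 1"
    if "a \<noteq> c" "nsub (renaming identify) a = nsub (renaming identify) c"
      "polarised ?\<Gamma> (LBOut a)" "polarised ?\<Gamma> (LIn c)" for a c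
  proof (cases a)
    case (Var m)
    with that obtain k where k: "c = Var k" by (cases c) auto
    with Var that have "m \<le> 1" "k \<le> 1" "m \<noteq> k" by (auto simp: identify_def)
    with Var k that(3,4) show ?thesis by (cases m; cases k) auto
  next
    case (Success w)
    with that show ?thesis by (cases c) auto
  qed
  from Res.prems(1) obtain X where X: "trans_pi (pren identify (translate M)) LTau X" "N = PNu X"
    by (auto elim: PNu_trans)
  from trans_psub_inv[OF X(1)] show ?case unfolding reacts_def
  proof (elim disjE exE conjE)
    fix l N\<^sub>0
    assume *: "trans_pi (translate M) l N\<^sub>0" "LTau = lsub (renaming identify) l"
      "X = psub (lifts l (renaming identify)) N\<^sub>0"
    then have l: "l = LTau" by simp
    from Res.IH[OF *(1)[unfolded l] S] obtain M' where M': "M \<longmapsto> M'" "N\<^sub>0 \<equiv>\<^sub>\<pi> translate M'" by blast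
    have "N \<equiv>\<^sub>\<pi> translate (Res T M')" unfolding X(2) *(3) l
      using peq_Nu[OF peq_psub[OF M'(2)]] by simp
    with red_Res[OF M'(1)] show ?thesis by blast
  next
    fix a c v P\<^sub>1 P\<^sub>2
    assume *: "trans_pi (translate M) (LOut a v) P\<^sub>1" "trans_pi P\<^sub>1 (LIn c) P\<^sub>2" "a \<noteq> c"
      "nsub (renaming identify) a = nsub (renaming identify) c"
      "X \<equiv>\<^sub>\<pi> psub (case_nat (vsub (renaming identify) v) (renaming identify)) P\<^sub>2"
    obtain M1 where M1: "M \<simeq> Par (Out (Nm a) v) M1" "P\<^sub>1 \<equiv>\<^sub>\<pi> translate M1"
      using LOut_scong[OF *(1)] by blast
    obtain P3 where P3: "trans_pi (translate M1) (LIn c) P3" "P\<^sub>2 \<equiv>\<^sub>\<pi> P3"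
      using peq_trans_pi[OF M1(2) *(2)] .
    have "ok M1 ?\<Gamma>" using scong_ok[OF M1(1)] S by auto
    then have ac: "a = Var 0 \<and> c = Var 1"
      using pair[OF *(3,4)] trans_polarised[OF *(1) S] trans_polarised[OF P3(1)] by simp
    obtain M' where M': "\<And>T Q. Res T (Par (ren (\<lambda>n. n) M1) (Par (Out (Nm (Var 0)) v) Q)) \<longmapsto> Res T (Par M' Q)"
      "translate M' \<equiv>\<^sub>\<pi> psub (case_nat v (renaming (\<lambda>n. n))) P3"
      using LIn_red[of M1 1 P3 "\<lambda>n. n" v] P3(1) ac by auto
    have id: "ren (\<lambda>n. n) M1 = M1" by (simp add: renaming_def)
    have "Res T M \<simeq> Res T (Par M1 (Par (Out (Nm (Var 0)) v) Inert))"
      using sc_Res[OF sc_trans[OF M1(1) out_last]] ac by simp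
    from red_scong[OF this M'(1)[unfolded id] sc_Res[OF sc_unit]] have "Res T M \<longmapsto> Res T M'" .
    moreover have "N \<equiv>\<^sub>\<pi> translate (Res T M')"
    proof -
      have "X \<equiv>\<^sub>\<pi> psub (case_nat (vsub (renaming identify) v) (renaming identify)) P3"
        using *(5) peq_psub[OF P3(2)] peq_trans by blast
      also have "\<dots> = pren identify (psub (case_nat v (renaming (\<lambda>n. n))) P3)"
        unfolding psub_psub by (rule psub_cong) (auto split: nat.splits)
      also have "\<dots> \<equiv>\<^sub>\<pi> pren identify (translate M')" by (rule peq_psub[OF peq_sym[OF M'(2)]])
      finally show ?thesis unfolding X(2) translate.simps by (rule peq_Nu)
    qed
    ultimately show ?thesis by blast
  next
    fix a c P\<^sub>1 P\<^sub>2
    assume *: "trans_pi (translate M) (LBOut a) P\<^sub>1" "trans_pi P\<^sub>1 (LIn (shift_name c)) P\<^sub>2" "a \<noteq> c"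
      "nsub (renaming identify) a = nsub (renaming identify) c"
      "X \<equiv>\<^sub>\<pi> PNu (psub (case_nat (Nm (Var 0)) (lift (renaming identify))) P\<^sub>2)"
    obtain U u M1 where M1: "M \<simeq> Res U (Par (Out (Nm (shift_name (shift_name a))) (Nm (Var u))) M1)"
      "u < 2" "P\<^sub>1 \<equiv>\<^sub>\<pi> pren identify (translate M1)"
      using LBOut_scong[OF *(1)] by blast
    obtain P3 where P3: "trans_pi (pren identify (translate M1)) (LIn (shift_name c)) P3" "P\<^sub>2 \<equiv>\<^sub>\<pi> P3"
      using peq_trans_pi[OF M1(3) *(2)] .
    obtain P4 where P4: "trans_pi (translate M1) (LIn (shift_name (shift_name c))) P4"
      "P3 = psub (lift (renaming identify)) P4"
      using P3(1) by (auto elim!: identify_trans simp: nsub_identify_shift)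
    obtain A where "ok M1 (OT A \<cdot> IT A \<cdot> ?\<Gamma>)" using scong_ok[OF M1(1), of ?\<Gamma>] S by auto
    from trans_polarised[OF P4(1) this] have "polarised ?\<Gamma> (LIn c)" by simp
    with trans_polarised[OF *(1) S] have ac: "a = Var 0 \<and> c = Var 1" by (intro pair[OF *(3,4)])
    \<comment> \<open>The exchange of the pairs moves the end \<open>u\<close> of the extruded pair
      past the pair of \<open>T\<close>, hence the offset 2.\<close>
    let ?u = "Nm (Var (u + 2))"
    obtain M' where M': "\<And>T Q. Res T (Par (ren swap_pairs M1) (Par (Out (Nm (Var 0)) ?u) Q)) \<longmapsto> Res T (Par M' Q)"
      "translate M' \<equiv>\<^sub>\<pi> psub (case_nat ?u (renaming swap_pairs)) P4"
      using LIn_red[of M1 3 P4 swap_pairs ?u] P4(1) ac by (auto simp: numeral_eq_Suc)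
    have swap: "ren swap_pairs (Par (Out (Nm (shift_name (shift_name a))) (Nm (Var u))) M1) =
        Par (Out (Nm (Var 0)) ?u) (ren swap_pairs M1)"
      using ac M1(2) by (simp add: swap_pairs_def[of u])
    have "Res T M \<simeq> Res T (Res U (Par (Out (Nm (shift_name (shift_name a))) (Nm (Var u))) M1))"
      using M1(1) by (rule sc_Res)
    also have "\<dots> \<simeq> Res U (Res T (Par (Out (Nm (Var 0)) ?u) (ren swap_pairs M1)))"
      unfolding swap[symmetric] by (rule sc_swap)
    also have "\<dots> \<simeq> Res U (Res T (Par (ren swap_pairs M1) (Par (Out (Nm (Var 0)) ?u) Inert)))"
      by (intro sc_Res out_last)
    finally have "Res T M \<simeq> Res U (Res T (Par (ren swap_pairs M1) (Par (Out (Nm (Var 0)) ?u) Inert)))" .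
    from red_scong[OF this red_Res[OF M'(1)] sc_Res[OF sc_Res[OF sc_unit]]]
    have "Res T M \<longmapsto> Res U (Res T M')" .
    moreover have "N \<equiv>\<^sub>\<pi> translate (Res U (Res T M'))"
    proof -
      have "X \<equiv>\<^sub>\<pi> PNu (psub (case_nat (Nm (Var 0)) (lift (renaming identify))) P3)"
        using *(5) peq_Nu[OF peq_psub[OF P3(2)]] peq_trans by blast
      then have "N \<equiv>\<^sub>\<pi> PNu (PNu (psub (case_nat (Nm (Var 0)) (lift (renaming identify))) P3))"
        unfolding X(2) by (rule peq_Nu)
      also note peq_swap
      also have "PNu (PNu (pren swap01 (psub (case_nat (Nm (Var 0)) (lift (renaming identify))) P3))) =
          PNu (pren identify (PNu (pren identify (psub (case_nat ?u (renaming swap_pairs)) P4))))"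
        unfolding P4(2) psub.simps psub_psub
      proof (intro arg_cong[where f = PNu], rule psub_cong, goal_cases)
        case (1 n)
        show ?case using M1(2)
          by (cases n rule: nat_cases_2; cases "n - 2" rule: nat_cases_2;
              cases "n - 4" rule: nat_cases_2) (auto simp: identify_def numeral_eq_Suc less_Suc_eq)
      qed
      also have "\<dots> \<equiv>\<^sub>\<pi> PNu (pren identify (PNu (pren identify (translate M'))))"
        by (intro peq_Nu peq_psub peq_sym[OF M'(2)])
      finally show ?thesis by simp
    qed
    ultimately show ?thesis by blast
  qed
qed auto

lemma taus_reds:
  assumes "taus (translate M) N" "ok M \<Gamma>"
  shows "\<exists>M'. M \<longmapsto>* M' \<and> ok M' \<Gamma> \<and> N \<equiv>\<^sub>\<pi> translate M'"
  using assms
proof (induction rule: taus_induct)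
  case (step N N')
  then obtain M' where M': "M \<longmapsto>* M'" "ok M' \<Gamma>" "N \<equiv>\<^sub>\<pi> translate M'" by blast
  obtain N1 where N1: "trans_pi (translate M') LTau N1" "N' \<equiv>\<^sub>\<pi> N1"
    using peq_trans_pi[OF M'(3) step(2)] .
  from tau_red[OF N1(1) M'(2)] obtain M'' where "M' \<longmapsto> M''" "N1 \<equiv>\<^sub>\<pi> translate M''" by blast
  with M' N1 red_ok show ?case by (meson rtranclp.rtrancl_into_rtrancl peq_trans)
qed auto

lemma barb_translate:
  assumes "barb M w" shows "\<exists>N. trans_pi (translate M) (LOut (Success w) Star) N"
proof -
  obtain M' where "M \<simeq> Par (Out (Nm (Success w)) Star) M'" using assms unfolding barb_def ..
  from peq_sym[OF scong_translate[OF this]] tr_ParL[OF tr_Out]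
  show ?thesis by (metis peq_trans_pi translate.simps(2,4))
qed

lemma translate_barb: "trans_pi (translate M) (LOut (Success w) Star) N \<Longrightarrow> barb M w"
  unfolding barb_def using LOut_scong by blast

lemma peq_bisimilar:
  assumes "P \<equiv>\<^sub>\<pi> Q" shows "P \<approx>\<^sub>\<pi> Q"
proof -
  have step: "\<exists>Q'. weak_trans Q l Q' \<and> P' \<equiv>\<^sub>\<pi> Q'" if "P \<equiv>\<^sub>\<pi> Q" "trans_pi P l P'" for P Q l P'
    using that by (metis peq_trans_pi weak_transI taus_refl)
  show ?thesis by (rule weak_bisimilarI[of peq, OF peq_sym step assms])
qed

text \<open>A barb is an output on a success name and thus visible to
  \<open>\<approx>\<^sub>\<pi>\<close>. Answers of the translation are read back as reductions by
  \<open>taus_reds\<close>; typing in the empty environment makes this applicable, persists under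
  reduction, and forces closedness.\<close>

lemma translate_adequate:
  assumes "ok M (\<lambda>_. None)" "ok N (\<lambda>_. None)" "translate M \<approx>\<^sub>\<pi> translate N"
  shows "M \<approx> N"
proof -
  let ?R = "\<lambda>M N. ok M (\<lambda>_. None) \<and> ok N (\<lambda>_. None) \<and> translate M \<approx>\<^sub>\<pi> translate N"
  have "barbed_bisimulation ?R" unfolding barbed_bisimulation_def
  proof (intro conjI allI impI)
    show "symp ?R" using weak_bisimilar_sym by (auto intro!: sympI)
  next
    fix M N assume R: "?R M N"
    then show "closed_proc M" "closed_proc N" by (auto intro: ok_closed)
    show "weak_barb N w" if "barb M w" for w
    proof -
      obtain X where "trans_pi (translate M) (LOut (Success w) Star) X"
        using barb_translate \<open>barb M w\<close> by blast
      then obtain Y where "weak_trans (translate N) (LOut (Success w) Star) Y"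
        using R weak_bisimilarD by blast
      then obtain N1 N2 where N12: "taus (translate N) N1" "trans_pi N1 (LOut (Success w) Star) N2"
        by (auto elim: weak_transE)
      obtain N' where "N \<longmapsto>* N'" "N1 \<equiv>\<^sub>\<pi> translate N'" using taus_reds[OF N12(1)] R by blast
      then show ?thesis unfolding weak_barb_def
        using translate_barb peq_trans_pi[OF _ N12(2)] by metis
    qed
    show "\<exists>N'. N \<longmapsto>* N' \<and> ?R M' N'" if "M \<longmapsto> M'" for M'
    proof -
      obtain X where X: "trans_pi (translate M) LTau X" "X \<equiv>\<^sub>\<pi> translate M'"
        using red_translate \<open>M \<longmapsto> M'\<close> by blast
      obtain Y where Y: "weak_trans (translate N) LTau Y" "X \<approx>\<^sub>\<pi> Y"
        using R weak_bisimilarD[OF _ X(1)] by blast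
      obtain N' where "N \<longmapsto>* N'" "ok N' (\<lambda>_. None)" "Y \<equiv>\<^sub>\<pi> translate N'"
        using taus_reds[of N Y] Y R by auto
      moreover from this X Y have "translate M' \<approx>\<^sub>\<pi> translate N'"
        by (meson peq_bisimilar peq_sym weak_bisimilar_trans)
      ultimately show ?thesis using R red_ok[OF \<open>M \<longmapsto> M'\<close>] by blast
    qed
  qed
  with assms show ?thesis unfolding barbed_bisimilar_def by blast
qed

section \<open>Contexts\<close>

definition var_env :: "env \<Rightarrow> tyenv" where
  "var_env \<Gamma> = (\<lambda>n. \<Gamma> (Var n))"

text \<open>The part of \<open>wf_env\<close> that matches the fixed type which \<open>nty\<close>
  gives to success names.\<close>

definition success_ok :: "env \<Rightarrow> bool" where
  "success_ok \<Gamma> \<longleftrightarrow> (\<forall>w T. \<Gamma> (Success w) = Some T \<longrightarrow> T = OT UnitT)"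

lemma success_ok_wf: "wf_env \<Gamma> \<Longrightarrow> success_ok \<Gamma>"
  unfolding wf_env_def success_ok_def by (metis domI option.inject)

lemma var_env_bind [simp]: "var_env (bind T \<Gamma>) = T \<cdot> var_env \<Gamma>"
  by (auto simp: var_env_def bind_def fun_eq_iff split: nat.splits)

lemma success_ok_bind [simp]: "success_ok (bind T \<Gamma>) = success_ok \<Gamma>"
  by (simp add: success_ok_def bind_def)

lemma success_ok_upd [simp]: "success_ok (\<Gamma>(Var x \<mapsto> T)) = success_ok \<Gamma>"
  by (simp add: success_ok_def)

lemma success_ok_add: "success_ok \<Gamma>\<^sub>1 \<Longrightarrow> success_ok \<Gamma>\<^sub>2 \<Longrightarrow> success_ok (\<Gamma>\<^sub>1 ++ \<Gamma>\<^sub>2)"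
  by (auto simp: success_ok_def map_add_def split: option.splits)

lemma nty_var_env: "success_ok \<Gamma> \<Longrightarrow> \<Gamma> a = Some T \<Longrightarrow> nty (var_env \<Gamma>) a = Some T"
  by (cases a) (auto simp: var_env_def success_ok_def)

lemma vty_var_env: "success_ok \<Gamma> \<Longrightarrow> val_ty \<Gamma> v = Some T \<Longrightarrow> vty (var_env \<Gamma>) v = Some T"
  by (cases v) (auto intro: nty_var_env)

text \<open>Weakening of an environment is treated as the identity substitution, so that the
  substitution lemmas cover it.\<close>

lemma sub_typed_le: "\<Gamma> \<subseteq>\<^sub>m \<Delta> \<Longrightarrow> sub_typed (var_env \<Gamma>) (\<lambda>n. Nm (Var n)) (var_env \<Delta>)"
  unfolding sub_typed_def var_env_def map_le_def by simp (metis domI)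

lemma ok_weaken: "ok P (var_env \<Gamma>) \<Longrightarrow> \<Gamma> \<subseteq>\<^sub>m \<Delta> \<Longrightarrow> ok P (var_env \<Delta>)"
  using ok_sub[OF _ sub_typed_le] by fastforce

lemma agree_le:
  assumes "agree \<Gamma>\<^sub>1 \<Gamma>\<^sub>2" shows "\<Gamma>\<^sub>1 \<subseteq>\<^sub>m \<Gamma>\<^sub>1 ++ \<Gamma>\<^sub>2" "\<Gamma>\<^sub>2 \<subseteq>\<^sub>m \<Gamma>\<^sub>1 ++ \<Gamma>\<^sub>2"
  using assms unfolding agree_def map_le_def
  by (auto simp: map_add_def split: option.splits) (metis IntI domI option.inject)

lemma typed_ok: "\<Gamma> \<turnstile> P \<Longrightarrow> success_ok \<Gamma> \<and> ok P (var_env \<Gamma>)"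
proof (induction rule: typed.induct)
  case (typed_Par \<Gamma>\<^sub>1 P\<^sub>1 \<Gamma>\<^sub>2 P\<^sub>2)
  then show ?case by (auto intro: success_ok_add ok_weaken agree_le)
next
  case (typed_Rep T \<Gamma>\<^sub>o P \<Gamma> a)
  then show ?case
    using ok_sub[OF _ sub_typed_lift[OF sub_typed_le[OF typed_Rep(4)]], of P T]
    by (auto simp: lift_id success_ok_wf nty_var_env)
qed (auto simp: success_ok_wf nty_var_env vty_var_env)

text \<open>The invariant of the induction on contexts. It is stated with \<open>ok\<close> instead
  of \<open>\<turnstile>\<close>, so that disjointness of input names need not be tracked in
  parallel compositions.\<close>

definition related :: "env \<Rightarrow> proc \<Rightarrow> proc \<Rightarrow> bool" where
  "related \<Gamma> P Q \<longleftrightarrow> success_ok \<Gamma> \<and> ok P (var_env \<Gamma>) \<and> ok Q (var_env \<Gamma>) \<and>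
    tbis (erase_env (var_env \<Gamma>)) (translate P) (translate Q)"

lemma sub_typed_renaming: "sub_typed (\<lambda>n. \<Gamma> (f n)) (renaming f) \<Gamma>"
  by (simp add: sub_typed_def)

lemma tbis_pren: "tbis (\<lambda>n. \<Gamma> (f n)) P Q \<Longrightarrow> tbis \<Gamma> (pren f P) (pren f Q)"
  by (rule tbis_psub[OF _ sub_typed_renaming])

lemma erase_env_comp: "erase_env (\<lambda>n. \<Gamma> (f n)) = (\<lambda>n. erase_env \<Gamma> (f n))"
  by (simp add: erase_env_def)

lemma sub_typed_erase_le: "\<Gamma> \<subseteq>\<^sub>m \<Delta> \<Longrightarrow>
    sub_typed (erase_env (var_env \<Gamma>)) (\<lambda>n. Nm (Var n)) (erase_env (var_env \<Delta>))"
  using sub_typed_le[of \<Gamma> \<Delta>] by (auto simp: sub_typed_def erase_env_def)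

lemma related_weaken:
  "related \<Gamma> P Q \<Longrightarrow> \<Gamma> \<subseteq>\<^sub>m \<Delta> \<Longrightarrow> success_ok \<Delta> \<Longrightarrow> related \<Delta> P Q"
  unfolding related_def using ok_weaken tbis_psub[OF _ sub_typed_erase_le] by fastforce

lemma related_Par:
  assumes "related \<Gamma> P Q" "\<Gamma>' \<turnstile> R" "\<Gamma> \<subseteq>\<^sub>m \<Delta>" "\<Gamma>' \<subseteq>\<^sub>m \<Delta>" "success_ok \<Delta>"
  shows "related \<Delta> (Par P R) (Par Q R)" "related \<Delta> (Par R P) (Par R Q)"
proof -
  have "related \<Delta> P Q" using assms related_weaken by blast
  moreover have "ok R (var_env \<Delta>)" using assms ok_weaken typed_ok by blast
  ultimately show "related \<Delta> (Par P R) (Par Q R)" "related \<Delta> (Par R P) (Par R Q)"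
    unfolding related_def by (auto intro: tbis_ParL tbis_ParR ok_translate)
qed

text \<open>Connects the named binders of contexts with indices: the renaming on the right is that
  of \<open>abs1\<close>, so \<open>ok_ren\<close> and \<open>tbis_pren\<close> apply.\<close>

lemma var_env_upd: "var_env (\<Gamma>(Var x \<mapsto> T)) = (\<lambda>n. (T \<cdot> var_env \<Gamma>) (if n = x then 0 else n + 1))"
  by (auto simp: var_env_def)

lemma related_abs1:
  assumes "related (\<Gamma>(Var x \<mapsto> T)) P Q"
  shows "ok (abs1 x P) (T \<cdot> var_env \<Gamma>)" "ok (abs1 x Q) (T \<cdot> var_env \<Gamma>)"
    "tbis (erase T \<cdot> erase_env (var_env \<Gamma>)) (translate (abs1 x P)) (translate (abs1 x Q))"
  using assms
    erase_env_comp[of "T \<cdot> var_env \<Gamma>" "\<lambda>n. if n = x then 0 else n + 1"]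
  unfolding related_def abs1_def ok_ren var_env_upd translate_sub erase_env_cons[symmetric]
  by (auto intro: tbis_pren simp del: erase_env_cons)

lemma related_Res:
  assumes "related (\<Gamma>(Var a \<mapsto> IT T, Var b \<mapsto> OT T)) P Q" "a \<noteq> b"
  shows "related \<Gamma> (Res (IT T) (abs2 a b P)) (Res (IT T) (abs2 a b Q))"
proof -
  let ?f = "\<lambda>n. if n = b then 0 else if n = a then 1 else n + 2"
  have env: "var_env (\<Gamma>(Var a \<mapsto> IT T, Var b \<mapsto> OT T)) = (\<lambda>n. (OT T \<cdot> IT T \<cdot> var_env \<Gamma>) (?f n))"
    using assms(2) by (auto simp: var_env_def)
  have "tbis (OT (erase T) \<cdot> OT (erase T) \<cdot> erase_env (var_env \<Gamma>))
      (pren ?f (translate P)) (pren ?f (translate Q))"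
  proof (rule tbis_pren)
    show "tbis (\<lambda>n. (OT (erase T) \<cdot> OT (erase T) \<cdot> erase_env (var_env \<Gamma>)) (?f n)) (translate P) (translate Q)"
      using assms(1) erase_env_comp[of "OT T \<cdot> IT T \<cdot> var_env \<Gamma>" ?f]
      unfolding related_def env by simp
  qed
  from tbis_Nu[OF tbis_psub[OF this sub_typed_identify]] assms(1) show ?thesis
    unfolding related_def env by (auto simp: abs2_def ok_ren translate_sub simp del: psub_psub)
qed

lemma related_fill:
  assumes "ctx_typed \<Delta> \<Gamma> C" and P: "\<Delta> \<turnstile> P" and Q: "\<Delta> \<turnstile> Q" and PQ: "translate P \<approx>\<^sub>\<pi> translate Q"
  shows "related \<Gamma> (fill C P) (fill C Q)"
  using assms(1)
proof induction
  case (ctx_Hole \<Gamma>)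
  have "related \<Delta> P Q" unfolding related_def tbis_def
    using typed_ok[OF P] typed_ok[OF Q] ok_translate PQ by blast
  with ctx_Hole show ?case using related_weaken success_ok_wf unfolding extends_def by simp
next
  case (ctx_ParL \<Gamma>\<^sub>1 C \<Gamma>\<^sub>2 R)
  then show ?case
    using related_Par(1)[OF _ ctx_ParL(2) agree_le[OF ctx_ParL(3)]] typed_ok success_ok_add
    by (auto simp: related_def)
next
  case (ctx_ParR \<Gamma>\<^sub>1 R \<Gamma>\<^sub>2 C)
  then show ?case
    using related_Par(2)[OF _ ctx_ParR(1) agree_le(2,1)[OF ctx_ParR(3)]] typed_ok success_ok_add
    by (auto simp: related_def)
next
  case (ctx_Res \<Gamma> a T b C)
  show ?case unfolding fill.simps by (rule related_Res[OF ctx_Res.IH ctx_Res.hyps(2)])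
next
  case (ctx_In \<Gamma> a T x C)
  then have s: "success_ok \<Gamma>" unfolding related_def success_ok_upd by blast
  have "vty (var_env \<Gamma>) (Nm a) = Some (IT T)" using nty_var_env[OF s ctx_In(1)] by simp
  with related_abs1[OF ctx_In.IH] s show ?case
    unfolding related_def by (auto intro!: tbis_In)
next
  case (ctx_Rep \<Gamma>\<^sub>o x T C \<Gamma> a)
  have s: "success_ok \<Gamma>" using ctx_Rep success_ok_wf by blast
  \<comment> \<open>The body was typed in the output-only part \<open>\<Gamma>\<^sub>o\<close>;
    \<open>tbis_Rep\<close> wants it in the environment that also types the subject
    \<open>a\<close>.\<close>
  have "related (\<Gamma>(Var x \<mapsto> T)) (fill C P) (fill C Q)"
    by (rule related_weaken[OF ctx_Rep.IH])
      (simp_all only: map_le_upd[OF \<open>\<Gamma>\<^sub>o \<subseteq>\<^sub>m \<Gamma>\<close>] success_ok_upd s)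
  moreover have "vty (var_env \<Gamma>) (Nm a) = Some (IT T)" using nty_var_env[OF s] ctx_Rep by simp
  ultimately show ?case using related_abs1[of \<Gamma> x T "fill C P" "fill C Q"] s
    unfolding related_def[of \<Gamma>] by (auto intro!: tbis_Rep)
qed

theorem theorem5p1:
  fixes \<Delta> :: env and P Q :: proc
  assumes "\<Delta> \<turnstile> P" and "\<Delta> \<turnstile> Q"
    and "translate P \<approx>\<^sub>\<pi> translate Q"
  shows "barbed_congruent \<Delta> P Q"
  unfolding barbed_congruent_def
proof (intro conjI allI impI assms(1,2))
  fix C assume "closing \<Delta> C"
  then obtain \<Gamma> where \<Gamma>: "dom \<Gamma> \<subseteq> range Success" "ctx_typed \<Delta> \<Gamma> C"
    unfolding closing_def by blast
  \<comment> \<open>The domain consists of success names, whose type is built into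
    \<open>nty\<close>; no variable remains, as adequacy demands.\<close>
  have "var_env \<Gamma> = (\<lambda>_. None)" using \<Gamma>(1) by (force simp: var_env_def)
  with related_fill[OF \<Gamma>(2) assms] show "fill C P \<approx> fill C Q"
    unfolding related_def tbis_def by (intro translate_adequate) auto
qed

end
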